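(* Let $p\ge1$ and $\alpha\ge0$, and define $T_{t,p}f(s)=e^{-t/p}f(e^{-t}s)$ for $t,s\in\mathbb{R}$ and $f\in\mathcal{T}_p^{(\alpha)}(|t|^\alpha)$. Then: (i) $(T_{t,p})_{t\in\mathbb{R}}$ is a $C_0$-group of isometries on $\mathcal{T}_p^{(\alpha)}(|t|^\alpha)$ whose infinitesimal generator $\Lambda$ is given by $(\Lambda f)(s)=-sf'(s)-\frac1pf(s)$ with domain $D(\Lambda)=\mathcal{T}_p^{(\alpha+1)}(|t|^{\alpha+1})$; (ii) $\sigma_p(\Lambda)=\emptyset$ and $\sigma(\Lambda)=i\mathbb{R}$, where $\sigma_p$ denotes the point spectrum and $\sigma$ the spectrum; (iii) if $p>1$ and $\frac1p+\frac1{p'}=1$, the semigroups $(T_{t,p})_{t\ge0}$ on $\mathcal{T}_p^{(\alpha)}(|t|^\alpha)$ and $(T_{-t,p'})_{t\ge0}$ on $\mathcal{T}_{p'}^{(\alpha)}(|t|^\alpha)$ are dual to each other: $\langle T_{t,p}f,g\rangle_\alpha=\langle f,T_{-t,p'}g\rangle_\alpha$ for all $t\ge0$.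
   Context: Let $\mathcal{S}$ be the Schwartz class on $\mathbb{R}$. For $\alpha>0$, $f\in\mathcal{S}$, $x\in\mathbb{R}$ and $n=[\alpha]+1$: $W_+^{-\alpha}f(x)=\frac{1}{\Gamma(\alpha)}\int_x^\infty(s-x)^{\alpha-1}f(s)\,ds$, $W_+^\alpha f(x)=(-1)^n\frac{d^n}{dx^n}W_+^{-(n-\alpha)}f(x)$, $W_-^{\alpha}f(x)=\frac{1}{\Gamma(n-\alpha)}\frac{d^n}{dx^n}\int_{-\infty}^x(x-t)^{n-\alpha-1}f(t)\,dt$, and $W_\pm^0f=f$. Set $W_0^\alpha f(t)=W_-^\alpha f(t)$ for $t<0$ and $W_0^\alpha f(t)=e^{i\pi\alpha}W_+^\alpha f(t)$ for $t>0$. For $1\le p<\infty$, $\mathcal{T}_p^{(\alpha)}(|t|^\alpha)$ is the completion of $\mathcal{S}$ in the norm $|||f|||_{\alpha,p}=\frac{1}{\Gamma(\alpha+1)}\left(\int_{-\infty}^\infty(|W_0^\alpha f(t)|\,|t|^\alpha)^p\,dt\right)^{1/p}$ (for $\alpha=0$ it is $L^p(\mathbb{R})$); it embeds continuously into $L^p(\mathbb{R})$. For $p>1$, $\mathcal{T}_{p'}^{(\alpha)}(|t|^\alpha)$ is the dual of $\mathcal{T}_p^{(\alpha)}(|t|^\alpha)$ via $\langle f,g\rangle_\alpha=\frac{1}{\Gamma(\alpha+1)^2}\int_{-\infty}^\infty W_0^\alpha f(t)W_0^\alpha g(t)|t|^{2\alpha}\,dt$. *)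

theory Defs
  imports "HOL-Analysis.Analysis"
begin

fun nderiv :: "nat \<Rightarrow> (real \<Rightarrow> complex) \<Rightarrow> real \<Rightarrow> complex" where
  "nderiv 0 f = f"
| "nderiv (Suc n) f = (\<lambda>x. vector_derivative (nderiv n f) (at x))"

definition schwartz :: "(real \<Rightarrow> complex) \<Rightarrow> bool" where
  "schwartz f \<longleftrightarrow>
     (\<forall>n x. (nderiv n f has_vector_derivative nderiv (Suc n) f x) (at x)) \<and>
     (\<forall>k n. \<exists>C. \<forall>x. \<bar>x\<bar> ^ k * norm (nderiv n f x) \<le> C)"

definition weyl_int_plus :: "real \<Rightarrow> (real \<Rightarrow> complex) \<Rightarrow> real \<Rightarrow> complex" where
  "weyl_int_plus a f x = complex_of_real (1 / Gamma a) *
     (LINT s:{x<..}|lborel. complex_of_real ((s - x) powr (a - 1)) * f s)"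

definition weyl_plus :: "real \<Rightarrow> (real \<Rightarrow> complex) \<Rightarrow> real \<Rightarrow> complex" where
  "weyl_plus a f x = (if a = 0 then f x else
     (let n = nat \<lfloor>a\<rfloor> + 1 in (-1) ^ n * nderiv n (weyl_int_plus (real n - a) f) x))"

definition weyl_minus :: "real \<Rightarrow> (real \<Rightarrow> complex) \<Rightarrow> real \<Rightarrow> complex" where
  "weyl_minus a f x = (if a = 0 then f x else
     (let n = nat \<lfloor>a\<rfloor> + 1 in complex_of_real (1 / Gamma (real n - a)) *
        nderiv n (\<lambda>y. LINT t:{..<y}|lborel.
                          complex_of_real ((y - t) powr (real n - a - 1)) * f t) x))"

text \<open>W_0^a (the value at t = 0 is irrelevant, a null set; we put 0).\<close>
definition weyl0 :: "real \<Rightarrow> (real \<Rightarrow> complex) \<Rightarrow> real \<Rightarrow> complex" where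
  "weyl0 a f t = (if t < 0 then weyl_minus a f t
                  else if t > 0 then exp (\<i> * complex_of_real (pi * a)) * weyl_plus a f t
                  else 0)"

definition tnorm :: "real \<Rightarrow> real \<Rightarrow> (real \<Rightarrow> complex) \<Rightarrow> real" where
  "tnorm a p f = (1 / Gamma (a + 1)) *
     (LINT t|lborel. (norm (weyl0 a f t) * \<bar>t\<bar> powr a) powr p) powr (1 / p)"

definition tpair0 :: "real \<Rightarrow> (real \<Rightarrow> complex) \<Rightarrow> (real \<Rightarrow> complex) \<Rightarrow> complex" where
  "tpair0 a f g = complex_of_real (1 / (Gamma (a + 1))\<^sup>2) *
     (LINT t|lborel. weyl0 a f t * weyl0 a g t * complex_of_real (\<bar>t\<bar> powr (2 * a)))"

text \<open>phi is a |||.|||_{a,p}-Cauchy sequence of Schwartz functions converging in L^p to g.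
  Since T_p^{(a)} embeds continuously into L^p, its elements are represented by
  (a.e. classes of) L^p functions.\<close>
definition approx_seq :: "real \<Rightarrow> real \<Rightarrow> (nat \<Rightarrow> real \<Rightarrow> complex) \<Rightarrow> (real \<Rightarrow> complex) \<Rightarrow> bool" where
  "approx_seq a p \<phi> g \<longleftrightarrow>
     (\<forall>n. schwartz (\<phi> n)) \<and>
     (\<forall>e>0. \<exists>N. \<forall>m\<ge>N. \<forall>n\<ge>N. tnorm a p (\<lambda>x. \<phi> m x - \<phi> n x) < e) \<and>
     g \<in> borel_measurable lborel \<and> integrable lborel (\<lambda>x. norm (g x) powr p) \<and>
     (\<lambda>n. LINT x|lborel. norm (\<phi> n x - g x) powr p) \<longlonglongrightarrow> 0"

definition Tsp :: "real \<Rightarrow> real \<Rightarrow> (real \<Rightarrow> complex) set" where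
  "Tsp a p = {g. \<exists>\<phi>. approx_seq a p \<phi> g}"

text \<open>Norm on the completion (extension by continuity).\<close>
definition Tnorm :: "real \<Rightarrow> real \<Rightarrow> (real \<Rightarrow> complex) \<Rightarrow> real" where
  "Tnorm a p g = lim (\<lambda>n. tnorm a p ((SOME \<phi>. approx_seq a p \<phi> g) n))"

text \<open>Pairing between T_p^{(a)} and T_q^{(a)} (extension by continuity).\<close>
definition Tpair :: "real \<Rightarrow> real \<Rightarrow> real \<Rightarrow> (real \<Rightarrow> complex) \<Rightarrow> (real \<Rightarrow> complex) \<Rightarrow> complex" where
  "Tpair a p q f g = lim (\<lambda>n. tpair0 a ((SOME \<phi>. approx_seq a p \<phi> f) n)
                                         ((SOME \<psi>. approx_seq a q \<psi> g) n))"

definition dil :: "real \<Rightarrow> real \<Rightarrow> (real \<Rightarrow> complex) \<Rightarrow> real \<Rightarrow> complex" where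
  "dil p t f = (\<lambda>s. complex_of_real (exp (- t / p)) * f (exp (- t) * s))"

definition c0_group_isom ::
  "real \<Rightarrow> real \<Rightarrow> (real \<Rightarrow> (real \<Rightarrow> complex) \<Rightarrow> real \<Rightarrow> complex) \<Rightarrow> bool" where
  "c0_group_isom a p T \<longleftrightarrow>
     (\<forall>t. \<forall>f\<in>Tsp a p. T t f \<in> Tsp a p \<and> Tnorm a p (T t f) = Tnorm a p f) \<and>
     (\<forall>f. T 0 f = f) \<and>
     (\<forall>t u f. T (t + u) f = T t (T u f)) \<and>
     (\<forall>f\<in>Tsp a p. ((\<lambda>t. Tnorm a p (\<lambda>s. T t f s - f s)) \<longlongrightarrow> 0) (at 0))"

definition is_gen :: "real \<Rightarrow> real \<Rightarrow> (real \<Rightarrow> complex) \<Rightarrow> (real \<Rightarrow> complex) \<Rightarrow> bool" where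
  "is_gen a p f h \<longleftrightarrow> f \<in> Tsp a p \<and> h \<in> Tsp a p \<and>
     ((\<lambda>t. Tnorm a p (\<lambda>s. (dil p t f s - f s) / complex_of_real t - h s)) \<longlongrightarrow> 0) (at 0)"

definition gen_domain :: "real \<Rightarrow> real \<Rightarrow> (real \<Rightarrow> complex) set" where
  "gen_domain a p = {f. \<exists>h. is_gen a p f h}"

text \<open>h(s) = - s f'(s) - f(s)/p, with f' the distributional derivative of f
  (tested against Schwartz functions): <-s f', phi> = <f, (s phi)'>.\<close>
definition gen_formula :: "real \<Rightarrow> (real \<Rightarrow> complex) \<Rightarrow> (real \<Rightarrow> complex) \<Rightarrow> bool" where
  "gen_formula p f h \<longleftrightarrow>
     (\<forall>\<phi>. schwartz \<phi> \<longrightarrow>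
        (LINT s|lborel. (h s + f s / complex_of_real p) * \<phi> s) =
        (LINT s|lborel. f s * nderiv 1 (\<lambda>x. complex_of_real x * \<phi> x) s))"

definition point_spectrum :: "real \<Rightarrow> real \<Rightarrow> complex set" where
  "point_spectrum a p = {z. \<exists>f h. is_gen a p f h \<and> \<not> (AE x in lborel. f x = 0) \<and>
                                  (AE x in lborel. h x = z * f x)}"

definition resolvent_set :: "real \<Rightarrow> real \<Rightarrow> complex set" where
  "resolvent_set a p = {z.
     (\<forall>g\<in>Tsp a p. \<exists>f h. is_gen a p f h \<and> (AE x in lborel. z * f x - h x = g x)) \<and>
     (\<forall>f h. is_gen a p f h \<and> (AE x in lborel. z * f x - h x = 0) \<longrightarrow> (AE x in lborel. f x = 0)) \<and>
     (\<exists>C. \<forall>f h. is_gen a p f h \<longrightarrow> Tnorm a p f \<le> C * Tnorm a p (\<lambda>x. z * f x - h x))}"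

definition spectrum_gen :: "real \<Rightarrow> real \<Rightarrow> complex set" where
  "spectrum_gen a p = - resolvent_set a p"

end

theory Submission
  imports Defs "HOL-Computational_Algebra.Polynomial"
begin

text \<open>
  Write \<open>T\<^sub>t\<close> for the dilations. For a Schwartz function the weighted derivative \<open>|x|\<^sup>a W\<^sub>0\<^sup>a \<phi>\<close>
  commutes with \<open>T\<^sub>t\<close>, and it is inverted by an Erdelyi-Kober operator, that is by an average
  \<open>\<integral> k(t) T\<^sub>t F dt\<close> of dilations with an integrable kernel. Such averages are bounded on \<open>L\<^sup>p\<close> by
  Minkowski's integral inequality and they commute. The index law for fractional integrals, which is
  a Beta integral for the kernels, makes the Erdelyi-Kober operators injective and the weighted
  derivatives of Schwartz functions dense in \<open>L\<^sup>p\<close>. Hence the completion is an isometric copy of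
  \<open>L\<^sup>p\<close> on which the group is again \<open>T\<^sub>t\<close>, and everything reduces to \<open>L\<^sup>p\<close>.

  There the resolvents are averages with kernels \<open>e\<^sup>-\<^sup>z\<^sup>t\<close> on a half-line. The Erdelyi-Kober operator of order 1
  is one of them, so its range is the domain of the generator, and the index law identifies the
  domain for order \<open>a\<close> with the space of order \<open>a + 1\<close>. An eigenvector would satisfy
  \<open>T\<^sub>t F = e\<^sup>z\<^sup>t F\<close>, which no nonzero \<open>L\<^sup>p\<close> function does, and differences of the resolvents at
  \<open>i y + \<epsilon>\<close> and \<open>i y - \<epsilon>\<close> supply approximate eigenvectors for every imaginary \<open>i y\<close>.
\<close>

section \<open>The spaces L^p\<close>

text \<open>Norm and pairing of the completion are limits along one sequence picked by
  \<open>SOME\<close>, so they are under control only once the limit of the weighted derivatives is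
  known to depend on the element alone: completeness of L^p provides that limit, and injectivity of
  the Erdelyi-Kober operators fixes it. A plain derivative does not commute with dilations, but x^j
  times the j-th derivative does. All derivatives are carried in that form: |x|^a W^a is, up to sign
  and phase, an average of order n - a applied to x^n d^n, with n = [a] + 1. The phase e^(i pi a)
  has modulus 1 and is constant on each half-line; it disturbs neither norms nor dilations and
  survives only as a square in the bilinear pairing. The parameter \<nu> of an average records the
  power of x in front of it. It has to be shifted by the order before two averages compose to a
  third, and \<nu> + 1/p > 0 provides the decay of the kernel at minus infinity, also for \<nu> =
  0.\<close>

definition Lp :: "real \<Rightarrow> (real \<Rightarrow> complex) set" where
  "Lp p = {f \<in> borel_measurable borel. integrable lborel (\<lambda>x. norm (f x) powr p)}"

text \<open>The Bochner integral of a non-integrable function is 0, so a value of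
  \<open>Lnorm\<close> is informative only for members of \<open>Lp p\<close>; membership is
  therefore carried along with the estimates.\<close>

definition Lnorm :: "real \<Rightarrow> (real \<Rightarrow> complex) \<Rightarrow> real" where
  "Lnorm p f = (LINT x|lborel. norm (f x) powr p) powr (1 / p)"

text \<open>Convexity of the p-th power, in the tangent-line form that feeds both the triangle
  inequality and Jensen's inequality. The point v = 0 lies outside the open half-line where
  convexity is invoked and reduces to (1 - p) a^p <= 0.\<close>

lemma powr_tangent:
  fixes a v p :: real
  assumes "1 \<le> p" "0 \<le> v" "0 < a"
  shows "a powr p + p * a powr (p - 1) * (v - a) \<le> v powr p"
proof (cases "v = 0")
  case True
  have "a powr p = a powr (p - 1) * a" using assms by (simp add: powr_mult_base mult.commute)
  then have "a powr p + p * a powr (p - 1) * (v - a) = (1 - p) * a powr p"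
    using True by (simp add: algebra_simps)
  also have "\<dots> \<le> 0" using assms by (simp add: mult_nonpos_nonneg)
  finally show ?thesis by (rule order_trans) simp
next
  case False
  have "((\<lambda>x. x powr p) has_real_derivative (p * a powr (p - 1))) (at a within {0<..})"
    using has_real_derivative_powr[OF assms(3)] by (rule has_field_derivative_at_within)
  then have "v powr p - a powr p \<ge> p * a powr (p - 1) * (v - a)"
    using convex_on_imp_above_tangent[OF powr_convex[OF assms(1)], of a v "p * a powr (p - 1)"]
      assms False by (auto simp: interior_open)
  then show ?thesis by simp
qed

text \<open>Regard a + b as the mean of a/l and b/(1 - l) with weights l and 1 - l and add the
  tangent inequalities at that mean: the linear terms cancel. The weight stays free because the
  triangle inequality needs the optimal one.\<close>

lemma powr_add_le:
  fixes a b l p :: real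
  assumes "1 \<le> p" "0 \<le> a" "0 \<le> b" "0 < l" "l < 1"
  shows "(a + b) powr p \<le> l powr (1 - p) * a powr p + (1 - l) powr (1 - p) * b powr p"
proof (cases "a + b = 0")
  case True
  then show ?thesis using assms by (simp add: add_nonneg_eq_0_iff)
next
  case False
  define s where "s = a + b"
  have s: "s > 0" using False assms by (simp add: s_def)
  have e: "m * (c / m) powr p = m powr (1 - p) * c powr p" if "0 < m" "0 \<le> c" for m c :: real
    using that by (simp add: powr_divide powr_diff)
  have "l * (s powr p + p * s powr (p - 1) * (a / l - s))
      + (1 - l) * (s powr p + p * s powr (p - 1) * (b / (1 - l) - s))
      \<le> l * (a / l) powr p + (1 - l) * (b / (1 - l)) powr p"
    using assms s by (intro add_mono mult_left_mono powr_tangent) auto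
  moreover have "l * (s powr p + p * s powr (p - 1) * (a / l - s))
      + (1 - l) * (s powr p + p * s powr (p - 1) * (b / (1 - l) - s))
      = s powr p + p * s powr (p - 1) * (a + b - s)"
    using assms by (simp add: field_simps)
  ultimately show ?thesis using e[of l a] e[of "1 - l" b] assms by (simp add: s_def)
qed

lemma Lp_measurable [measurable_dest]: "f \<in> Lp p \<Longrightarrow> f \<in> borel_measurable borel"
  by (simp add: Lp_def)

lemma Lp_integrable: "f \<in> Lp p \<Longrightarrow> integrable lborel (\<lambda>x. norm (f x) powr p)"
  by (simp add: Lp_def)

lemma LpI: "f \<in> borel_measurable borel \<Longrightarrow> integrable lborel (\<lambda>x. norm (f x) powr p) \<Longrightarrow> f \<in> Lp p"
  by (simp add: Lp_def)

lemma Lnorm_nonneg [simp]: "0 \<le> Lnorm p f"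
  by (simp add: Lnorm_def)

lemma Lnorm_cong_AE:
  assumes "AE x in lborel. f x = g x"
    and [measurable]: "f \<in> borel_measurable borel" "g \<in> borel_measurable borel"
  shows "Lnorm p f = Lnorm p g"
proof -
  have "(LINT x|lborel. norm (f x) powr p) = (LINT x|lborel. norm (g x) powr p)"
    using assms(1) by (intro integral_cong_AE) auto
  then show ?thesis by (simp add: Lnorm_def)
qed

lemma Lp_cong_AE:
  assumes "AE x in lborel. f x = g x" "f \<in> Lp p" "g \<in> borel_measurable borel"
  shows "g \<in> Lp p"
proof (rule LpI[OF assms(3)])
  have [measurable]: "f \<in> borel_measurable borel" "g \<in> borel_measurable borel" using assms by auto
  have "AE x in lborel. norm (f x) powr p = norm (g x) powr p" using assms(1) by auto
  then show "integrable lborel (\<lambda>x. norm (g x) powr p)"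
    using Lp_integrable[OF assms(2)] by (subst integrable_cong_AE[where g="\<lambda>x. norm (f x) powr p"]) auto
qed

lemma Lp_bound:
  assumes "f \<in> Lp p" and [measurable]: "g \<in> borel_measurable borel"
    and "AE x in lborel. norm (g x) \<le> c * norm (f x)" "0 \<le> p" "0 \<le> c"
  shows "g \<in> Lp p"
proof (rule LpI)
  have 1: "integrable lborel (\<lambda>x. c powr p * norm (f x) powr p)" using Lp_integrable[OF assms(1)] by simp
  have 2: "AE x in lborel. norm (norm (g x) powr p) \<le> norm (c powr p * norm (f x) powr p)"
    using assms(3)
  proof eventually_elim
    case (elim x)
    have "norm (g x) powr p \<le> (c * norm (f x)) powr p"
      using elim assms by (intro powr_mono2) auto
    then show ?case using assms by (simp add: powr_mult)
  qed
  show "integrable lborel (\<lambda>x. norm (g x) powr p)"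
    by (rule Bochner_Integration.integrable_bound[OF 1 _ 2]) auto
qed fact

lemma integrable_inverse_1_plus_square: "integrable lborel (\<lambda>x::real. inverse (1 + x\<^sup>2))"
proof -
  have "set_integrable lborel (einterval (-\<infinity>) \<infinity>) (\<lambda>x. inverse (1 + x\<^sup>2) :: real)"
  proof (rule interval_integral_FTC_nonneg(1)[where F = arctan and A = "-pi/2" and B = "pi/2"])
    show "((arctan \<circ> real_of_ereal) \<longlongrightarrow> - pi / 2) (at_right (- \<infinity>))"
      by (auto simp: ereal_tendsto_simps intro!: filterlim_mono[OF tendsto_arctan_at_bot])
    show "((arctan \<circ> real_of_ereal) \<longlongrightarrow> pi / 2) (at_left \<infinity>)"
      by (auto simp: ereal_tendsto_simps tendsto_arctan_at_top)
    show "(arctan has_real_derivative inverse (1 + x\<^sup>2)) (at x)" for x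
      by (auto intro!: derivative_eq_intros)
    show "isCont (\<lambda>x. inverse (1 + x\<^sup>2)) x" for x :: real
      by (auto intro!: continuous_intros simp: add_nonneg_eq_0_iff)
  qed auto
  then show ?thesis by (simp add: set_integrable_def)
qed

context
  fixes p :: real
  assumes p1: "1 \<le> p"
begin

lemma Lnorm_powr: "Lnorm p f powr p = (LINT x|lborel. norm (f x) powr p)"
  using p1 by (simp add: Lnorm_def powr_powr)

lemma Lnorm_le_iff: "0 \<le> c \<Longrightarrow> Lnorm p f \<le> c \<longleftrightarrow> (LINT x|lborel. norm (f x) powr p) \<le> c powr p"
  using powr_mono2[of p "Lnorm p f" c] powr_less_mono2[of p c "Lnorm p f"] p1
  unfolding Lnorm_powr[symmetric] by (force simp: not_le[symmetric])

lemma Lp_zero [simp]: "(\<lambda>x. 0) \<in> Lp p"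
  by (simp add: Lp_def)

lemma Lnorm_zero [simp]: "Lnorm p (\<lambda>x. 0) = 0"
  by (simp add: Lnorm_def)

lemma Lnorm_eq_0:
  assumes "f \<in> Lp p"
  shows "Lnorm p f = 0 \<longleftrightarrow> (AE x in lborel. f x = 0)"
proof -
  have "Lnorm p f = 0 \<longleftrightarrow> (LINT x|lborel. norm (f x) powr p) = 0"
    by (simp add: Lnorm_def)
  also have "\<dots> \<longleftrightarrow> (AE x in lborel. norm (f x) powr p = 0)"
    using Lp_integrable[OF assms] by (intro integral_nonneg_eq_0_iff_AE) auto
  finally show ?thesis by simp
qed

lemma Lp_scale:
  assumes "f \<in> Lp p" shows "(\<lambda>x. c * f x) \<in> Lp p"
  using Lp_bound[OF assms, of "\<lambda>x. c * f x" "norm c"] Lp_measurable[OF assms] p1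
  by (auto simp: norm_mult)

lemma Lnorm_scale: "Lnorm p (\<lambda>x. c * f x) = norm c * Lnorm p f"
proof -
  have "(LINT x|lborel. norm (c * f x) powr p) = norm c powr p * (LINT x|lborel. norm (f x) powr p)"
    by (simp add: norm_mult powr_mult)
  then show ?thesis using p1 by (simp add: Lnorm_def powr_mult powr_powr)
qed

lemma Lp_add:
  assumes "f \<in> Lp p" "g \<in> Lp p" shows "(\<lambda>x. f x + g x) \<in> Lp p"
proof (rule LpI)
  show [measurable]: "(\<lambda>x. f x + g x) \<in> borel_measurable borel" using assms[THEN Lp_measurable] by simp
  have "norm (f x + g x) powr p \<le> (1/2) powr (1 - p) * norm (f x) powr p + (1/2) powr (1 - p) * norm (g x) powr p" for x
  proof -
    have "norm (f x + g x) powr p \<le> (norm (f x) + norm (g x)) powr p"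
      using p1 by (intro powr_mono2 norm_triangle_ineq) auto
    then show ?thesis using powr_add_le[OF p1, of "norm (f x)" "norm (g x)" "1/2"] by simp
  qed
  then have 2: "norm (norm (f x + g x) powr p)
      \<le> norm ((1/2) powr (1 - p) * norm (f x) powr p + (1/2) powr (1 - p) * norm (g x) powr p)" for x
    by (smt (verit) powr_ge_zero real_norm_def)
  have 1: "integrable lborel (\<lambda>x. (1/2) powr (1 - p) * norm (f x) powr p + (1/2) powr (1 - p) * norm (g x) powr p)"
    using assms[THEN Lp_integrable] by (intro Bochner_Integration.integrable_add integrable_mult_right)
  show "integrable lborel (\<lambda>x. norm (f x + g x) powr p)"
    by (rule Bochner_Integration.integrable_bound[OF 1 _ AE_I2[OF 2]]) measurable
qed

lemma Lp_diff:
  assumes "f \<in> Lp p" "g \<in> Lp p" shows "(\<lambda>x. f x - g x) \<in> Lp p"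
  using Lp_add[OF assms(1) Lp_scale[OF assms(2), of "-1"]] by simp

lemma Lnorm_triangle:
  assumes f: "f \<in> Lp p" and g: "g \<in> Lp p"
  shows "Lnorm p (\<lambda>x. f x + g x) \<le> Lnorm p f + Lnorm p g"
proof -
  note [measurable] = f[THEN Lp_measurable] g[THEN Lp_measurable]
  define A B where "A = Lnorm p f" and "B = Lnorm p g"
  consider "A = 0" | "B = 0" | "A > 0" "B > 0"
    using Lnorm_nonneg unfolding A_def B_def by (metis less_eq_real_def)
  then show ?thesis
  proof cases
    case 1
    then have "AE x in lborel. f x + g x = g x" using Lnorm_eq_0[OF f] by (auto simp: A_def)
    then have "Lnorm p (\<lambda>x. f x + g x) = Lnorm p g" by (intro Lnorm_cong_AE) auto
    then show ?thesis by simp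
  next
    case 2
    then have "AE x in lborel. f x + g x = f x" using Lnorm_eq_0[OF g] by (auto simp: B_def)
    then have "Lnorm p (\<lambda>x. f x + g x) = Lnorm p f" by (intro Lnorm_cong_AE) auto
    then show ?thesis by simp
  next
    case 3
    have e: "(a / s) powr (1 - p) * a powr p = s powr (p - 1) * a" if "a > 0" "s > 0" for a s :: real
      using powr_add[of a "1 - p" p] powr_minus[of s "1 - p"] that by (simp add: powr_divide field_simps)
    \<comment> \<open>The optimal weight: both terms become multiples of (A + B)^(p-1) and add up to
      exactly (A + B)^p.\<close>
    define l where "l = A / (A + B)"
    have l: "0 < l" "l < 1" "1 - l = B / (A + B)" using 3 by (auto simp: l_def field_simps)
    have "(LINT x|lborel. norm (f x + g x) powr p)
        \<le> (LINT x|lborel. l powr (1 - p) * norm (f x) powr p + (1 - l) powr (1 - p) * norm (g x) powr p)"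
    proof (rule integral_mono)
      show "norm (f x + g x) powr p \<le> l powr (1 - p) * norm (f x) powr p + (1 - l) powr (1 - p) * norm (g x) powr p" for x
        using powr_add_le[OF p1 _ _ l(1,2), of "norm (f x)" "norm (g x)"] p1
        by (intro order_trans[OF powr_mono2[OF _ _ norm_triangle_ineq]]) auto
    qed (use Lp_integrable[OF Lp_add[OF f g]] Lp_integrable[OF f] Lp_integrable[OF g] in auto)
    also have "\<dots> = l powr (1 - p) * A powr p + (1 - l) powr (1 - p) * B powr p"
      using Lp_integrable[OF f] Lp_integrable[OF g] by (simp add: A_def B_def Lnorm_powr)
    also have "l powr (1 - p) * A powr p = (A + B) powr (p - 1) * A"
      unfolding l_def using e[of A "A + B"] 3 by simp
    also have "(1 - l) powr (1 - p) * B powr p = (A + B) powr (p - 1) * B"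
      unfolding l(3) using e[of B "A + B"] 3 by simp
    also have "(A + B) powr (p - 1) * A + (A + B) powr (p - 1) * B = (A + B) powr p"
      using powr_add[of "A + B" "p - 1" 1] 3 by (simp add: ring_distribs)
    finally show ?thesis using 3 by (simp add: Lnorm_le_iff A_def B_def)
  qed
qed

lemma Lnorm_minus_commute: "Lnorm p (\<lambda>x. f x - g x) = Lnorm p (\<lambda>x. g x - f x)"
  by (simp add: Lnorm_def norm_minus_commute)

lemma Lnorm_triangle3:
  assumes "f \<in> Lp p" "g \<in> Lp p" "h \<in> Lp p"
  shows "Lnorm p (\<lambda>x. f x - h x) \<le> Lnorm p (\<lambda>x. f x - g x) + Lnorm p (\<lambda>x. g x - h x)"
  using Lnorm_triangle[OF Lp_diff[OF assms(1,2)] Lp_diff[OF assms(2,3)]] by simp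

lemma Lnorm_diff_ineq:
  assumes "f \<in> Lp p" "g \<in> Lp p"
  shows "\<bar>Lnorm p f - Lnorm p g\<bar> \<le> Lnorm p (\<lambda>x. f x - g x)"
proof -
  have "Lnorm p f \<le> Lnorm p (\<lambda>x. f x - g x) + Lnorm p g"
    using Lnorm_triangle3[OF assms Lp_zero] by simp
  moreover have "Lnorm p g \<le> Lnorm p (\<lambda>x. g x - f x) + Lnorm p f"
    using Lnorm_triangle3[OF assms(2,1) Lp_zero] by simp
  ultimately show ?thesis unfolding Lnorm_minus_commute[of g f] by linarith
qed

lemma Lnorm_tendsto:
  assumes "\<And>n. f n \<in> Lp p" "g \<in> Lp p" "((\<lambda>n. Lnorm p (\<lambda>x. f n x - g x)) \<longlongrightarrow> 0) F"
  shows "((\<lambda>n. Lnorm p (f n)) \<longlongrightarrow> Lnorm p g) F"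
proof (rule Lim_transform2[OF tendsto_const])
  show "((\<lambda>n. Lnorm p g - Lnorm p (f n)) \<longlongrightarrow> 0) F"
    using Lnorm_diff_ineq[OF assms(1,2)]
    by (intro Lim_null_comparison[OF _ assms(3)]) (auto simp: abs_minus_commute)
qed

lemma Lnorm_mono:
  assumes f: "f \<in> Lp p" and [measurable]: "g \<in> borel_measurable borel"
    and le: "AE x in lborel. norm (g x) \<le> norm (f x)"
  shows "Lnorm p g \<le> Lnorm p f"
proof -
  have g: "g \<in> Lp p" by (rule Lp_bound[OF f, where c=1]) (use le p1 in auto)
  have "(LINT x|lborel. norm (g x) powr p) \<le> (LINT x|lborel. norm (f x) powr p)"
  proof (rule integral_mono_AE)
    show "AE x in lborel. norm (g x) powr p \<le> norm (f x) powr p"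
      using le by eventually_elim (use p1 in \<open>auto intro: powr_mono2\<close>)
  qed (use Lp_integrable[OF f] Lp_integrable[OF g] in auto)
  then show ?thesis by (simp add: Lnorm_le_iff Lnorm_powr)
qed

lemma Lnorm_tendsto_0_iff:
  "((\<lambda>n. Lnorm p (f n)) \<longlongrightarrow> 0) F \<longleftrightarrow> ((\<lambda>n. LINT x|lborel. norm (f n x) powr p) \<longlongrightarrow> 0) F"
proof
  assume "((\<lambda>n. Lnorm p (f n)) \<longlongrightarrow> 0) F"
  then have "((\<lambda>n. Lnorm p (f n) powr p) \<longlongrightarrow> 0 powr p) F"
    using p1 by (intro tendsto_powr2) auto
  then show "((\<lambda>n. LINT x|lborel. norm (f n x) powr p) \<longlongrightarrow> 0) F" using p1 by (simp add: Lnorm_powr)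
next
  assume "((\<lambda>n. LINT x|lborel. norm (f n x) powr p) \<longlongrightarrow> 0) F"
  then have "((\<lambda>n. Lnorm p (f n)) \<longlongrightarrow> 0 powr (1 / p)) F"
    unfolding Lnorm_def using p1 by (intro tendsto_powr2) auto
  then show "((\<lambda>n. Lnorm p (f n)) \<longlongrightarrow> 0) F" by simp
qed

lemma Lp_dominated_convergence:
  fixes f :: "nat \<Rightarrow> real \<Rightarrow> complex"
  assumes [measurable]: "\<And>n. f n \<in> borel_measurable borel" and g: "g \<in> Lp p" and w: "w \<in> Lp p"
    and lim: "AE x in lborel. (\<lambda>n. f n x) \<longlonglongrightarrow> g x"
    and bd: "\<And>n. AE x in lborel. norm (f n x) \<le> norm (w x)"
  shows "(\<lambda>n. Lnorm p (\<lambda>x. f n x - g x)) \<longlonglongrightarrow> 0"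
proof -
  note [measurable] = g[THEN Lp_measurable] w[THEN Lp_measurable]
  have "(\<lambda>n. LINT x|lborel. norm (f n x - g x) powr p) \<longlonglongrightarrow> (LINT x::real|lborel. 0::real)"
  \<comment> \<open>The majorant is (|w| + |g|)^p; the moduli are cast to complex functions so that
    closure of \<open>Lp p\<close> under addition shows it integrable.\<close>
  proof (rule integral_dominated_convergence[where w="\<lambda>x. norm (complex_of_real (norm (w x)) + complex_of_real (norm (g x))) powr p"])
    have "(\<lambda>x. complex_of_real (norm (w x))) \<in> Lp p" by (rule Lp_bound[OF w, of _ 1]) (use p1 in auto)
    moreover have "(\<lambda>x. complex_of_real (norm (g x))) \<in> Lp p" by (rule Lp_bound[OF g, of _ 1]) (use p1 in auto)
    ultimately show "integrable lborel (\<lambda>x. norm (complex_of_real (norm (w x)) + complex_of_real (norm (g x))) powr p)"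
      using Lp_add Lp_integrable by blast
    show "AE x in lborel. (\<lambda>n. norm (f n x - g x) powr p) \<longlonglongrightarrow> 0"
      using lim
    proof eventually_elim
      case (elim x)
      then have "(\<lambda>n. norm (f n x - g x)) \<longlonglongrightarrow> 0" by (simp add: tendsto_norm_zero_iff LIM_zero)
      then have "(\<lambda>n. norm (f n x - g x) powr p) \<longlonglongrightarrow> 0 powr p" using p1 by (intro tendsto_powr2) auto
      then show ?case using p1 by simp
    qed
    show "AE x in lborel. norm (norm (f n x - g x) powr p)
        \<le> norm (complex_of_real (norm (w x)) + complex_of_real (norm (g x))) powr p" for n
      using bd[of n]
    proof eventually_elim
      case (elim x)
      have "norm (f n x - g x) \<le> norm (w x) + norm (g x)" using elim norm_triangle_ineq4[of "f n x" "g x"] by linarith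
      also have "\<dots> = norm (complex_of_real (norm (w x)) + complex_of_real (norm (g x)))"
        by (metis abs_of_nonneg add_nonneg_nonneg norm_ge_zero norm_of_real of_real_add)
      finally show ?case using p1 by (auto intro: powr_mono2)
    qed
  qed auto
  then show ?thesis by (simp add: Lnorm_tendsto_0_iff)
qed

text \<open>The exponent p >= 1 only shrinks the majorant 1/(1 + x^2) <= 1, so one quadratic decay
  bound gives membership for every p at once.\<close>

lemma Lp_bounded_decay:
  assumes [measurable]: "f \<in> borel_measurable borel" and bd: "\<And>x. norm (f x) * (1 + x\<^sup>2) \<le> C"
  shows "f \<in> Lp p"
proof (rule LpI)
  have C: "C \<ge> 0" using bd[of 0] order_trans[OF norm_ge_zero[of "f 0"]] by simp
  have 1: "integrable lborel (\<lambda>x. C powr p * inverse (1 + x\<^sup>2))"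
    using integrable_inverse_1_plus_square by simp
  have 2: "norm (norm (f x) powr p) \<le> norm (C powr p * inverse (1 + x\<^sup>2))" for x
  proof -
    have pos: "1 + x\<^sup>2 > 0" by (simp add: add_pos_nonneg)
    have "norm (f x) \<le> C * inverse (1 + x\<^sup>2)" using bd[of x] pos by (simp add: field_simps)
    then have "norm (f x) powr p \<le> (C * inverse (1 + x\<^sup>2)) powr p" using p1 by (intro powr_mono2) auto
    also have "\<dots> = C powr p * inverse (1 + x\<^sup>2) powr p" using C pos by (simp add: powr_mult)
    also have "inverse (1 + x\<^sup>2) powr p \<le> inverse (1 + x\<^sup>2) powr 1"
      using p1 pos by (intro powr_mono') (auto simp: field_simps)
    finally show ?thesis using pos by (simp add: mult_left_mono)
  qed
  show "integrable lborel (\<lambda>x. norm (f x) powr p)"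
    by (rule Bochner_Integration.integrable_bound[OF 1 _ AE_I2[OF 2]]) measurable
qed fact

end

section \<open>Completeness, the inequalities of Jensen and Minkowski, and dilations on L^p\<close>

context
  fixes p :: real
  assumes p1: "1 \<le> p"
begin

text \<open>Riesz-Fischer: along a subsequence the differences d_k are so small that the integrals
  of (2^k |d_k|)^p are summable, hence |d_k| <= 2^-k eventually at almost every point and the
  subsequence converges there. Fatou's lemma turns the pointwise limit into a limit in norm.\<close>

lemma Lp_complete:
  fixes f :: "nat \<Rightarrow> real \<Rightarrow> complex"
  assumes f: "\<And>n. f n \<in> Lp p"
    and cau: "\<And>e. e > 0 \<Longrightarrow> \<exists>N. \<forall>m\<ge>N. \<forall>n\<ge>N. Lnorm p (\<lambda>x. f m x - f n x) < e"
  shows "\<exists>g\<in>Lp p. (\<lambda>n. Lnorm p (\<lambda>x. f n x - g x)) \<longlonglongrightarrow> 0"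
proof -
  note fm [measurable] = f[THEN Lp_measurable]
  have "\<forall>k. \<exists>N. \<forall>m\<ge>N. \<forall>n\<ge>N. Lnorm p (\<lambda>x. f m x - f n x) < (1/4)^k"
    by (intro allI cau) simp
  then obtain N where N: "\<And>k m n. m \<ge> N k \<Longrightarrow> n \<ge> N k \<Longrightarrow> Lnorm p (\<lambda>x. f m x - f n x) < (1/4)^k"
    by metis
  \<comment> \<open>The sum makes the indices monotone and at least \<open>N k\<close>; the added k
    makes them tend to infinity, which the Fatou step needs.\<close>
  define r where "r k = (\<Sum>i\<le>k. N i) + k" for k
  have r_ge: "r k \<ge> N k" for k
    unfolding r_def by (intro trans_le_add1 member_le_sum) auto
  have r_mono: "r k \<le> r (Suc k)" for k by (simp add: r_def)
  have r_id: "r k \<ge> k" for k by (simp add: r_def)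
  define d where "d k x = f (r (Suc k)) x - f (r k) x" for k x
  have dm [measurable]: "d k \<in> borel_measurable borel" for k unfolding d_def by measurable
  have dp: "d k \<in> Lp p" for k unfolding d_def by (intro Lp_diff p1 f)
  have dn: "Lnorm p (d k) \<le> (1/4)^k" for k
    unfolding d_def by (intro less_imp_le N order_trans[OF r_ge r_mono] r_ge)
  have trm: "(\<integral>\<^sup>+x. ennreal ((2^k * norm (d k x)) powr p) \<partial>lborel) \<le> ennreal ((1/2)^k)" for k
  proof -
    have "(\<integral>\<^sup>+x. ennreal ((2^k * norm (d k x)) powr p) \<partial>lborel)
        = (\<integral>\<^sup>+x. ennreal ((2^k) powr p * norm (d k x) powr p) \<partial>lborel)" by (simp add: powr_mult)
    also have "\<dots> = ennreal (LINT x|lborel. (2^k) powr p * norm (d k x) powr p)"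
      using Lp_integrable[OF dp] by (intro nn_integral_eq_integral) auto
    also have "(LINT x|lborel. (2^k) powr p * norm (d k x) powr p) = (2^k * Lnorm p (d k)) powr p"
      by (simp add: Lnorm_powr p1 powr_mult)
    also have "\<dots> \<le> (2^k * (1/4)^k) powr p" using dn p1 by (intro powr_mono2) auto
    also have "(2^k * (1/4)^k :: real) = (1/2)^k" by (simp flip: power_mult_distrib)
    also have "((1/2)^k) powr p \<le> ((1/2)^k) powr 1" using p1 by (intro powr_mono') (auto simp: power_le_one)
    finally show ?thesis by (simp add: ennreal_leI)
  qed
  have "(\<integral>\<^sup>+x. (\<Sum>k. ennreal ((2^k * norm (d k x)) powr p)) \<partial>lborel)
      = (\<Sum>k. \<integral>\<^sup>+x. ennreal ((2^k * norm (d k x)) powr p) \<partial>lborel)"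
    by (rule nn_integral_suminf) measurable
  also have "\<dots> \<le> (\<Sum>k. ennreal ((1/2)^k))" by (intro suminf_le trm) auto
  also have "\<dots> = ennreal (\<Sum>k. (1/2)^k)" by (intro suminf_ennreal2) (auto intro: summable_geometric)
  also have "\<dots> < \<infinity>" by simp
  finally have "AE x in lborel. (\<Sum>k. ennreal ((2^k * norm (d k x)) powr p)) \<noteq> \<infinity>"
    by (intro nn_integral_PInf_AE) auto
  then have conv: "AE x in lborel. convergent (\<lambda>k. f (r k) x)"
  proof eventually_elim
    case (elim x)
    then have "summable (\<lambda>k. (2^k * norm (d k x)) powr p)"
      by (intro summable_suminf_not_top) auto
    then have "(\<lambda>k. (2^k * norm (d k x)) powr p) \<longlonglongrightarrow> 0" by (rule summable_LIMSEQ_zero)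
    then have "eventually (\<lambda>k. (2^k * norm (d k x)) powr p < 1) sequentially"
      by (rule order_tendstoD) simp
    then have "eventually (\<lambda>k. norm (d k x) \<le> (1/2)^k) sequentially"
    proof eventually_elim
      case (elim k)
      then have "2^k * norm (d k x) \<le> 1"
        using p1 by (smt (verit) ge_one_powr_ge_zero)
      then show ?case by (simp add: field_simps power_one_over)
    qed
    then have "summable (\<lambda>k. d k x)"
      by (rule summable_comparison_test_ev) (auto intro: summable_geometric)
    then have "convergent (\<lambda>n. f (r 0) x + (\<Sum>k<n. d k x))"
      by (intro convergent_add convergent_const) (simp add: summable_iff_convergent)
    moreover have "f (r 0) x + (\<Sum>k<n. d k x) = f (r n) x" for n
      unfolding d_def using sum_lessThan_telescope[of "\<lambda>k. f (r k) x" n] by simp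
    ultimately show ?case by simp
  qed
  define g where "g x = lim (\<lambda>k. f (r k) x)" for x
  have gm [measurable]: "g \<in> borel_measurable borel" unfolding g_def by measurable
  have lim: "AE x in lborel. (\<lambda>k. f (r k) x) \<longlonglongrightarrow> g x"
    using conv unfolding g_def by eventually_elim (simp add: convergent_LIMSEQ_iff)
  \<comment> \<open>Fatou along the subsequence: a bound on \<open>f n - f m\<close> for all large m
    passes to \<open>f n - g\<close>, and membership of the difference in \<open>Lp p\<close> comes
    with it.\<close>
  have key: "(\<lambda>x. f n x - g x) \<in> Lp p \<and> Lnorm p (\<lambda>x. f n x - g x) \<le> e"
    if e: "e > 0" and M: "\<And>m. m \<ge> M \<Longrightarrow> Lnorm p (\<lambda>x. f n x - f m x) \<le> e" for n e M
  proof -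
    have "(\<integral>\<^sup>+x. ennreal (norm (f n x - g x) powr p) \<partial>lborel)
        = (\<integral>\<^sup>+x. liminf (\<lambda>k. ennreal (norm (f n x - f (r k) x) powr p)) \<partial>lborel)"
    proof (rule nn_integral_cong_AE, use lim in eventually_elim)
      case (elim x)
      have "(\<lambda>k. norm (f n x - f (r k) x) powr p) \<longlonglongrightarrow> norm (f n x - g x) powr p"
        using p1 elim by (intro tendsto_powr2 tendsto_intros) auto
      then have "(\<lambda>k. ennreal (norm (f n x - f (r k) x) powr p)) \<longlonglongrightarrow> ennreal (norm (f n x - g x) powr p)"
        by (intro tendsto_ennrealI)
      then show ?case by (intro lim_imp_Liminf[symmetric]) auto
    qed
    also have "\<dots> \<le> liminf (\<lambda>k. \<integral>\<^sup>+x. ennreal (norm (f n x - f (r k) x) powr p) \<partial>lborel)"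
      by (rule nn_integral_liminf) measurable
    also have "\<dots> \<le> liminf (\<lambda>k. ennreal (e powr p))"
    proof (rule Liminf_mono, rule eventually_sequentiallyI[of M])
      fix k assume "k \<ge> M"
      then have "Lnorm p (\<lambda>x. f n x - f (r k) x) \<le> e" using r_id[of k] by (intro M) auto
      then have "(LINT x|lborel. norm (f n x - f (r k) x) powr p) \<le> e powr p"
        using Lnorm_le_iff[OF p1] e by simp
      moreover have "(\<integral>\<^sup>+x. ennreal (norm (f n x - f (r k) x) powr p) \<partial>lborel) = ennreal (LINT x|lborel. norm (f n x - f (r k) x) powr p)"
        using Lp_integrable[OF Lp_diff[OF p1 f f]] by (intro nn_integral_eq_integral) auto
      ultimately show "(\<integral>\<^sup>+x. ennreal (norm (f n x - f (r k) x) powr p) \<partial>lborel) \<le> ennreal (e powr p)"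
        by (simp add: ennreal_leI)
    qed
    also have "\<dots> = ennreal (e powr p)" by (simp add: Liminf_const)
    finally have le: "(\<integral>\<^sup>+x. ennreal (norm (f n x - g x) powr p) \<partial>lborel) \<le> ennreal (e powr p)" .
    have int: "integrable lborel (\<lambda>x. norm (f n x - g x) powr p)"
      unfolding integrable_iff_bounded using le by (auto simp: top.not_eq_extremum[symmetric] less_top[symmetric] top_unique)
    have "(LINT x|lborel. norm (f n x - g x) powr p) \<le> e powr p"
      using le nn_integral_eq_integral[OF int] by (simp add: ennreal_le_iff)
    then show ?thesis using int e by (auto intro!: LpI simp: Lnorm_le_iff[OF p1])
  qed
  have ev: "\<exists>N. \<forall>n\<ge>N. (\<lambda>x. f n x - g x) \<in> Lp p \<and> Lnorm p (\<lambda>x. f n x - g x) \<le> e" if "e > 0" for e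
  proof -
    from cau[OF that] obtain N where "\<forall>m\<ge>N. \<forall>n\<ge>N. Lnorm p (\<lambda>x. f m x - f n x) < e" by blast
    then show ?thesis by (intro exI[of _ N] allI impI key[OF that, of N]) (auto intro: less_imp_le)
  qed
  obtain n where "(\<lambda>x. f n x - g x) \<in> Lp p" using ev[of 1] by auto
  from Lp_diff[OF p1 f[of n] this] have "g \<in> Lp p" by simp
  moreover have "(\<lambda>n. Lnorm p (\<lambda>x. f n x - g x)) \<longlonglongrightarrow> 0"
  proof (rule LIMSEQ_I)
    fix e :: real assume "e > 0"
    then obtain N where "\<forall>n\<ge>N. Lnorm p (\<lambda>x. f n x - g x) \<le> e/2" using ev[of "e/2"] by auto
    then show "\<exists>N. \<forall>n\<ge>N. norm (Lnorm p (\<lambda>x. f n x - g x) - 0) < e"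
      using \<open>e > 0\<close> by (intro exI[of _ N]) auto
  qed
  ultimately show ?thesis by blast
qed

text \<open>The weight has arbitrary finite total mass k, which costs the factor k^(p-1). The
  tangent line at the weighted mean a is integrated against w; a vanishing integral is split off
  because the tangent needs a > 0.\<close>

lemma jensen_powr:
  fixes w v :: "'a \<Rightarrow> real"
  assumes w: "integrable M w" "\<And>x. 0 \<le> w x" and [measurable]: "v \<in> borel_measurable M"
    and v: "\<And>x. 0 \<le> v x" and wv: "integrable M (\<lambda>x. w x * v x powr p)"
  shows "integrable M (\<lambda>x. w x * v x)"
    and "(LINT x|M. w x * v x) powr p \<le> (LINT x|M. w x) powr (p - 1) * (LINT x|M. w x * v x powr p)"
proof -
  note [measurable] = w(1)[THEN borel_measurable_integrable]
  show int: "integrable M (\<lambda>x. w x * v x)"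
  proof (rule Bochner_Integration.integrable_bound[of _ "\<lambda>x. w x + w x * v x powr p"])
    have "v x \<le> 1 + v x powr p" for x
    proof (cases "v x \<le> 1")
      case False
      then have "v x powr 1 \<le> v x powr p" using p1 by (intro powr_mono) auto
      then show ?thesis using False by simp
    qed (simp add: add_increasing2)
    then have "w x * v x \<le> w x + w x * v x powr p" for x
      using mult_left_mono[of "v x" "1 + v x powr p" "w x"] w(2) by (simp add: ring_distribs)
    then show "AE x in M. norm (w x * v x) \<le> norm (w x + w x * v x powr p)"
      using w(2) v by (intro AE_I2) (smt (verit) mult_nonneg_nonneg real_norm_def)
  qed (use w wv in auto)
  define k a where "k = (LINT x|M. w x)" and "a = (LINT x|M. w x * v x) / k"
  have nn: "0 \<le> k" "0 \<le> (LINT x|M. w x * v x)" "0 \<le> (LINT x|M. w x * v x powr p)"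
    unfolding k_def using w v by (auto intro!: integral_nonneg)
  show "(LINT x|M. w x * v x) powr p \<le> k powr (p - 1) * (LINT x|M. w x * v x powr p)"
  proof (cases "(LINT x|M. w x * v x) = 0")
    case True
    then show ?thesis using p1 nn by simp
  next
    case False
    have "k \<noteq> 0"
    proof
      assume "k = 0"
      then have "AE x in M. w x = 0" using integral_nonneg_eq_0_iff_AE[OF w(1)] w(2) by (simp add: k_def)
      then have "(LINT x|M. w x * v x) = (LINT x|M. 0)" by (intro integral_cong_AE) auto
      then show False using False by simp
    qed
    then have k: "k > 0" using nn by simp
    have a: "a > 0" using False nn k by (simp add: a_def less_le)
    have ka: "(LINT x|M. w x * v x) = k * a" using k by (simp add: a_def)
    have "(LINT x|M. a powr p * w x + p * a powr (p - 1) * (w x * v x - a * w x)) \<le> (LINT x|M. w x * v x powr p)"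
    proof (rule integral_mono)
      fix x
      have "w x * (a powr p + p * a powr (p - 1) * (v x - a)) \<le> w x * v x powr p"
        using a v w by (intro mult_left_mono powr_tangent p1) auto
      then show "a powr p * w x + p * a powr (p - 1) * (w x * v x - a * w x) \<le> w x * v x powr p"
        by (simp add: algebra_simps)
    qed (use w int wv in auto)
    also have "(LINT x|M. a powr p * w x + p * a powr (p - 1) * (w x * v x - a * w x)) = a powr p * k"
      using w int ka by (simp add: k_def)
    finally have "a powr p * k \<le> (LINT x|M. w x * v x powr p)" .
    then have "k powr (p - 1) * (a powr p * k) \<le> k powr (p - 1) * (LINT x|M. w x * v x powr p)"
      by (intro mult_left_mono) auto
    moreover have "k powr (p - 1) * (a powr p * k) = (k * a) powr p"
      using k a powr_add[of k "p - 1" 1] by (simp add: powr_mult)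
    ultimately show ?thesis by (simp add: ka)
  qed
qed

text \<open>Minkowski's integral inequality for a family of uniformly bounded norm: Jensen with
  weight |k| at each x, then Tonelli. The assumptions on \<open>u t\<close> are restricted to k(t)
  nonzero because the kernel 1/h on (0, h), used for the generator, meets a family that is small
  only there.\<close>

lemma Lnorm_integral_le:
  fixes u :: "'b \<Rightarrow> real \<Rightarrow> complex" and k :: "'b \<Rightarrow> complex"
  assumes N: "sigma_finite_measure N" and um [measurable]: "(\<lambda>(t, x). u t x) \<in> borel_measurable (N \<Otimes>\<^sub>M borel)"
    and k: "integrable N k"
    and u: "\<And>t. k t \<noteq> 0 \<Longrightarrow> u t \<in> Lp p" "\<And>t. k t \<noteq> 0 \<Longrightarrow> Lnorm p (u t) \<le> B" and B: "0 \<le> B"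
  shows "AE x in lborel. integrable N (\<lambda>t. k t * u t x)"
    and "(\<lambda>x. LINT t|N. k t * u t x) \<in> Lp p"
    and "Lnorm p (\<lambda>x. LINT t|N. k t * u t x) \<le> (LINT t|N. norm (k t)) * B"
proof -
  interpret sigma_finite_measure N by fact
  interpret NL: pair_sigma_finite N "lborel :: real measure" by standard
  have km [measurable]: "k \<in> borel_measurable N" using borel_measurable_integrable[OF k] .
  have um2 [measurable]: "(\<lambda>t. u t x) \<in> borel_measurable N" for x by measurable
  define \<kappa> where "\<kappa> = (LINT t|N. norm (k t))"
  define \<Phi> where "\<Phi> x = (LINT t|N. norm (k t) * norm (u t x) powr p)" for x
  have \<kappa>: "0 \<le> \<kappa>" by (simp add: \<kappa>_def)
  have "(\<integral>\<^sup>+x. (\<integral>\<^sup>+t. ennreal (norm (k t) * norm (u t x) powr p) \<partial>N) \<partial>lborel)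
      = (\<integral>\<^sup>+t. (\<integral>\<^sup>+x. ennreal (norm (k t) * norm (u t x) powr p) \<partial>lborel) \<partial>N)"
    by (rule NL.Fubini') measurable
  also have "\<dots> \<le> (\<integral>\<^sup>+t. ennreal (norm (k t) * B powr p) \<partial>N)"
  proof (rule nn_integral_mono)
    fix t
    show "(\<integral>\<^sup>+x. ennreal (norm (k t) * norm (u t x) powr p) \<partial>lborel) \<le> ennreal (norm (k t) * B powr p)"
    proof (cases "k t = 0")
      case False
      have "(\<integral>\<^sup>+x. ennreal (norm (k t) * norm (u t x) powr p) \<partial>lborel) = ennreal (LINT x|lborel. norm (k t) * norm (u t x) powr p)"
        using Lp_integrable[OF u(1)[OF False]] by (intro nn_integral_eq_integral) auto
      also have "\<dots> \<le> ennreal (norm (k t) * B powr p)"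
        using u(2)[OF False] B by (intro ennreal_leI) (auto intro!: mult_left_mono simp: Lnorm_le_iff[OF p1])
      finally show ?thesis .
    qed simp
  qed
  also have "\<dots> = ennreal (LINT t|N. norm (k t) * B powr p)"
    using k by (intro nn_integral_eq_integral) auto
  also have "(LINT t|N. norm (k t) * B powr p) = \<kappa> * B powr p" by (simp add: \<kappa>_def)
  finally have le: "(\<integral>\<^sup>+x. (\<integral>\<^sup>+t. ennreal (norm (k t) * norm (u t x) powr p) \<partial>N) \<partial>lborel) \<le> ennreal (\<kappa> * B powr p)" .
  then have "AE x in lborel. (\<integral>\<^sup>+t. ennreal (norm (k t) * norm (u t x) powr p) \<partial>N) \<noteq> \<infinity>"
    by (intro nn_integral_PInf_AE) (auto simp: top_unique)
  then have intx: "AE x in lborel. integrable N (\<lambda>t. norm (k t) * norm (u t x) powr p)"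
    by eventually_elim (auto simp: integrable_iff_bounded top.not_eq_extremum)
  have jx: "AE x in lborel. integrable N (\<lambda>t. k t * u t x) \<and> norm (LINT t|N. k t * u t x) powr p \<le> \<kappa> powr (p - 1) * \<Phi> x"
    using intx
  proof eventually_elim
    case (elim x)
    note j = jensen_powr[of N "\<lambda>t. norm (k t)" "\<lambda>t. norm (u t x)", OF _ _ _ _ elim]
    have i: "integrable N (\<lambda>t. norm (k t * u t x))" using j(1) k by (simp add: norm_mult)
    then have i': "integrable N (\<lambda>t. k t * u t x)" by (subst (asm) integrable_norm_iff) auto
    have "norm (LINT t|N. k t * u t x) powr p \<le> (LINT t|N. norm (k t) * norm (u t x)) powr p"
      using p1 integral_norm_bound[of N "\<lambda>t. k t * u t x"] by (intro powr_mono2) (auto simp: norm_mult)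
    also have "\<dots> \<le> \<kappa> powr (p - 1) * \<Phi> x" using j(2) k by (simp add: \<kappa>_def \<Phi>_def)
    finally show ?case using i' by blast
  qed
  then show "AE x in lborel. integrable N (\<lambda>t. k t * u t x)" by eventually_elim blast
  have [measurable]: "\<Phi> \<in> borel_measurable borel" unfolding \<Phi>_def by measurable
  have fm [measurable]: "(\<lambda>x. LINT t|N. k t * u t x) \<in> borel_measurable borel" by measurable
  have "(\<integral>\<^sup>+x. ennreal (\<Phi> x) \<partial>lborel) \<le> ennreal (\<kappa> * B powr p)"
  proof -
    have "(\<integral>\<^sup>+x. ennreal (\<Phi> x) \<partial>lborel) = (\<integral>\<^sup>+x. (\<integral>\<^sup>+t. ennreal (norm (k t) * norm (u t x) powr p) \<partial>N) \<partial>lborel)"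
      unfolding \<Phi>_def using intx
      by (intro nn_integral_cong_AE, eventually_elim) (simp add: nn_integral_eq_integral)
    then show ?thesis using le by simp
  qed
  moreover have \<Phi>0: "0 \<le> \<Phi> x" for x by (simp add: \<Phi>_def)
  ultimately have \<Phi>i: "integrable lborel \<Phi>"
    by (auto simp: integrable_iff_bounded intro: le_less_trans)
  have \<Phi>le: "(LINT x|lborel. \<Phi> x) \<le> \<kappa> * B powr p"
    using \<open>(\<integral>\<^sup>+x. ennreal (\<Phi> x) \<partial>lborel) \<le> ennreal (\<kappa> * B powr p)\<close> nn_integral_eq_integral[OF \<Phi>i] \<Phi>0 \<kappa>
    by (simp add: ennreal_le_iff)
  have int: "integrable lborel (\<lambda>x. norm (LINT t|N. k t * u t x) powr p)"
  proof (rule Bochner_Integration.integrable_bound[of _ "\<lambda>x. \<kappa> powr (p - 1) * \<Phi> x"])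
    show "AE x in lborel. norm (norm (LINT t|N. k t * u t x) powr p) \<le> norm (\<kappa> powr (p - 1) * \<Phi> x)"
      using jx by eventually_elim (use \<Phi>0 in \<open>auto simp: abs_of_nonneg\<close>)
  qed (use \<Phi>i in auto)
  then show "(\<lambda>x. LINT t|N. k t * u t x) \<in> Lp p" by (intro LpI fm)
  have "(LINT x|lborel. norm (LINT t|N. k t * u t x) powr p) \<le> (LINT x|lborel. \<kappa> powr (p - 1) * \<Phi> x)"
    by (rule integral_mono_AE) (use int \<Phi>i jx in auto)
  also have "\<dots> \<le> \<kappa> powr (p - 1) * (\<kappa> * B powr p)" using \<Phi>le by (simp add: mult_left_mono)
  also have "\<dots> = (\<kappa> * B) powr p"
    using \<kappa> B p1 powr_add[of \<kappa> "p - 1" 1] by (cases "\<kappa> = 0") (auto simp: powr_mult)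
  finally show "Lnorm p (\<lambda>x. LINT t|N. k t * u t x) \<le> (LINT t|N. norm (k t)) * B"
    using \<kappa> B by (simp add: Lnorm_le_iff[OF p1] \<kappa>_def)
qed

lemma dil_measurable [measurable]:
  assumes [measurable]: "f \<in> borel_measurable borel" shows "dil p t f \<in> borel_measurable borel"
  unfolding dil_def by measurable

lemma dil_0 [simp]: "dil p 0 f = f" by (simp add: dil_def)

lemma dil_dil: "dil p t (dil p u f) = dil p (t + u) f"
proof -
  have "exp (- (t + u) / p) = exp (- t / p) * exp (- u / p)"
    by (simp add: add_divide_distrib diff_divide_distrib flip: exp_add)
  moreover have "exp (- (t + u)) = exp (- u) * exp (- t)" by (simp flip: exp_add)
  ultimately show ?thesis unfolding dil_def by (simp add: mult.assoc del: minus_add_distrib)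
qed

lemma dil_add: "dil p t (\<lambda>x. f x + g x) = (\<lambda>x. dil p t f x + dil p t g x)"
  by (simp add: dil_def fun_eq_iff algebra_simps)

lemma dil_diff: "dil p t (\<lambda>x. f x - g x) = (\<lambda>x. dil p t f x - dil p t g x)"
  by (simp add: dil_def fun_eq_iff algebra_simps)

lemma dil_scale: "dil p t (\<lambda>x. c * f x) = (\<lambda>x. c * dil p t f x)"
  by (simp add: dil_def fun_eq_iff algebra_simps)

text \<open>The prefactor e^(-t/p) raised to the power p is the Jacobian of x -> e^(-t) x; this
  makes the dilations isometries of L^p.\<close>

lemma norm_dil_powr: "norm (dil p t f x) powr p = exp (- t) * norm (f (exp (- t) * x)) powr p"
proof -
  have "(exp (- t / p)) powr p = exp (- t)" using p1 by (simp add: powr_def)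
  then show ?thesis by (simp add: dil_def norm_mult powr_mult)
qed

lemma dil_Lp: "f \<in> Lp p \<Longrightarrow> dil p t f \<in> Lp p"
  using lborel_integrable_real_affine[of "\<lambda>x. norm (f x) powr p" "exp (- t)" 0]
  by (auto simp: Lp_def norm_dil_powr)

lemma Lnorm_dil: "Lnorm p (dil p t f) = Lnorm p f"
  using lborel_integral_real_affine[of "exp (- t)" "\<lambda>x. norm (f x) powr p" 0]
  by (simp add: Lnorm_def norm_dil_powr)

lemma dil_cong_AE:
  assumes [measurable]: "f \<in> borel_measurable borel" "g \<in> borel_measurable borel" and "AE x in lborel. f x = g x"
  shows "AE x in lborel. dil p t f x = dil p t g x"
  using AE_borel_affine[of "exp (- t)" "\<lambda>x. f x = g x" 0] assms by (auto simp: dil_def)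

end

section \<open>Schwartz functions and density\<close>

text \<open>\<open>nderiv\<close> iterates the choice operator \<open>vector_derivative\<close>, so
  iterated derivatives are identified by exhibiting a family in which each member differentiates to
  the next.\<close>

lemma nderiv_family:
  assumes "\<And>n x. (g n has_vector_derivative g (Suc n) x) (at x)"
  shows "nderiv n (g 0) = g n"
proof (induction n)
  case (Suc n)
  show ?case unfolding nderiv.simps(2) Suc.IH using assms by (intro ext vector_derivative_at)
qed simp

lemma schwartzI:
  assumes "\<And>n x. (g n has_vector_derivative g (Suc n) x) (at x)"
    and "\<And>k n. \<exists>C. \<forall>x. \<bar>x\<bar> ^ k * norm (g n x) \<le> C"
  shows "schwartz (g 0)"
  unfolding schwartz_def nderiv_family[of g, OF assms(1)] using assms by blast

lemma schwartz_deriv: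
  "schwartz f \<Longrightarrow> (nderiv n f has_vector_derivative nderiv (Suc n) f x) (at x)"
  unfolding schwartz_def by blast

lemma schwartz_bound:
  assumes "schwartz f" obtains C where "\<And>x. \<bar>x\<bar> ^ k * norm (nderiv n f x) \<le> C"
  using assms unfolding schwartz_def by blast

lemma schwartz_nderiv_continuous: "schwartz f \<Longrightarrow> continuous_on A (nderiv n f)"
  by (meson continuous_at_imp_continuous_on has_vector_derivative_continuous schwartz_deriv)

lemma schwartz_nderiv_measurable [measurable]:
  "schwartz f \<Longrightarrow> nderiv n f \<in> borel_measurable borel"
  by (intro borel_measurable_continuous_onI schwartz_nderiv_continuous)

lemma schwartz_measurable: "schwartz f \<Longrightarrow> f \<in> borel_measurable borel"
  using schwartz_nderiv_measurable[of f 0] by simp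

lemma nderiv_nderiv: "nderiv m (nderiv n f) = nderiv (m + n) f"
  by (induction m) auto

lemma schwartz_nderiv: "schwartz f \<Longrightarrow> schwartz (nderiv n f)"
  unfolding schwartz_def by (auto simp: nderiv_nderiv simp flip: nderiv.simps(2))

lemma schwartz_decay:
  assumes "schwartz f"
  obtains C where "0 \<le> C" "\<And>x. \<bar>x\<bar> ^ j * norm (nderiv n f x) * (1 + x\<^sup>2) \<le> C"
proof -
  obtain A where A: "\<And>x. \<bar>x\<bar> ^ j * norm (nderiv n f x) \<le> A" using schwartz_bound[OF assms] by blast
  obtain B where B: "\<And>x. \<bar>x\<bar> ^ (j + 2) * norm (nderiv n f x) \<le> B" using schwartz_bound[OF assms] by blast
  have *: "\<bar>x\<bar> ^ j * norm (nderiv n f x) * (1 + x\<^sup>2) \<le> A + B" for x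
    using A[of x] B[of x] by (simp add: power_add power2_eq_square algebra_simps)
  moreover have "0 \<le> A + B" using *[of 0] by (rule order_trans[rotated]) simp
  ultimately show ?thesis using that by blast
qed

lemma schwartz_add_scale:
  assumes f: "schwartz f" and g: "schwartz g"
  shows "schwartz (\<lambda>x. a * f x + b * g x)"
    and "nderiv n (\<lambda>x. a * f x + b * g x) = (\<lambda>x. a * nderiv n f x + b * nderiv n g x)"
proof -
  define h where "h n x = a * nderiv n f x + b * nderiv n g x" for n x
  have 1: "(h n has_vector_derivative h (Suc n) x) (at x)" for n x
    unfolding h_def by (intro has_vector_derivative_add has_vector_derivative_mult_right schwartz_deriv f g)
  have 2: "\<exists>C. \<forall>x. \<bar>x\<bar> ^ k * norm (h n x) \<le> C" for k n
  proof -
    obtain A where A: "\<And>x. \<bar>x\<bar> ^ k * norm (nderiv n f x) \<le> A" using schwartz_bound[OF f] by blast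
    obtain B where B: "\<And>x. \<bar>x\<bar> ^ k * norm (nderiv n g x) \<le> B" using schwartz_bound[OF g] by blast
    have "\<bar>x\<bar> ^ k * norm (h n x) \<le> norm a * A + norm b * B" for x
    proof -
      have "\<bar>x\<bar> ^ k * norm (h n x) \<le> \<bar>x\<bar> ^ k * (norm a * norm (nderiv n f x) + norm b * norm (nderiv n g x))"
        unfolding h_def by (intro mult_left_mono order_trans[OF norm_triangle_ineq]) (auto simp: norm_mult)
      also have "\<dots> = norm a * (\<bar>x\<bar> ^ k * norm (nderiv n f x)) + norm b * (\<bar>x\<bar> ^ k * norm (nderiv n g x))"
        by (simp add: algebra_simps)
      also have "\<dots> \<le> norm a * A + norm b * B" by (intro add_mono mult_left_mono A B) auto
      finally show ?thesis .
    qed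
    then show ?thesis by blast
  qed
  show "schwartz (\<lambda>x. a * f x + b * g x)" using schwartzI[of h, OF 1 2] by (simp add: h_def[abs_def])
  show "nderiv n (\<lambda>x. a * f x + b * g x) = (\<lambda>x. a * nderiv n f x + b * nderiv n g x)"
    using nderiv_family[of h, OF 1, of n] by (simp add: h_def[abs_def])
qed

lemma schwartz_scaled:
  assumes f: "schwartz f" and c: "c \<noteq> 0"
  shows "schwartz (\<lambda>x. a * f (c * x))"
    and "nderiv n (\<lambda>x. a * f (c * x)) = (\<lambda>x. a * of_real c ^ n * nderiv n f (c * x))"
proof -
  define h where "h n x = a * of_real c ^ n * nderiv n f (c * x)" for n x
  have 1: "(h n has_vector_derivative h (Suc n) x) (at x)" for n x
  proof -
    have "((\<lambda>x. c * x) has_vector_derivative c) (at x)"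
      by (auto intro!: derivative_eq_intros simp: has_real_derivative_iff_has_vector_derivative[symmetric])
    from vector_diff_chain_at[OF this schwartz_deriv[OF f, of n "c * x"]]
    have "((\<lambda>x. nderiv n f (c * x)) has_vector_derivative c *\<^sub>R nderiv (Suc n) f (c * x)) (at x)"
      by (simp add: o_def)
    from has_vector_derivative_mult_right[OF this, of "a * of_real c ^ n"]
    show ?thesis unfolding h_def by (simp add: scaleR_conv_of_real mult_ac)
  qed
  have 2: "\<exists>C. \<forall>x. \<bar>x\<bar> ^ k * norm (h n x) \<le> C" for k n
  proof -
    obtain A where A: "\<And>x. \<bar>x\<bar> ^ k * norm (nderiv n f x) \<le> A" using schwartz_bound[OF f] by blast
    have "\<bar>x\<bar> ^ k * norm (h n x) \<le> norm a * \<bar>c\<bar> ^ n / \<bar>c\<bar> ^ k * A" for x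
    proof -
      have "\<bar>x\<bar> ^ k * norm (h n x) = norm a * \<bar>c\<bar> ^ n / \<bar>c\<bar> ^ k * (\<bar>c * x\<bar> ^ k * norm (nderiv n f (c * x)))"
        unfolding h_def using c by (simp add: norm_mult norm_power abs_mult power_mult_distrib)
      also have "\<dots> \<le> norm a * \<bar>c\<bar> ^ n / \<bar>c\<bar> ^ k * A" by (intro mult_left_mono A) auto
      finally show ?thesis .
    qed
    then show ?thesis by blast
  qed
  show "schwartz (\<lambda>x. a * f (c * x))" using schwartzI[of h, OF 1 2] by (simp add: h_def[abs_def])
  show "nderiv n (\<lambda>x. a * f (c * x)) = (\<lambda>x. a * of_real c ^ n * nderiv n f (c * x))"
    using nderiv_family[of h, OF 1, of n] by (simp add: h_def[abs_def])
qed

lemma schwartz_dil: "schwartz f \<Longrightarrow> schwartz (dil p t f)"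
  unfolding dil_def by (intro schwartz_scaled(1)) auto

lemma schwartz_diff: "schwartz f \<Longrightarrow> schwartz g \<Longrightarrow> schwartz (\<lambda>x. f x - g x)"
  using schwartz_add_scale(1)[of f g 1 "-1"] by simp

lemma power_le_exp_mult: "0 \<le> x \<Longrightarrow> x ^ m \<le> real m ^ m * exp x"
proof (cases "m = 0")
  case False
  assume x: "0 \<le> x"
  have "(x / m) ^ m \<le> exp (x / m) ^ m"
    using x exp_ge_add_one_self[of "x / m"] by (intro power_mono) (linarith, simp)
  also have "\<dots> = exp x" using False by (simp flip: exp_of_nat_mult)
  finally show ?thesis using False by (simp add: power_divide field_simps)
qed simp

text \<open>Horner induction on P: splitting off the constant term trades one degree for one more
  power of x, so k has to stay general. Growth of q beyond |x| - M lets e^(-q) absorb every power of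
  x.\<close>

lemma poly_exp_bounded:
  fixes P q :: "real poly"
  assumes q: "\<And>x. \<bar>x\<bar> - M \<le> poly q x"
  shows "\<exists>C. \<forall>x. \<bar>x\<bar> ^ k * \<bar>poly P x * exp (- poly q x)\<bar> \<le> C"
proof (induction P arbitrary: k)
  case 0
  show ?case by (intro exI[of _ 0]) simp
next
  case (pCons a P)
  obtain C where C: "\<And>x. \<bar>x\<bar> ^ Suc k * \<bar>poly P x * exp (- poly q x)\<bar> \<le> C" using pCons.IH[of "Suc k"] by blast
  have "\<bar>x\<bar> ^ k * \<bar>poly (pCons a P) x * exp (- poly q x)\<bar> \<le> \<bar>a\<bar> * (real k ^ k * exp M) + C" for x
  proof -
    have "\<bar>x\<bar> ^ k * exp (- poly q x) \<le> real k ^ k * exp \<bar>x\<bar> * exp (M - \<bar>x\<bar>)"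
      using q[of x] by (intro mult_mono power_le_exp_mult) auto
    also have "\<dots> = real k ^ k * exp M" by (simp add: exp_diff)
    finally have 1: "\<bar>x\<bar> ^ k * exp (- poly q x) \<le> real k ^ k * exp M" .
    have "\<bar>x\<bar> ^ k * \<bar>poly (pCons a P) x * exp (- poly q x)\<bar>
        \<le> \<bar>x\<bar> ^ k * ((\<bar>a\<bar> + \<bar>x\<bar> * \<bar>poly P x\<bar>) * exp (- poly q x))"
      by (intro mult_left_mono) (auto simp: abs_mult intro!: mult_right_mono order_trans[OF abs_triangle_ineq])
    also have "\<dots> = \<bar>a\<bar> * (\<bar>x\<bar> ^ k * exp (- poly q x)) + \<bar>x\<bar> ^ Suc k * \<bar>poly P x * exp (- poly q x)\<bar>"
      by (simp add: abs_mult algebra_simps)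
    also have "\<dots> \<le> \<bar>a\<bar> * (real k ^ k * exp M) + C" by (intro add_mono mult_left_mono 1 C) auto
    finally show ?thesis .
  qed
  then show ?case by blast
qed

lemma schwartz_exp_poly:
  fixes q :: "real poly"
  assumes q: "\<And>x. \<bar>x\<bar> - M \<le> poly q x"
  shows "schwartz (\<lambda>x. complex_of_real (exp (- poly q x)))"
proof -
  \<comment> \<open>Differentiating P e^(-q) replaces P by P' - q' P; iterating from 1 gives the
    polynomial factor of the n-th derivative.\<close>
  define Q where "Q n = ((\<lambda>P. pderiv P - pderiv q * P) ^^ n) [:1:]" for n
  define g where "g n x = complex_of_real (poly (Q n) x * exp (- poly q x))" for n x
  have "((\<lambda>x. poly (Q n) x * exp (- poly q x)) has_real_derivative poly (Q (Suc n)) x * exp (- poly q x)) (at x)" for n x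
    by (auto intro!: derivative_eq_intros poly_DERIV simp: Q_def algebra_simps)
  then have 1: "(g n has_vector_derivative g (Suc n) x) (at x)" for n x
    unfolding g_def by (intro has_vector_derivative_of_real)
       (simp add: has_real_derivative_iff_has_vector_derivative)
  have 2: "\<exists>C. \<forall>x. \<bar>x\<bar> ^ k * norm (g n x) \<le> C" for k n
    using poly_exp_bounded[OF q, of k "Q n"] by (simp add: g_def norm_mult abs_mult)
  have "schwartz (g 0)" by (rule schwartzI[of g, OF 1 2])
  moreover have "g 0 = (\<lambda>x. complex_of_real (exp (- poly q x)))" by (simp add: g_def[abs_def] Q_def)
  ultimately show ?thesis by simp
qed

lemma square_le_power_plus_1: "y\<^sup>2 \<le> y ^ (2 * Suc k) + (1::real)"
proof (cases "y\<^sup>2 \<le> 1")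
  case True
  then show ?thesis unfolding power_mult by (intro add_increasing) auto
next
  case False
  then have "(y\<^sup>2) ^ 1 \<le> (y\<^sup>2) ^ Suc k" by (intro power_increasing) auto
  then show ?thesis unfolding power_mult by simp
qed

text \<open>Smoothed indicators of (c - r, c + r): as k grows, exp(-y^(2k+2)) tends to 1 for |y| < 1
  and to 0 for |y| > 1. As exponentials of polynomials they have explicit derivatives and replace
  bump functions of compact support.\<close>

lemma schwartz_flat_gaussian:
  assumes r: "r > 0"
  shows "schwartz (\<lambda>x. complex_of_real (exp (- (((x - c) / r) ^ (2 * Suc k)))))"
proof -
  define q where "q = [:- c / r, 1 / r:] ^ (2 * Suc k)"
  have pq: "poly q x = ((x - c) / r) ^ (2 * Suc k)" for x
    unfolding q_def poly_power using r by (simp add: field_simps del: power_Suc mult_Suc_right)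
  \<comment> \<open>Completing a square bounds r|y| by y^2 + r^2/4, and the remaining 1 pays for y^2
    <= y^(2k+2) + 1; this is the origin of the constant.\<close>
  have "\<bar>x\<bar> - (\<bar>c\<bar> + r\<^sup>2 / 4 + 1) \<le> poly q x" for x
  proof -
    define y where "y = (x - c) / r"
    have x: "x = c + r * y" using r by (simp add: y_def)
    have "0 \<le> (\<bar>y\<bar> - r / 2)\<^sup>2" by simp
    then have "r * \<bar>y\<bar> \<le> y\<^sup>2 + r\<^sup>2 / 4" by (simp add: power2_eq_square algebra_simps)
    moreover have "\<bar>x\<bar> \<le> \<bar>c\<bar> + r * \<bar>y\<bar>" unfolding x using r abs_triangle_ineq[of c "r * y"] by (simp add: abs_mult)
    moreover have "y\<^sup>2 \<le> poly q x + 1" unfolding pq y_def by (rule square_le_power_plus_1)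
    ultimately show ?thesis by linarith
  qed
  from schwartz_exp_poly[OF this] show ?thesis by (simp add: pq del: power_Suc mult_Suc_right)
qed

section \<open>Subspaces of L^p, their closures, and density of the Schwartz functions\<close>

definition Lsub :: "real \<Rightarrow> (real \<Rightarrow> complex) set \<Rightarrow> bool" where
  "Lsub p V \<longleftrightarrow> V \<subseteq> Lp p \<and> (\<lambda>x. 0) \<in> V \<and> (\<forall>f\<in>V. \<forall>g\<in>V. (\<lambda>x. f x + g x) \<in> V) \<and>
     (\<forall>c. \<forall>f\<in>V. (\<lambda>x. c * f x) \<in> V)"

definition Lcl :: "real \<Rightarrow> (real \<Rightarrow> complex) set \<Rightarrow> (real \<Rightarrow> complex) set" where
  "Lcl p V = {f \<in> Lp p. \<forall>e>0. \<exists>g\<in>V. Lnorm p (\<lambda>x. f x - g x) < e}"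

lemma Lsub_addD: "Lsub p V \<Longrightarrow> f \<in> V \<Longrightarrow> g \<in> V \<Longrightarrow> (\<lambda>x. f x + g x) \<in> V"
  by (simp add: Lsub_def)

lemma Lsub_scaleD: "Lsub p V \<Longrightarrow> f \<in> V \<Longrightarrow> (\<lambda>x. c * f x) \<in> V"
  by (simp add: Lsub_def)

context
  fixes p :: real
  assumes p1: "1 \<le> p"
begin

lemma schwartz_monom_Lp:
  assumes f: "schwartz f" shows "(\<lambda>x. of_real x ^ j * nderiv n f x) \<in> Lp p"
proof -
  obtain C where "\<And>x. \<bar>x\<bar> ^ j * norm (nderiv n f x) * (1 + x\<^sup>2) \<le> C" using schwartz_decay[OF f] by metis
  then show ?thesis using f by (intro Lp_bounded_decay[OF p1]) (auto simp: norm_mult norm_power)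
qed

lemma schwartz_Lp: "schwartz f \<Longrightarrow> f \<in> Lp p"
  using schwartz_monom_Lp[of f 0 0] by simp

lemma Lsub_schwartz: "Lsub p (Collect schwartz)"
proof -
  have "schwartz (\<lambda>x. 0)" using schwartz_flat_gaussian[of 1 0 0] schwartz_add_scale(1)[of _ _ 0 0] by fastforce
  moreover have "schwartz (\<lambda>x. c * f x)" if "schwartz f" for c f
    using schwartz_add_scale(1)[OF that that, of c 0] by simp
  moreover have "schwartz (\<lambda>x. f x + g x)" if "schwartz f" "schwartz g" for f g
    using schwartz_add_scale(1)[OF that, of 1 1] by simp
  ultimately show ?thesis unfolding Lsub_def using schwartz_Lp by auto
qed

lemma Lcl_subset: "Lcl p V \<subseteq> Lp p" by (auto simp: Lcl_def)

lemma subset_Lcl: "V \<subseteq> Lp p \<Longrightarrow> V \<subseteq> Lcl p V"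
  by (auto simp: Lcl_def intro!: bexI[rotated] simp: p1)

lemma Lcl_approx:
  assumes V: "V \<subseteq> Lp p" and f: "f \<in> Lp p" and ap: "\<And>e. e > 0 \<Longrightarrow> \<exists>g\<in>Lcl p V. Lnorm p (\<lambda>x. f x - g x) < e"
  shows "f \<in> Lcl p V"
  unfolding Lcl_def
proof (intro CollectI conjI f allI impI)
  fix e :: real assume "e > 0"
  then obtain g where g: "g \<in> Lcl p V" "Lnorm p (\<lambda>x. f x - g x) < e / 2" using ap[of "e/2"] by auto
  have "\<exists>h\<in>V. Lnorm p (\<lambda>x. g x - h x) < d" if "d > 0" for d using g(1) that by (simp add: Lcl_def)
  from this[of "e / 2"] obtain h where h: "h \<in> V" "Lnorm p (\<lambda>x. g x - h x) < e / 2" using \<open>e > 0\<close> by auto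
  have "g \<in> Lp p" "h \<in> Lp p" using g h V by (auto simp: Lcl_def)
  then have "Lnorm p (\<lambda>x. f x - h x) < e" using Lnorm_triangle3[OF p1 f, of g h] g h by simp
  then show "\<exists>g\<in>V. Lnorm p (\<lambda>x. f x - g x) < e" using h by blast
qed

lemma Lcl_limit:
  assumes V: "V \<subseteq> Lp p" and f: "f \<in> Lp p" and g: "\<And>n. g n \<in> Lcl p V" and lim: "(\<lambda>n. Lnorm p (\<lambda>x. g n x - f x)) \<longlonglongrightarrow> 0"
  shows "f \<in> Lcl p V"
proof (rule Lcl_approx[OF V f])
  fix e :: real assume "e > 0"
  then have "eventually (\<lambda>n. Lnorm p (\<lambda>x. g n x - f x) < e) sequentially" using order_tendstoD(2)[OF lim] by simp
  then obtain n where "Lnorm p (\<lambda>x. g n x - f x) < e" by (auto simp: eventually_sequentially)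
  then show "\<exists>h\<in>Lcl p V. Lnorm p (\<lambda>x. f x - h x) < e"
    using g[of n] by (intro bexI[of _ "g n"]) (simp_all add: Lnorm_minus_commute[OF p1, of f])
qed

lemma Lcl_cong_AE:
  assumes "f \<in> Lcl p V" "AE x in lborel. f x = g x" "V \<subseteq> Lp p" "g \<in> borel_measurable borel"
  shows "g \<in> Lcl p V"
proof (rule Lcl_limit[where g="\<lambda>_. f"])
  have f: "f \<in> Lp p" using assms Lcl_subset by auto
  then show g: "g \<in> Lp p" using assms Lp_cong_AE by blast
  have "Lnorm p (\<lambda>x. f x - g x) = 0" using Lp_diff[OF p1 f g] assms(2) by (simp add: Lnorm_eq_0[OF p1])
  then show "(\<lambda>n. Lnorm p (\<lambda>x. f x - g x)) \<longlonglongrightarrow> 0" by simp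
qed (use assms in auto)

lemma Lsub_Lcl:
  assumes V: "Lsub p V" shows "Lsub p (Lcl p V)"
  unfolding Lsub_def
proof (intro conjI ballI allI)
  show "Lcl p V \<subseteq> Lp p" by (rule Lcl_subset)
  show "(\<lambda>x. 0) \<in> Lcl p V" using V subset_Lcl by (auto simp: Lsub_def)
next
  fix f g assume f: "f \<in> Lcl p V" and g: "g \<in> Lcl p V"
  show "(\<lambda>x. f x + g x) \<in> Lcl p V"
    unfolding Lcl_def
  proof (intro CollectI conjI allI impI)
    show "(\<lambda>x. f x + g x) \<in> Lp p" using f g by (auto simp: Lcl_def intro: Lp_add[OF p1])
    fix e :: real assume e: "e > 0"
    obtain f' where f': "f' \<in> V" "Lnorm p (\<lambda>x. f x - f' x) < e / 2" using f e by (auto simp: Lcl_def dest!: spec[of _ "e/2"])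
    obtain g' where g': "g' \<in> V" "Lnorm p (\<lambda>x. g x - g' x) < e / 2" using g e by (auto simp: Lcl_def dest!: spec[of _ "e/2"])
    have "(\<lambda>x. f x - f' x) \<in> Lp p" "(\<lambda>x. g x - g' x) \<in> Lp p"
      using f g f' g' V by (auto simp: Lcl_def Lsub_def intro!: Lp_diff[OF p1])
    from Lnorm_triangle[OF p1 this] have "Lnorm p (\<lambda>x. (f x + g x) - (f' x + g' x)) < e"
      using f' g' by (simp add: algebra_simps)
    then show "\<exists>h\<in>V. Lnorm p (\<lambda>x. f x + g x - h x) < e"
      using V f' g' by (intro bexI[of _ "\<lambda>x. f' x + g' x"]) (auto simp: Lsub_def)
  qed
next
  fix c f assume f: "f \<in> Lcl p V"
  show "(\<lambda>x. c * f x) \<in> Lcl p V"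
    unfolding Lcl_def
  proof (intro CollectI conjI allI impI)
    show "(\<lambda>x. c * f x) \<in> Lp p" using f by (auto simp: Lcl_def intro: Lp_scale[OF p1])
    fix e :: real assume e: "e > 0"
    then have "e / (norm c + 1) > 0" by (simp add: add_nonneg_pos)
    then obtain f' where f': "f' \<in> V" "Lnorm p (\<lambda>x. f x - f' x) < e / (norm c + 1)" using f by (auto simp: Lcl_def)
    have "Lnorm p (\<lambda>x. c * f x - c * f' x) = norm c * Lnorm p (\<lambda>x. f x - f' x)"
      using Lnorm_scale[OF p1, of c "\<lambda>x. f x - f' x"] by (simp add: algebra_simps)
    also have "\<dots> \<le> (norm c + 1) * Lnorm p (\<lambda>x. f x - f' x)" by (intro mult_right_mono) auto
    also have "\<dots> < e" using f'(2) by (subst (asm) pos_less_divide_eq) (auto simp: add_nonneg_pos mult.commute)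
    finally show "\<exists>h\<in>V. Lnorm p (\<lambda>x. c * f x - h x) < e"
      using V f' by (intro bexI[of _ "\<lambda>x. c * f' x"]) (auto simp: Lsub_def)
  qed
qed

lemma Lsub_sum:
  assumes "Lsub p V" "\<And>i. i \<in> I \<Longrightarrow> f i \<in> V" shows "(\<lambda>x. \<Sum>i\<in>I. f i x) \<in> V"
  using assms(2) by (induction I rule: infinite_finite_induct) (use assms(1) in \<open>auto simp: Lsub_def\<close>)

lemma Lsub_diff:
  assumes "Lsub p V" "f \<in> V" "g \<in> V" shows "(\<lambda>x. f x - g x) \<in> V"
proof -
  have "(\<lambda>x. f x + (-1) * g x) \<in> V"
    by (intro Lsub_addD[OF assms(1)] Lsub_scaleD[OF assms(1)] assms)
  then show ?thesis by simp
qed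

lemma Lp_indicator_bounded:
  assumes "A \<in> sets borel" shows "(indicator (A \<inter> {-N<..<N}) :: real \<Rightarrow> complex) \<in> Lp p"
proof (rule LpI)
  show "(indicator (A \<inter> {-N<..<N}) :: real \<Rightarrow> complex) \<in> borel_measurable borel" using assms by measurable
  have "(\<lambda>x. norm (indicator (A \<inter> {-N<..<N}) x :: complex) powr p) = (indicator (A \<inter> {-N<..<N}) :: real \<Rightarrow> real)"
    using p1 by (auto simp: indicator_def fun_eq_iff)
  moreover have "emeasure lborel (A \<inter> {-N<..<N}) < \<infinity>"
    by (rule emeasure_bounded_finite) (simp add: bounded_Int)
  ultimately show "integrable lborel (\<lambda>x. norm (indicator (A \<inter> {-N<..<N}) x :: complex) powr p)"
    using assms by simp
qed

text \<open>Dynkin's pi-lambda argument on the intersection-stable class of open intervals reaches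
  all Borel sets cut to a window (-N, N); simple functions do the rest. The window keeps indicators
  in L^p and lets complements be taken inside a set of finite measure.\<close>

lemma Lp_dense_if_intervals:
  assumes V: "Lsub p V" and iv: "\<And>a b. a < b \<Longrightarrow> (indicator {a<..<b} :: real \<Rightarrow> complex) \<in> Lcl p V"
  shows "Lcl p V = Lp p"
proof (intro equalityI Lcl_subset subsetI)
  have VL: "V \<subseteq> Lp p" using V by (simp add: Lsub_def)
  have sub: "Lsub p (Lcl p V)" by (rule Lsub_Lcl[OF V])
  have borel_eq_box_real: "sets (borel :: real measure) = sigma_sets UNIV (range (\<lambda>(a, b). {a<..<b::real}))"
    unfolding borel_eq_box by (simp add: box_real case_prod_unfold)
  have ivN: "(indicator {a<..<b} :: real \<Rightarrow> complex) \<in> Lcl p V" for a b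
  proof (cases "a < b")
    case False
    then have "{a<..<b} = {}" by auto
    then show ?thesis using sub by (auto simp: Lsub_def indicator_def[abs_def])
  qed (rule iv)
  have set: "(indicator (A \<inter> {-N<..<N}) :: real \<Rightarrow> complex) \<in> Lcl p V" if "A \<in> sets borel" for A N
  proof -
    let ?G = "range (\<lambda>(a, b). {a<..<b::real})"
    have "A \<in> sigma_sets UNIV ?G" using that unfolding borel_eq_box_real by simp
    moreover have "Int_stable ?G"
      unfolding Int_stable_def
    proof (intro ballI)
      fix A B assume "A \<in> ?G" "B \<in> ?G"
      then obtain a b c d where "A = {a<..<b}" "B = {c<..<d}" by auto
      then have "A \<inter> B = {max a c<..<min b d}" by auto
      then show "A \<inter> B \<in> ?G" by auto
    qed
    ultimately have "Int_stable ?G" "?G \<subseteq> Pow UNIV" "A \<in> sigma_sets UNIV ?G" by auto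
    then show ?thesis
    proof (induction rule: sigma_sets_induct_disjoint)
      case (basic A)
      then obtain a b where A: "A = {a<..<b}" by auto
      have "A \<inter> {-N<..<N} = {max a (-N)<..<min b N}" unfolding A by auto
      then show ?case using ivN by simp
    next
      case empty
      show ?case using sub by (auto simp: Lsub_def indicator_def[abs_def])
    next
      case (compl A)
      have "(\<lambda>x. indicator {-N<..<N} x - indicator (A \<inter> {-N<..<N}) x :: complex) \<in> Lcl p V"
        by (rule Lsub_diff[OF sub ivN compl.IH])
      moreover have "(\<lambda>x. indicator {-N<..<N} x - indicator (A \<inter> {-N<..<N}) x :: complex) = indicator ((UNIV - A) \<inter> {-N<..<N})"
        by (auto simp: indicator_def fun_eq_iff)
      ultimately show ?case by simp
    next
      case (union A)
      have Am [measurable]: "A i \<in> sets borel" for i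
        using union(2) unfolding borel_eq_box_real by auto
      show ?case
      proof (rule Lcl_limit[OF VL])
        show "(indicator (\<Union> (range A) \<inter> {-N<..<N}) :: real \<Rightarrow> complex) \<in> Lp p"
          by (rule Lp_indicator_bounded) measurable
        show "(\<lambda>x. \<Sum>i<n. indicator (A i \<inter> {-N<..<N}) x :: complex) \<in> Lcl p V" for n
          by (intro Lsub_sum[OF sub] union)
        have e: "(\<Sum>i<n. indicator (A i \<inter> {-N<..<N}) x :: complex) = indicator ((\<Union>i<n. A i) \<inter> {-N<..<N}) x" for n x
        proof -
          have "disjoint_family_on (\<lambda>i. A i \<inter> {-N<..<N}) {..<n}"
            using union(1) by (auto simp: disjoint_family_on_def)
          then have "(\<Sum>i<n. indicator (A i \<inter> {-N<..<N}) x :: complex) = indicator (\<Union>i<n. A i \<inter> {-N<..<N}) x"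
            by (intro indicator_UN_disjoint[symmetric]) auto
          also have "(\<Union>i<n. A i \<inter> {-N<..<N}) = (\<Union>i<n. A i) \<inter> {-N<..<N}" by blast
          finally show ?thesis .
        qed
        show "(\<lambda>n. Lnorm p (\<lambda>x. (\<Sum>i<n. indicator (A i \<inter> {-N<..<N}) x) - indicator (\<Union> (range A) \<inter> {-N<..<N}) x)) \<longlonglongrightarrow> 0"
          unfolding e
        proof (rule Lp_dominated_convergence[OF p1, where w="indicator (UNIV \<inter> {-N<..<N})"])
          show "(indicator (UNIV \<inter> {-N<..<N}) :: real \<Rightarrow> complex) \<in> Lp p"
            by (rule Lp_indicator_bounded) simp
          show "AE x in lborel. (\<lambda>n. indicator ((\<Union>i<n. A i) \<inter> {-N<..<N}) x :: complex) \<longlonglongrightarrow> indicator (\<Union> (range A) \<inter> {-N<..<N}) x"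
          proof (rule AE_I2)
            fix x :: real
            have "(\<lambda>n. indicator (\<Union>i<n. A i) x :: complex) \<longlonglongrightarrow> indicator (\<Union>i. A i) x"
              by (rule LIMSEQ_indicator_UN)
            then have "(\<lambda>n. indicator (\<Union>i<n. A i) x * indicator {-N<..<N} x :: complex) \<longlonglongrightarrow> indicator (\<Union>i. A i) x * indicator {-N<..<N} x"
              by (intro tendsto_intros)
            then show "(\<lambda>n. indicator ((\<Union>i<n. A i) \<inter> {-N<..<N}) x :: complex) \<longlonglongrightarrow> indicator (\<Union> (range A) \<inter> {-N<..<N}) x"
              by (simp add: indicator_inter_arith)
          qed
          show "(indicator (\<Union> (range A) \<inter> {-N<..<N}) :: real \<Rightarrow> complex) \<in> Lp p"
            by (rule Lp_indicator_bounded) measurable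
        qed (auto simp: indicator_def)
      qed
    qed
  qed
  fix f assume f: "f \<in> Lp p"
  then have fm [measurable]: "f \<in> borel_measurable borel" by (rule Lp_measurable)
  then obtain s where s: "\<And>i. simple_function borel (s i)" "\<And>x. (\<lambda>i. s i x) \<longlonglongrightarrow> f x" "\<And>i x. norm (s i x) \<le> 2 * norm (f x)"
    using borel_measurable_implies_sequence_metric[of f borel 0] unfolding dist_0_norm dist_commute[of _ 0]
    by (auto simp: dist_0_norm)
  show "f \<in> Lcl p V"
  proof (rule Lcl_limit[OF VL f])
    \<comment> \<open>Cutting the simple functions to (-i, i) expresses them by indicators already
      treated; since |s i| <= 2|f|, the function 2f is the majorant.\<close>
    define g where "g i x = s i x * indicator {- real i<..<real i} x" for i x
    have sm [measurable]: "s i \<in> borel_measurable borel" for i using s(1) by (rule borel_measurable_simple_function)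
    have "g i = (\<lambda>x. \<Sum>y\<in>range (s i). y * indicator ((s i -` {y}) \<inter> {- real i<..<real i}) x)" for i
    proof
      fix x
      have fin: "finite (range (s i))" using simple_functionD(1)[OF s(1)[of i]] by simp
      have "(\<Sum>y\<in>range (s i). y * indicator ((s i -` {y}) \<inter> {- real i<..<real i}) x)
          = (\<Sum>y\<in>{s i x}. y * indicator ((s i -` {y}) \<inter> {- real i<..<real i}) x)"
        by (rule sum.mono_neutral_right[OF fin]) (auto simp: indicator_def)
      then show "g i x = (\<Sum>y\<in>range (s i). y * indicator ((s i -` {y}) \<inter> {- real i<..<real i}) x)"
        by (auto simp: g_def indicator_def)
    qed
    moreover have "(\<lambda>x. \<Sum>y\<in>range (s i). y * indicator ((s i -` {y}) \<inter> {- real i<..<real i}) x) \<in> Lcl p V" for i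
    proof (rule Lsub_sum[OF sub])
      fix y assume "y \<in> range (s i)"
      have "s i -` {y} \<in> sets borel" using simple_functionD(2)[OF s(1)[of i], of "{y}"] by simp
      from set[OF this] show "(\<lambda>x. y * indicator ((s i -` {y}) \<inter> {- real i<..<real i}) x) \<in> Lcl p V"
        by (rule Lsub_scaleD[OF sub])
    qed
    ultimately show "g i \<in> Lcl p V" for i by simp
    show "(\<lambda>n. Lnorm p (\<lambda>x. g n x - f x)) \<longlonglongrightarrow> 0"
    proof (rule Lp_dominated_convergence[OF p1 _ f Lp_scale[OF p1 f, of 2]])
      show "g n \<in> borel_measurable borel" for n unfolding g_def by measurable
      show "AE x in lborel. norm (g n x) \<le> norm (2 * f x)" for n
        using s(3) by (intro AE_I2) (auto simp: g_def norm_mult indicator_def)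
      show "AE x in lborel. (\<lambda>n. g n x) \<longlonglongrightarrow> f x"
      proof (rule AE_I2)
        fix x :: real
        have "eventually (\<lambda>n. s n x = g n x) sequentially"
        proof (rule eventually_sequentiallyI[of "nat \<lceil>\<bar>x\<bar>\<rceil> + 1"])
          fix n assume "nat \<lceil>\<bar>x\<bar>\<rceil> + 1 \<le> n"
          then have "\<bar>x\<bar> < real n" by linarith
          then show "s n x = g n x" by (auto simp: g_def indicator_def)
        qed
        then show "(\<lambda>n. g n x) \<longlonglongrightarrow> f x" using s(2)[of x] by (rule Lim_transform_eventually[rotated])
      qed
    qed
  qed
qed

lemma schwartz_dense: "Lcl p (Collect schwartz) = Lp p"
proof (rule Lp_dense_if_intervals[OF Lsub_schwartz])
  fix a b :: real assume ab: "a < b"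
  define c r where "c = (a + b) / 2" and "r = (b - a) / 2"
  have r: "r > 0" using ab by (simp add: r_def)
  define g where "g k x = complex_of_real (exp (- (((x - c) / r) ^ (2 * Suc k))))" for k x
  have sg: "schwartz (g k)" for k unfolding g_def by (rule schwartz_flat_gaussian[OF r])
  have SL: "Collect schwartz \<subseteq> Lp p" using schwartz_Lp by auto
  have "({a<..<b} :: real set) = {a<..<b} \<inter> {-(\<bar>a\<bar>+\<bar>b\<bar>+1)<..<\<bar>a\<bar>+\<bar>b\<bar>+1}" by auto
  then have iL: "(indicator {a<..<b} :: real \<Rightarrow> complex) \<in> Lp p"
    using Lp_indicator_bounded[of "{a<..<b}"] by (metis borel_open open_greaterThanLessThan)
  show "(indicator {a<..<b} :: real \<Rightarrow> complex) \<in> Lcl p (Collect schwartz)"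
  proof (rule Lcl_limit[OF SL iL])
    show "g k \<in> Lcl p (Collect schwartz)" for k using subset_Lcl[OF SL] sg by auto
    show "(\<lambda>k. Lnorm p (\<lambda>x. g k x - indicator {a<..<b} x)) \<longlonglongrightarrow> 0"
    \<comment> \<open>The majorant is e times the ordinary Gaussian \<open>g 0\<close>, because
      exp(-y^(2k+2)) <= e exp(-y^2) for every k.\<close>
    proof (rule Lp_dominated_convergence[OF p1 _ iL Lp_scale[OF p1 schwartz_Lp[OF sg[of 0]], of "of_real (exp 1)"]])
      show "g k \<in> borel_measurable borel" for k by (rule schwartz_measurable[OF sg])
      show "AE x in lborel. norm (g k x) \<le> norm (complex_of_real (exp 1) * g 0 x)" for k
      proof (rule AE_I2)
        fix x
        show "norm (g k x) \<le> norm (complex_of_real (exp 1) * g 0 x)"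
          using square_le_power_plus_1[of "(x - c) / r" k] unfolding g_def norm_mult norm_of_real
          by (simp flip: exp_add)
      qed
      have "AE x in lborel. x \<noteq> a \<and> x \<noteq> b"
        using AE_lborel_singleton[of a] AE_lborel_singleton[of b] by eventually_elim auto
      then show "AE x in lborel. (\<lambda>k. g k x) \<longlonglongrightarrow> indicator {a<..<b} x"
      proof eventually_elim
        case (elim x)
        define y where "y = ((x - c) / r)\<^sup>2"
        have gy: "g k x = complex_of_real (exp (- (y ^ Suc k)))" for k
          unfolding g_def y_def by (simp only: power_mult)
        consider "a < x" "x < b" | "x < a \<or> b < x" using elim by linarith
        then show ?case
        proof cases
          case 1
          then have "\<bar>(x - c) / r\<bar> < 1" using r by (auto simp: c_def r_def abs_less_iff field_simps)
          then have "\<bar>(x - c) / r\<bar>\<^sup>2 < 1\<^sup>2" by (intro power_strict_mono) auto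
          then have "y < 1" "0 \<le> y" unfolding y_def power2_abs by simp_all
          then have "(\<lambda>k. y ^ Suc k) \<longlonglongrightarrow> 0" by (intro LIMSEQ_Suc LIMSEQ_power_zero) auto
          then have "(\<lambda>k. complex_of_real (exp (- (y ^ Suc k)))) \<longlonglongrightarrow> complex_of_real (exp (- 0))" by (intro tendsto_intros)
          then show ?thesis using 1 by (simp add: gy)
        next
          case 2
          then have "\<bar>(x - c) / r\<bar> > 1" using r by (auto simp: c_def r_def abs_if field_simps)
          then have "\<bar>(x - c) / r\<bar>\<^sup>2 > 1\<^sup>2" by (intro power_strict_mono) auto
          then have "y > 1" unfolding y_def power2_abs by simp
          then have "filterlim (\<lambda>k. y ^ Suc k) at_top sequentially"
            by (intro filterlim_at_infinity_imp_filterlim_at_top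
                filterlim_compose[OF filterlim_realpow_sequentially_gt1[of y] filterlim_Suc]) auto
          then have "(\<lambda>k. exp (- (y ^ Suc k))) \<longlonglongrightarrow> 0"
            by (intro filterlim_compose[OF exp_at_bot] filterlim_compose[OF filterlim_uminus_at_bot_at_top])
          then have "(\<lambda>k. complex_of_real (exp (- (y ^ Suc k)))) \<longlonglongrightarrow> complex_of_real 0" by (intro tendsto_of_real)
          then show ?thesis using 2 by (auto simp: gy)
        qed
      qed
    qed
  qed
qed

section \<open>Strong continuity of the dilation group\<close>

lemma dil_tendsto_schwartz:
  assumes f: "schwartz f"
  shows "((\<lambda>t. Lnorm p (\<lambda>x. dil p t f x - f x)) \<longlongrightarrow> 0) (at 0)"
  unfolding tendsto_at_iff_sequentially o_def
proof (intro allI impI)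
  fix X :: "nat \<Rightarrow> real" assume "\<forall>i. X i \<in> UNIV - {0}" and X: "X \<longlonglongrightarrow> 0"
  have "eventually (\<lambda>n. norm (X n) < 1) sequentially" using tendsto_norm[OF X] by (intro order_tendstoD) auto
  then obtain M where M: "\<And>n. n \<ge> M \<Longrightarrow> \<bar>X n\<bar> < 1" by (auto simp: eventually_sequentially)
  obtain C where C: "0 \<le> C" "\<And>x. norm (f x) * (1 + x\<^sup>2) \<le> C" using schwartz_decay[OF f, of 0 0] by auto
  \<comment> \<open>For |t| < 1 the prefactor is at most e, and 1 + x^2 <= e^2 (1 + (e^(-t) x)^2)
    moves the decay of f from the dilated point back to x; hence the two exponentials.\<close>
  define w where "w x = complex_of_real (exp 1 * exp 2 * C / (1 + x\<^sup>2))" for x :: real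
  have w: "w \<in> Lp p"
  proof (rule Lp_bounded_decay[OF p1])
    show "w \<in> borel_measurable borel" unfolding w_def by measurable
    show "norm (w x) * (1 + x\<^sup>2) \<le> exp 1 * exp 2 * C" for x
    proof -
      have "1 + x\<^sup>2 > 0" by (simp add: add_pos_nonneg)
      then show ?thesis using C(1) unfolding w_def norm_of_real by simp
    qed
  qed
  note fm = schwartz_measurable[OF f]
  show "(\<lambda>n. Lnorm p (\<lambda>x. dil p (X n) f x - f x)) \<longlonglongrightarrow> 0"
  proof (rule LIMSEQ_offset[of _ M], rule Lp_dominated_convergence[OF p1 _ schwartz_Lp[OF f] w])
    show "dil p (X (n + M)) f \<in> borel_measurable borel" for n
      by (rule dil_measurable[OF p1 fm])
    show "AE x in lborel. (\<lambda>n. dil p (X (n + M)) f x) \<longlonglongrightarrow> f x"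
    proof (rule AE_I2)
      fix x :: real
      have c: "isCont f (exp (- 0) * x)"
        using schwartz_nderiv_continuous[OF f, of UNIV 0] by (simp add: continuous_on_eq_continuous_at)
      have "(\<lambda>n. X (n + M)) \<longlonglongrightarrow> 0" by (rule LIMSEQ_ignore_initial_segment[OF X])
      then have "(\<lambda>n. dil p (X (n + M)) f x) \<longlonglongrightarrow> complex_of_real (exp (- 0 / p)) * f (exp (- 0) * x)"
        unfolding dil_def using p1 by (intro tendsto_intros isCont_tendsto_compose[OF c]) auto
      then show "(\<lambda>n. dil p (X (n + M)) f x) \<longlonglongrightarrow> f x" by simp
    qed
    show "AE x in lborel. norm (dil p (X (n + M)) f x) \<le> norm (w x)" for n
    proof (rule AE_I2)
      fix x :: real
      define t where "t = X (n + M)"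
      have t: "\<bar>t\<bar> < 1" using M[of "n + M"] by (simp add: t_def)
      have "exp (- t / p) \<le> exp 1" using t p1 by (auto simp: field_simps abs_if split: if_splits)
      have pos: "1 + x\<^sup>2 > 0" "1 + (exp (- t) * x)\<^sup>2 > 0" by (simp_all add: add_pos_nonneg)
      have "exp (-2) * (1 + x\<^sup>2) \<le> 1 + (exp (- t) * x)\<^sup>2"
      proof -
        have "exp (-2) \<le> exp (- 2 * t)" using t by auto
        also have "exp (- 2 * t) = (exp (- t))\<^sup>2" by (simp flip: exp_double)
        finally have "exp (-2) * x\<^sup>2 \<le> (exp (- t))\<^sup>2 * x\<^sup>2" by (intro mult_right_mono) auto
        moreover have "exp (-2) \<le> (1::real)" by simp
        ultimately show ?thesis unfolding power_mult_distrib distrib_left by linarith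
      qed
      then have "1 + x\<^sup>2 \<le> exp 2 * (1 + (exp (- t) * x)\<^sup>2)" by (simp add: exp_minus field_simps)
      then have "norm (f (exp (- t) * x)) * (1 + x\<^sup>2) \<le> norm (f (exp (- t) * x)) * (exp 2 * (1 + (exp (- t) * x)\<^sup>2))"
        by (intro mult_left_mono) auto
      also have "\<dots> \<le> exp 2 * C" using C(2)[of "exp (- t) * x"] by (simp add: mult_ac)
      finally have 1: "norm (f (exp (- t) * x)) \<le> exp 2 * C / (1 + x\<^sup>2)" using pos by (simp add: field_simps)
      have "norm (dil p t f x) \<le> exp 1 * (exp 2 * C / (1 + x\<^sup>2))"
        unfolding dil_def norm_mult norm_of_real using 1 \<open>exp (- t / p) \<le> exp 1\<close> by (intro mult_mono) auto
      also have "\<dots> = norm (w x)" unfolding w_def norm_of_real using C(1) pos by (simp add: abs_of_nonneg)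
      finally show "norm (dil p (X (n + M)) f x) \<le> norm (w x)" by (simp add: t_def)
    qed
  qed
qed

text \<open>Three-epsilon argument: dilations are isometries, so a Schwartz approximation has the
  same error before and after dilation.\<close>

lemma dil_tendsto:
  assumes f: "f \<in> Lp p"
  shows "((\<lambda>t. Lnorm p (\<lambda>x. dil p t f x - f x)) \<longlongrightarrow> 0) (at 0)"
proof (rule tendstoI)
  fix e :: real assume e: "e > 0"
  obtain g where g: "schwartz g" "Lnorm p (\<lambda>x. f x - g x) < e / 3"
    using f e schwartz_dense by (auto simp: Lcl_def dest!: spec[of _ "e/3"] equalityD2 subsetD)
  have gL: "g \<in> Lp p" by (rule schwartz_Lp[OF g(1)])
  have "eventually (\<lambda>t. Lnorm p (\<lambda>x. dil p t g x - g x) < e / 3) (at 0)"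
    using dil_tendsto_schwartz[OF g(1)] e by (intro order_tendstoD) auto
  then show "eventually (\<lambda>t. dist (Lnorm p (\<lambda>x. dil p t f x - f x)) 0 < e) (at 0)"
  proof eventually_elim
    case (elim t)
    note L = dil_Lp[OF p1]
    have "Lnorm p (\<lambda>x. dil p t f x - dil p t g x) < e / 3"
      using g(2) Lnorm_dil[OF p1, of t "\<lambda>x. f x - g x"] by (simp add: dil_diff[OF p1])
    moreover have "Lnorm p (\<lambda>x. dil p t f x - f x) \<le> Lnorm p (\<lambda>x. dil p t f x - dil p t g x) + Lnorm p (\<lambda>x. dil p t g x - f x)"
      by (intro Lnorm_triangle3 p1 L f gL)
    moreover have "Lnorm p (\<lambda>x. dil p t g x - f x) \<le> Lnorm p (\<lambda>x. dil p t g x - g x) + Lnorm p (\<lambda>x. g x - f x)"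
      by (intro Lnorm_triangle3 p1 L f gL)
    ultimately show ?case using elim g(2) by (simp add: Lnorm_minus_commute[OF p1, of g f])
  qed
qed

end

section \<open>Averages of dilations\<close>

text \<open>The operator integral of k(t) T_t, written pointwise. In the logarithmic variable on
  each half-line it is, up to an exponential weight, an ordinary convolution, so composition of
  operators becomes convolution of kernels.\<close>

definition conv :: "real \<Rightarrow> (real \<Rightarrow> complex) \<Rightarrow> (real \<Rightarrow> complex) \<Rightarrow> real \<Rightarrow> complex" where
  "conv p k F x = (LINT t|lborel. k t * dil p t F x)"

lemma dil_commute: "dil p t (dil p u F) = dil p u (dil p t F)"
  by (simp add: dil_def fun_eq_iff mult_ac)

lemma dil_pair_measurable [measurable]:
  assumes [measurable]: "F \<in> borel_measurable borel"
  shows "(\<lambda>(t, x). dil p t F x) \<in> borel_measurable (lborel \<Otimes>\<^sub>M borel)"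
  unfolding dil_def by measurable

lemma dil_measurable_fst [measurable]:
  assumes [measurable]: "F \<in> borel_measurable borel"
  shows "(\<lambda>t. dil p t F x) \<in> borel_measurable borel"
  unfolding dil_def by measurable

lemma conv_measurable [measurable]:
  assumes [measurable]: "F \<in> borel_measurable borel" "k \<in> borel_measurable borel"
  shows "conv p k F \<in> borel_measurable borel"
  unfolding conv_def dil_def by measurable

lemma dil_conv: "dil p u (conv p k F) = conv p k (dil p u F)"
proof
  fix x
  have "dil p u (conv p k F) x = (LINT t|lborel. of_real (exp (- u / p)) * (k t * dil p t F (exp (- u) * x)))"
    by (simp add: dil_def conv_def)
  also have "\<dots> = (LINT t|lborel. k t * dil p u (dil p t F) x)" by (simp add: dil_def mult_ac)
  also have "\<dots> = conv p k (dil p u F) x" unfolding conv_def by (subst dil_commute) simp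
  finally show "dil p u (conv p k F) x = conv p k (dil p u F) x" .
qed

lemma conv_scale: "conv p k (\<lambda>x. c * F x) x = c * conv p k F x"
  by (simp add: conv_def dil_def mult_ac flip: integral_mult_right_zero)

lemma conv_kernel_scale: "conv p (\<lambda>t. c * k t) F x = c * conv p k F x"
  by (simp add: conv_def mult_ac flip: integral_mult_right_zero)

lemma sigma_finite_lborel_pair: "sigma_finite_measure (lborel \<Otimes>\<^sub>M lborel :: (real \<times> real) measure)"
  by (rule lborel_pair.sigma_finite_measure_axioms)

context
  fixes p :: real
  assumes p1: "1 \<le> p"
begin

lemma conv_bounds:
  assumes k: "integrable lborel k" and F: "F \<in> Lp p"
  shows conv_AE_integrable: "AE x in lborel. integrable lborel (\<lambda>t. k t * dil p t F x)"
    and conv_Lp: "conv p k F \<in> Lp p"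
    and Lnorm_conv: "Lnorm p (conv p k F) \<le> (LINT t|lborel. norm (k t)) * Lnorm p F"
proof -
  note m [measurable] = F[THEN Lp_measurable]
  note L = Lnorm_integral_le[OF p1 sigma_finite_lborel dil_pair_measurable[OF m] k dil_Lp[OF p1 F], where B="Lnorm p F"]
  show "AE x in lborel. integrable lborel (\<lambda>t. k t * dil p t F x)" by (rule L(1)) (simp_all add: Lnorm_dil[OF p1])
  show "conv p k F \<in> Lp p" unfolding conv_def[abs_def] by (rule L(2)) (simp_all add: Lnorm_dil[OF p1])
  show "Lnorm p (conv p k F) \<le> (LINT t|lborel. norm (k t)) * Lnorm p F" unfolding conv_def[abs_def] by (rule L(3)) (simp_all add: Lnorm_dil[OF p1])
qed

text \<open>The integral defining an average is only known to converge for almost every x, so even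
  additivity is an identity almost everywhere; scaling by a constant, by contrast, holds
  pointwise.\<close>

lemma conv_add_AE:
  assumes k: "integrable lborel k" and F: "F \<in> Lp p" and G: "G \<in> Lp p"
  shows "AE x in lborel. conv p k (\<lambda>x. a * F x + b * G x) x = a * conv p k F x + b * conv p k G x"
  using conv_AE_integrable[OF k F] conv_AE_integrable[OF k G]
proof eventually_elim
  case (elim x)
  have "conv p k (\<lambda>x. a * F x + b * G x) x = (LINT t|lborel. a * (k t * dil p t F x) + b * (k t * dil p t G x))"
    unfolding conv_def by (simp add: dil_def algebra_simps)
  then show ?case using elim by (simp add: conv_def)
qed

lemma conv_diff_AE:
  assumes "integrable lborel k" "F \<in> Lp p" "G \<in> Lp p"
  shows "AE x in lborel. conv p k (\<lambda>x. F x - G x) x = conv p k F x - conv p k G x"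
  using conv_add_AE[OF assms, of 1 "-1"] by simp

lemma conv_kernel_add_AE:
  assumes k: "integrable lborel k" and l: "integrable lborel l" and F: "F \<in> Lp p"
  shows "AE x in lborel. conv p (\<lambda>t. k t + l t) F x = conv p k F x + conv p l F x"
  using conv_AE_integrable[OF k F] conv_AE_integrable[OF l F]
  by eventually_elim (simp add: conv_def distrib_right)

lemma Lnorm_conv_diff:
  assumes k: "integrable lborel k" and F: "F \<in> Lp p" and G: "G \<in> Lp p"
  shows "Lnorm p (\<lambda>x. conv p k F x - conv p k G x) \<le> (LINT t|lborel. norm (k t)) * Lnorm p (\<lambda>x. F x - G x)"
proof -
  have "Lnorm p (\<lambda>x. conv p k F x - conv p k G x) = Lnorm p (conv p k (\<lambda>x. F x - G x))"
  proof (rule Lnorm_cong_AE)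
    show "AE x in lborel. conv p k F x - conv p k G x = conv p k (\<lambda>x. F x - G x) x"
      using conv_diff_AE[OF assms] by eventually_elim simp
  qed (use Lp_diff[OF p1 conv_Lp[OF k F] conv_Lp[OF k G]] conv_Lp[OF k Lp_diff[OF p1 F G]] in auto)
  then show ?thesis using Lnorm_conv[OF k Lp_diff[OF p1 F G]] by simp
qed

lemma conv_cong_AE:
  assumes k: "integrable lborel k" and F: "F \<in> Lp p" and G: "G \<in> Lp p" and eq: "AE x in lborel. F x = G x"
  shows "AE x in lborel. conv p k F x = conv p k G x"
proof -
  have "Lnorm p (\<lambda>x. F x - G x) = 0" using eq Lp_diff[OF p1 F G] by (simp add: Lnorm_eq_0[OF p1])
  then have "Lnorm p (\<lambda>x. conv p k F x - conv p k G x) = 0"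
    using Lnorm_conv_diff[OF k F G] Lnorm_nonneg[of p "\<lambda>x. conv p k F x - conv p k G x"] by simp
  then show ?thesis unfolding Lnorm_eq_0[OF p1 Lp_diff[OF p1 conv_Lp[OF k F] conv_Lp[OF k G]]] by eventually_elim simp
qed

text \<open>Fubini after the translation s = t - r. Absolute integrability over the product of the
  two time axes, for almost every x, comes from Minkowski's inequality with kernel k(r) l(s) and
  family T_(r+s) F.\<close>

lemma conv_conv:
  assumes k: "integrable lborel k" and l: "integrable lborel l" and F: "F \<in> Lp p"
    and [measurable]: "m \<in> borel_measurable borel" and m: "AE t in lborel. m t = (LINT r|lborel. k r * l (t - r))"
  shows "AE x in lborel. conv p k (conv p l F) x = conv p m F x"
proof -
  have [measurable]: "k \<in> borel_measurable borel" "l \<in> borel_measurable borel" "F \<in> borel_measurable borel"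
    using borel_measurable_integrable[OF k] borel_measurable_integrable[OF l] F[THEN Lp_measurable] by auto
  have kl: "integrable (lborel \<Otimes>\<^sub>M lborel) (\<lambda>z. k (fst z) * l (snd z))"
    by (rule lborel_pair.Fubini_integrable) (use k l in \<open>auto simp: norm_mult\<close>)
  have um: "(\<lambda>(z, x). dil p (fst z + snd z) F x) \<in> borel_measurable ((lborel \<Otimes>\<^sub>M lborel) \<Otimes>\<^sub>M borel)"
    unfolding dil_def by measurable
  have "AE x in lborel. integrable (lborel \<Otimes>\<^sub>M lborel) (\<lambda>z. k (fst z) * l (snd z) * dil p (fst z + snd z) F x)"
    by (rule Lnorm_integral_le(1)[OF p1 sigma_finite_lborel_pair um kl dil_Lp[OF p1 F], of "Lnorm p F"]) (simp_all add: Lnorm_dil[OF p1])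
  then show ?thesis
  proof eventually_elim
    case (elim x)
    have "(\<integral>\<^sup>+z. ennreal (norm (k (fst z) * l (snd z) * dil p (fst z + snd z) F x)) \<partial>(lborel \<Otimes>\<^sub>M lborel)) < \<infinity>"
      using elim unfolding integrable_iff_bounded by blast
    moreover have "(\<integral>\<^sup>+z. ennreal (norm (k (fst z) * l (snd z) * dil p (fst z + snd z) F x)) \<partial>(lborel \<Otimes>\<^sub>M lborel))
       = (\<integral>\<^sup>+z. ennreal (norm (k (fst z) * l (snd z - fst z) * dil p (snd z) F x)) \<partial>(lborel \<Otimes>\<^sub>M lborel))"
    proof -
      have "(\<integral>\<^sup>+z. ennreal (norm (k (fst z) * l (snd z) * dil p (fst z + snd z) F x)) \<partial>(lborel \<Otimes>\<^sub>M lborel))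
          = (\<integral>\<^sup>+r. \<integral>\<^sup>+s. ennreal (norm (k r * l s * dil p (r + s) F x)) \<partial>lborel \<partial>lborel)"
        by (subst lborel.nn_integral_fst[symmetric]) (auto simp: dil_def)
      also have "\<dots> = (\<integral>\<^sup>+r. \<integral>\<^sup>+s. ennreal (norm (k r * l (s - r) * dil p s F x)) \<partial>lborel \<partial>lborel)"
      proof (rule nn_integral_cong)
        fix r :: real
        show "(\<integral>\<^sup>+s. ennreal (norm (k r * l s * dil p (r + s) F x)) \<partial>lborel) = (\<integral>\<^sup>+s. ennreal (norm (k r * l (s - r) * dil p s F x)) \<partial>lborel)"
          using nn_integral_real_affine[of "\<lambda>s. ennreal (norm (k r * l s * dil p (r + s) F x))" 1 "- r"]
          by (simp add: dil_def)
      qed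
      also have "\<dots> = (\<integral>\<^sup>+z. ennreal (norm (k (fst z) * l (snd z - fst z) * dil p (snd z) F x)) \<partial>(lborel \<Otimes>\<^sub>M lborel))"
        by (subst lborel.nn_integral_fst[symmetric]) (auto simp: dil_def)
      finally show ?thesis .
    qed
    ultimately have "integrable (lborel \<Otimes>\<^sub>M lborel) (\<lambda>z. k (fst z) * l (snd z - fst z) * dil p (snd z) F x)"
      unfolding integrable_iff_bounded by (simp add: dil_def)
    then have int: "integrable (lborel \<Otimes>\<^sub>M lborel) (\<lambda>(r, t). k r * l (t - r) * dil p t F x)"
      by (simp add: case_prod_unfold)
    have "conv p k (conv p l F) x = (LINT r|lborel. LINT s|lborel. k r * l s * dil p (r + s) F x)"
    proof -
      have "conv p k (conv p l F) x = (LINT r|lborel. k r * conv p l (dil p r F) x)"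
        by (simp add: conv_def[of p k] dil_conv)
      also have "\<dots> = (LINT r|lborel. LINT s|lborel. k r * (l s * dil p s (dil p r F) x))"
        by (simp add: conv_def)
      finally show ?thesis by (simp add: dil_dil[OF p1] mult.assoc add.commute)
    qed
    also have "\<dots> = (LINT r|lborel. LINT t|lborel. k r * l (t - r) * dil p t F x)"
    proof (rule Bochner_Integration.integral_cong[OF refl])
      fix r :: real
      show "(LINT s|lborel. k r * l s * dil p (r + s) F x) = (LINT t|lborel. k r * l (t - r) * dil p t F x)"
        using lborel_integral_real_affine[of 1 "\<lambda>s. k r * l s * dil p (r + s) F x" "- r"] by simp
    qed
    also have "\<dots> = (LINT t|lborel. LINT r|lborel. k r * l (t - r) * dil p t F x)"
      by (rule lborel_pair.Fubini_integral[OF int, symmetric])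
    also have "\<dots> = (LINT t|lborel. (LINT r|lborel. k r * l (t - r)) * dil p t F x)" by simp
    also have "\<dots> = conv p m F x"
      unfolding conv_def by (rule integral_cong_AE) (use m in \<open>auto elim: eventually_mono simp: dil_def\<close>)
    finally show ?case .
  qed
qed

text \<open>The convolution of k and l is symmetric by r -> t - r, so both compositions have the
  same kernel.\<close>

lemma conv_commute:
  assumes k: "integrable lborel k" and l: "integrable lborel l" and F: "F \<in> Lp p"
  shows "AE x in lborel. conv p k (conv p l F) x = conv p l (conv p k F) x"
proof -
  have [measurable]: "k \<in> borel_measurable borel" "l \<in> borel_measurable borel"
    using borel_measurable_integrable[OF k] borel_measurable_integrable[OF l] by auto
  define m where "m t = (LINT r|lborel. k r * l (t - r))" for t
  have mm: "m \<in> borel_measurable borel" unfolding m_def by measurable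
  have m2: "m t = (LINT r|lborel. l r * k (t - r))" for t
    unfolding m_def using lborel_integral_real_affine[of "-1" "\<lambda>r. k r * l (t - r)" t] by (simp add: mult.commute)
  show ?thesis
    using conv_conv[OF k l F mm] conv_conv[OF l k F mm]
    by (simp add: m_def[symmetric] m2[symmetric]) (auto elim: eventually_elim2)
qed

section \<open>Averages inside closed dilation-invariant subspaces\<close>

lemma dil_Lcl:
  assumes V: "V \<subseteq> Lp p" and inv: "\<And>f t. f \<in> V \<Longrightarrow> dil p t f \<in> Lcl p V" and f: "f \<in> Lcl p V"
  shows "dil p t f \<in> Lcl p V"
proof (rule Lcl_approx[OF p1 V])
  have fL: "f \<in> Lp p" using f Lcl_subset[OF p1] by blast
  then show "dil p t f \<in> Lp p" by (rule dil_Lp[OF p1])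
  fix e :: real assume "e > 0"
  then obtain g where g: "g \<in> V" "Lnorm p (\<lambda>x. f x - g x) < e" using f by (auto simp: Lcl_def)
  have "Lnorm p (\<lambda>x. dil p t f x - dil p t g x) < e"
    using g(2) Lnorm_dil[OF p1, of t "\<lambda>x. f x - g x"] by (simp add: dil_diff[OF p1])
  then show "\<exists>h\<in>Lcl p V. Lnorm p (\<lambda>x. dil p t f x - h x) < e" using inv[OF g(1)] by blast
qed

lemma dil_Lp_modulus:
  assumes F: "F \<in> Lp p" and e: "e > 0"
  obtains d where "d > 0" "\<And>t. \<bar>t\<bar> < d \<Longrightarrow> Lnorm p (\<lambda>x. dil p t F x - F x) < e"
proof -
  have "eventually (\<lambda>t. Lnorm p (\<lambda>x. dil p t F x - F x) < e) (at 0)"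
    using dil_tendsto[OF p1 F] e by (intro order_tendstoD) auto
  then obtain d where d: "d > 0" "\<And>t. t \<noteq> 0 \<Longrightarrow> \<bar>t\<bar> < d \<Longrightarrow> Lnorm p (\<lambda>x. dil p t F x - F x) < e"
    by (auto simp: eventually_at)
  have "Lnorm p (\<lambda>x. dil p t F x - F x) < e" if "\<bar>t\<bar> < d" for t
    using d(2)[of t] that e by (cases "t = 0") (simp_all add: dil_0[OF p1] Lnorm_zero[OF p1])
  with d(1) show ?thesis using that by blast
qed

text \<open>Riemann sums: on a grid of mesh h the dilation is frozen at the left end of its cell,
  which leaves a finite combination of dilates of F because k has bounded support. Strong continuity
  and Minkowski's inequality control the error.\<close>

lemma conv_compact_Lcl:
  assumes V: "Lsub p V" and inv: "\<And>f t. f \<in> V \<Longrightarrow> dil p t f \<in> Lcl p V" and F: "F \<in> Lcl p V"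
    and k: "integrable lborel k" and supp: "\<And>t. \<bar>t\<bar> > M \<Longrightarrow> k t = 0"
  shows "conv p k F \<in> Lcl p V"
proof (rule Lcl_approx[OF p1])
  show VL: "V \<subseteq> Lp p" using V by (simp add: Lsub_def)
  have FL: "F \<in> Lp p" using F Lcl_subset[OF p1] by blast
  note [measurable] = FL[THEN Lp_measurable]
  have [measurable]: "k \<in> borel_measurable borel" using borel_measurable_integrable[OF k] by simp
  show "conv p k F \<in> Lp p" by (rule conv_Lp[OF k FL])
  fix e :: real assume e: "e > 0"
  define K where "K = (LINT t|lborel. norm (k t))"
  have K: "K \<ge> 0" by (simp add: K_def)
  \<comment> \<open>\<open>K + 1\<close> in place of K keeps the tolerance meaningful when K =
    0.\<close>
  obtain d where d: "d > 0" "\<And>t. \<bar>t\<bar> < d \<Longrightarrow> Lnorm p (\<lambda>x. dil p t F x - F x) < e / (2 * (K + 1))"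
    using dil_Lp_modulus[OF FL, of "e / (2 * (K + 1))"] e K by auto
  define h where "h = d / 2"
  have h: "h > 0" "h < d" using d(1) by (auto simp: h_def)
  define u where "u t x = dil p t F x - dil p (h * of_int \<lfloor>t / h\<rfloor>) F x" for t x
  have um: "(\<lambda>(t, x). u t x) \<in> borel_measurable (lborel \<Otimes>\<^sub>M borel)"
    unfolding u_def dil_def by measurable
  have uL: "u t \<in> Lp p" for t unfolding u_def by (intro Lp_diff p1 dil_Lp FL)
  have un: "Lnorm p (u t) \<le> e / (2 * (K + 1))" for t
  proof -
    define r where "r = h * of_int \<lfloor>t / h\<rfloor>"
    have "h * of_int \<lfloor>t / h\<rfloor> \<le> h * (t / h)" "h * (t / h) < h * (of_int \<lfloor>t / h\<rfloor> + 1)"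
      using h(1) by (intro mult_left_mono mult_strict_left_mono; linarith)+
    then have "r \<le> t" "t < r + h" unfolding r_def using h(1) by (simp_all add: distrib_left)
    then have "\<bar>t - r\<bar> < d" using h by auto
    moreover have "Lnorm p (u t) = Lnorm p (\<lambda>x. dil p (t - r) F x - F x)"
    proof -
      \<comment> \<open>The isometry T_r pulls the error back to time 0, so the modulus of
        continuity at 0 serves every cell.\<close>
      have "u t = dil p r (\<lambda>x. dil p (t - r) F x - F x)"
        unfolding u_def r_def[symmetric] dil_diff[OF p1] dil_dil[OF p1] by simp
      then show ?thesis by (simp add: Lnorm_dil[OF p1])
    qed
    ultimately show ?thesis using d(2)[of "t - r"] by simp
  qed
  note L = Lnorm_integral_le[OF p1 sigma_finite_lborel um k uL un]
  define J where "J = \<lceil>M / h\<rceil> + 1"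
  define c where "c j = (LINT t|lborel. k t * indicator {t. \<lfloor>t / h\<rfloor> = j} t)" for j
  define S where "S x = (\<Sum>j\<in>{-J..J}. c j * dil p (h * of_int j) F x)" for x
  have SV: "S \<in> Lcl p V"
    unfolding S_def[abs_def]
    by (intro Lsub_sum[OF p1 Lsub_Lcl[OF p1 V]] Lsub_scaleD[OF Lsub_Lcl[OF p1 V]] dil_Lcl[OF VL inv F])
  have kd: "k t * dil p (h * of_int \<lfloor>t / h\<rfloor>) F x
      = (\<Sum>j\<in>{-J..J}. k t * indicator {t. \<lfloor>t / h\<rfloor> = j} t * dil p (h * of_int j) F x)" for t x
  proof (cases "\<lfloor>t / h\<rfloor> \<in> {-J..J}")
    case True
    have "(\<Sum>j\<in>{-J..J}. k t * indicator {t. \<lfloor>t / h\<rfloor> = j} t * dil p (h * of_int j) F x)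
        = (\<Sum>j\<in>{\<lfloor>t / h\<rfloor>}. k t * indicator {t. \<lfloor>t / h\<rfloor> = j} t * dil p (h * of_int j) F x)"
      using True by (intro sum.mono_neutral_right) (auto simp: indicator_def)
    then show ?thesis by simp
  next
    case False
    have "M < \<bar>t\<bar>"
    proof (rule ccontr)
      assume "\<not> M < \<bar>t\<bar>"
      then have "\<bar>t / h\<bar> \<le> M / h" using h by (simp add: divide_right_mono)
      then have "- (M / h) \<le> t / h" "t / h \<le> M / h" by linarith+
      then have "- J \<le> \<lfloor>t / h\<rfloor>" "\<lfloor>t / h\<rfloor> \<le> J" unfolding J_def by linarith+
      then have "\<lfloor>t / h\<rfloor> \<in> {-J..J}" by simp
      then show False using False by simp
    qed
    then have "k t = 0" by (rule supp)
    then show ?thesis by simp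
  qed
  have int: "integrable lborel (\<lambda>t. k t * indicator {t. \<lfloor>t / h\<rfloor> = j} t)" for j
    by (rule Bochner_Integration.integrable_bound[OF k]) (auto simp: indicator_def)
  have Sx: "S x = (LINT t|lborel. k t * dil p (h * of_int \<lfloor>t / h\<rfloor>) F x)" for x
    unfolding kd S_def c_def using int by (subst Bochner_Integration.integral_sum) auto
  have Si: "integrable lborel (\<lambda>t. k t * dil p (h * of_int \<lfloor>t / h\<rfloor>) F x)" for x
    unfolding kd using int by (intro Bochner_Integration.integrable_sum integrable_mult_left)
  have "AE x in lborel. conv p k F x - S x = (LINT t|lborel. k t * u t x)"
    using conv_AE_integrable[OF k FL]
  proof eventually_elim
    case (elim x)
    show ?case unfolding conv_def Sx u_def using elim Si[of x] by (simp add: right_diff_distrib)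
  qed
  moreover have SL: "S \<in> Lp p" using SV Lcl_subset[OF p1] by blast
  ultimately have "Lnorm p (\<lambda>x. conv p k F x - S x) = Lnorm p (\<lambda>x. LINT t|lborel. k t * u t x)"
    using e K Lp_measurable[OF Lp_diff[OF p1 conv_Lp[OF k FL] SL]] Lp_measurable[OF L(2)]
    by (intro Lnorm_cong_AE) auto
  also have "\<dots> \<le> K * (e / (2 * (K + 1)))" using L(3)[folded K_def] e K by simp
  also have "\<dots> < e" using e K by (simp add: field_simps add_nonneg_pos)
  finally show "\<exists>g\<in>Lcl p V. Lnorm p (\<lambda>x. conv p k F x - g x) < e" using SV by blast
qed

text \<open>Truncating the kernel to [-n, n] makes an error that is small in L^1, and the L^1 norm
  of a kernel bounds its operator; so the case of bounded support passes to the limit.\<close>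

lemma conv_Lcl:
  assumes V: "Lsub p V" and inv: "\<And>f t. f \<in> V \<Longrightarrow> dil p t f \<in> Lcl p V" and F: "F \<in> Lcl p V"
    and k: "integrable lborel k"
  shows "conv p k F \<in> Lcl p V"
proof -
  have VL: "V \<subseteq> Lp p" using V by (simp add: Lsub_def)
  have FL: "F \<in> Lp p" using F Lcl_subset[OF p1] by blast
  have [measurable]: "k \<in> borel_measurable borel" using borel_measurable_integrable[OF k] by simp
  define kn where "kn n t = k t * indicator {- real n..real n} t" for n t
  have [measurable]: "kn n \<in> borel_measurable borel" for n unfolding kn_def by measurable
  have kn: "integrable lborel (kn n)" for n
    by (rule Bochner_Integration.integrable_bound[OF k]) (auto simp: kn_def indicator_def)
  show ?thesis
  proof (rule Lcl_limit[OF p1 VL])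
    show "conv p k F \<in> Lp p" by (rule conv_Lp[OF k FL])
    show "conv p (kn n) F \<in> Lcl p V" for n
      by (rule conv_compact_Lcl[OF V inv F kn, of "real n"]) (auto simp: kn_def indicator_def)
    show "(\<lambda>n. Lnorm p (\<lambda>x. conv p (kn n) F x - conv p k F x)) \<longlonglongrightarrow> 0"
    proof (rule Lim_null_comparison)
      have "Lnorm p (\<lambda>x. conv p (kn n) F x - conv p k F x) \<le> (LINT t|lborel. norm (kn n t - k t)) * Lnorm p F" for n
      proof -
        have "AE x in lborel. conv p (kn n) F x - conv p k F x = conv p (\<lambda>t. kn n t - k t) F x"
          using conv_kernel_add_AE[OF Bochner_Integration.integrable_diff[OF kn k] k FL, of n] by eventually_elim simp
        then have "Lnorm p (\<lambda>x. conv p (kn n) F x - conv p k F x) = Lnorm p (conv p (\<lambda>t. kn n t - k t) F)"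
          using Lp_measurable[OF conv_Lp[OF k FL]] Lp_measurable[OF conv_Lp[OF kn FL]] Lp_measurable[OF conv_Lp[OF Bochner_Integration.integrable_diff[OF kn k] FL]]
          by (intro Lnorm_cong_AE) auto
        then show ?thesis using Lnorm_conv[OF Bochner_Integration.integrable_diff[OF kn k] FL] by simp
      qed
      then show "eventually (\<lambda>n. norm (Lnorm p (\<lambda>x. conv p (kn n) F x - conv p k F x)) \<le> (LINT t|lborel. norm (kn n t - k t)) * Lnorm p F) sequentially"
        by (auto simp: abs_of_nonneg)
      have "(\<lambda>n. LINT t|lborel. norm (kn n t - k t)) \<longlonglongrightarrow> (LINT t::real|lborel. (0::real))"
      proof (rule integral_dominated_convergence[where w="\<lambda>t. norm (k t)"])
        show "AE t in lborel. (\<lambda>n. norm (kn n t - k t)) \<longlonglongrightarrow> 0"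
        proof (rule AE_I2)
          fix t :: real
          have "eventually (\<lambda>n. 0 = norm (kn n t - k t)) sequentially"
          proof (rule eventually_sequentiallyI[of "nat \<lceil>\<bar>t\<bar>\<rceil>"])
            fix n assume "nat \<lceil>\<bar>t\<bar>\<rceil> \<le> n"
            then have "\<bar>t\<bar> \<le> real n" by linarith
            then show "0 = norm (kn n t - k t)" by (auto simp: kn_def indicator_def)
          qed
          then show "(\<lambda>n. norm (kn n t - k t)) \<longlonglongrightarrow> 0" by (rule Lim_transform_eventually[OF tendsto_const])
        qed
      qed (use k in \<open>auto simp: kn_def indicator_def\<close>)
      then show "(\<lambda>n. (LINT t|lborel. norm (kn n t - k t)) * Lnorm p F) \<longlonglongrightarrow> 0"
        by (auto intro: tendsto_mult_left_zero)
    qed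
  qed
qed

end

section \<open>The generator of the dilation group on L^p\<close>

text \<open>A relation rather than a partial operator, because elements of L^p are functions
  determined only up to null sets.\<close>

definition Lgen :: "real \<Rightarrow> (real \<Rightarrow> complex) \<Rightarrow> (real \<Rightarrow> complex) \<Rightarrow> bool" where
  "Lgen p F H \<longleftrightarrow> F \<in> Lp p \<and> H \<in> Lp p \<and>
     ((\<lambda>t. Lnorm p (\<lambda>x. (dil p t F x - F x) / of_real t - H x)) \<longlongrightarrow> 0) (at 0)"

context
  fixes p :: real
  assumes p1: "1 \<le> p"
begin

lemma Lp_divide: "f \<in> Lp p \<Longrightarrow> (\<lambda>x. f x / c) \<in> Lp p"
  using Lp_scale[OF p1, of f "1 / c"] by simp

lemma Lnorm_divide: "Lnorm p (\<lambda>x. f x / c) = Lnorm p f / norm c"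
  using Lnorm_scale[OF p1, of "1 / c" f] by (simp add: norm_divide)

lemma Lp_quotient:
  assumes "F \<in> Lp p" "H \<in> Lp p" shows "(\<lambda>x. (dil p t F x - F x) / of_real t - H x) \<in> Lp p"
  by (intro Lp_diff p1 Lp_divide dil_Lp assms)

lemma LgenD: "Lgen p F H \<Longrightarrow> F \<in> Lp p" "Lgen p F H \<Longrightarrow> H \<in> Lp p"
  by (auto simp: Lgen_def)

text \<open>In a group the left difference quotient is T_(-s) applied to the right one, up to T_s H
  - H. The resolvent computation therefore has to treat h > 0 only.\<close>

lemma Lgen_rightI:
  assumes F: "F \<in> Lp p" and H: "H \<in> Lp p"
    and R: "((\<lambda>t. Lnorm p (\<lambda>x. (dil p t F x - F x) / of_real t - H x)) \<longlongrightarrow> 0) (at_right 0)"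
  shows "Lgen p F H"
proof -
  have "((\<lambda>t. Lnorm p (\<lambda>x. (dil p t F x - F x) / of_real t - H x)) \<longlongrightarrow> 0) (at_left 0)"
    unfolding filterlim_at_left_to_right
  proof (rule Lim_null_comparison)
    have "((\<lambda>t. Lnorm p (\<lambda>x. dil p t H x - H x)) \<longlongrightarrow> 0) (at_right 0)"
      using dil_tendsto[OF p1 H] by (rule filterlim_mono) (auto simp: at_le)
    from tendsto_add[OF R this]
    show "((\<lambda>s. Lnorm p (\<lambda>x. (dil p s F x - F x) / of_real s - H x) + Lnorm p (\<lambda>x. dil p s H x - H x)) \<longlongrightarrow> 0) (at_right (- 0))"
      by simp
    show "eventually (\<lambda>s. norm (Lnorm p (\<lambda>x. (dil p (- s) F x - F x) / of_real (- s) - H x))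
        \<le> Lnorm p (\<lambda>x. (dil p s F x - F x) / of_real s - H x) + Lnorm p (\<lambda>x. dil p s H x - H x)) (at_right (- 0))"
    proof (rule always_eventually, rule allI)
      fix s
      define Q where "Q x = (dil p s F x - F x) / of_real s - dil p s H x" for x
      have "dil p (- s) Q x = (dil p (- s) F x - F x) / of_real (- s) - H x" for x
      proof -
        have "dil p (- s) (\<lambda>x. 1 / of_real s * (dil p s F x - F x)) x = 1 / of_real s * (dil p (- s) (dil p s F) x - dil p (- s) F x)"
          unfolding dil_scale[OF p1] dil_diff[OF p1] ..
        then show ?thesis
          unfolding Q_def dil_diff[OF p1] by (simp add: dil_dil[OF p1] dil_0[OF p1] diff_divide_distrib)
      qed
      then have "Lnorm p (\<lambda>x. (dil p (- s) F x - F x) / of_real (- s) - H x) = Lnorm p Q"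
        using Lnorm_dil[OF p1, of "- s" Q] by presburger
      also have "\<dots> \<le> Lnorm p (\<lambda>x. (dil p s F x - F x) / of_real s - H x) + Lnorm p (\<lambda>x. H x - dil p s H x)"
        unfolding Q_def by (intro Lnorm_triangle3 p1 H dil_Lp Lp_divide Lp_diff F)
      finally show "norm (Lnorm p (\<lambda>x. (dil p (- s) F x - F x) / of_real (- s) - H x))
        \<le> Lnorm p (\<lambda>x. (dil p s F x - F x) / of_real s - H x) + Lnorm p (\<lambda>x. dil p s H x - H x)"
        by (simp add: Lnorm_minus_commute[OF p1, of H])
    qed
  qed
  with R show ?thesis using F H unfolding Lgen_def by (simp add: filterlim_split_at)
qed

lemma Lgen_add:
  assumes "Lgen p F H" "Lgen p F' H'"
  shows "Lgen p (\<lambda>x. a * F x + b * F' x) (\<lambda>x. a * H x + b * H' x)"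
proof -
  note L = assms[THEN LgenD(1)] assms[THEN LgenD(2)]
  let ?q = "\<lambda>F H t x. (dil p t F x - F x) / of_real t - H x"
  have "((\<lambda>t. Lnorm p (?q (\<lambda>x. a * F x + b * F' x) (\<lambda>x. a * H x + b * H' x) t)) \<longlongrightarrow> 0) (at 0)"
  proof (rule Lim_null_comparison)
    have "((\<lambda>t. norm a * Lnorm p (?q F H t) + norm b * Lnorm p (?q F' H' t)) \<longlongrightarrow> norm a * 0 + norm b * 0) (at 0)"
      using assms unfolding Lgen_def by (intro tendsto_intros) auto
    then show "((\<lambda>t. norm a * Lnorm p (?q F H t) + norm b * Lnorm p (?q F' H' t)) \<longlongrightarrow> 0) (at 0)" by simp
    have "Lnorm p (?q (\<lambda>x. a * F x + b * F' x) (\<lambda>x. a * H x + b * H' x) t) \<le> norm a * Lnorm p (?q F H t) + norm b * Lnorm p (?q F' H' t)" for t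
    proof -
      have "?q (\<lambda>x. a * F x + b * F' x) (\<lambda>x. a * H x + b * H' x) t = (\<lambda>x. a * ?q F H t x + b * ?q F' H' t x)"
        by (simp add: fun_eq_iff dil_add[OF p1] dil_scale[OF p1] divide_inverse algebra_simps)
      then show ?thesis
        using Lnorm_triangle[OF p1 Lp_scale[OF p1 Lp_quotient[OF L(1,3)], of a] Lp_scale[OF p1 Lp_quotient[OF L(2,4)], of b], of t t]
        by (simp add: Lnorm_scale[OF p1])
    qed
    then show "eventually (\<lambda>t. norm (Lnorm p (?q (\<lambda>x. a * F x + b * F' x) (\<lambda>x. a * H x + b * H' x) t)) \<le> norm a * Lnorm p (?q F H t) + norm b * Lnorm p (?q F' H' t)) (at 0)"
      by (simp add: abs_of_nonneg)
  qed
  then show ?thesis unfolding Lgen_def by (auto intro!: Lp_add Lp_scale p1 L)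
qed

lemma Lgen_cong_AE:
  assumes G: "Lgen p F H" and eq: "AE x in lborel. F x = F' x" "AE x in lborel. H x = H' x"
    and [measurable]: "F' \<in> borel_measurable borel" "H' \<in> borel_measurable borel"
  shows "Lgen p F' H'"
proof -
  note L = LgenD[OF G] LgenD[OF G, THEN Lp_measurable, measurable]
  have F': "F' \<in> Lp p" by (rule Lp_cong_AE[OF eq(1) L(1)]) measurable
  have H': "H' \<in> Lp p" by (rule Lp_cong_AE[OF eq(2) L(2)]) measurable
  have "Lnorm p (\<lambda>x. (dil p t F x - F x) / of_real t - H x) = Lnorm p (\<lambda>x. (dil p t F' x - F' x) / of_real t - H' x)" for t
  proof (rule Lnorm_cong_AE)
    show "AE x in lborel. (dil p t F x - F x) / of_real t - H x = (dil p t F' x - F' x) / of_real t - H' x"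
      using dil_cong_AE[OF p1 _ _ eq(1), of t] eq L(3) by (auto elim!: eventually_elim2)
  qed (use Lp_quotient[OF L(1,2)] Lp_quotient[OF F' H'] in auto)
  then show ?thesis using G F' H' unfolding Lgen_def by simp
qed

text \<open>For F = 0 all difference quotients vanish, so the constant norm of H tends to 0. With
  linearity this makes the generator single-valued modulo null sets.\<close>

lemma Lgen_zero:
  assumes G: "Lgen p F H" and F0: "AE x in lborel. F x = 0"
  shows "AE x in lborel. H x = 0"
proof -
  note L = LgenD[OF G]
  have "Lgen p (\<lambda>x. 0) H" using Lgen_cong_AE[OF G F0, of H] L[THEN Lp_measurable] by simp
  then have "((\<lambda>t::real. Lnorm p H) \<longlongrightarrow> 0) (at 0)"
    unfolding Lgen_def using Lnorm_scale[OF p1, of "-1" H] by (simp add: dil_def)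
  then have "Lnorm p H = 0" by (simp add: tendsto_const_iff)
  then show ?thesis using Lnorm_eq_0[OF p1 L(2)] by simp
qed

text \<open>Apart from integrability, the shift condition is all that is used of the kernel: k obeys
  the functional equation of e^(-zt) except for a defect on (0, h). In this form the forward kernel
  for Re z > 0 and the backward one for Re z < 0 are treated together.\<close>

lemma Lgen_resolventI:
  assumes k: "integrable lborel k" and G: "G \<in> Lp p"
    and shift: "\<And>h. h > 0 \<Longrightarrow> AE t in lborel. k (t - h) = exp (z * of_real h) * k t - exp (z * of_real (h - t)) * indicator {0<..<h} t"
  shows "Lgen p (conv p k G) (\<lambda>x. z * conv p k G x - G x)"
proof (rule Lgen_rightI)
  define R where "R = conv p k G"
  have R: "R \<in> Lp p" unfolding R_def by (rule conv_Lp[OF p1 k G])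
  then show "conv p k G \<in> Lp p" unfolding R_def .
  show "(\<lambda>x. z * conv p k G x - G x) \<in> Lp p" by (intro Lp_diff Lp_scale p1 G conv_Lp k)
  note [measurable] = G[THEN Lp_measurable] R[THEN Lp_measurable]
  have km [measurable]: "k \<in> borel_measurable borel" using borel_measurable_integrable[OF k] by simp
  have ind: "integrable lborel (\<lambda>t. indicator {0<..<h} t / of_real h :: complex)" for h :: real
  proof -
    have "integrable lborel (indicator {0<..<h} :: real \<Rightarrow> real)"
      by (rule integrable_real_indicator) (simp, rule emeasure_bounded_finite, simp)
    then have "integrable lborel (\<lambda>t. complex_of_real (indicator {0<..<h} t / h))"
      by (intro integrable_of_real integrable_divide)
    then show ?thesis by (simp add: of_real_indicator)
  qed
  \<comment> \<open>The mean over (0, h) of e^(z(h-t)) T_t G - G. It is what the jump of the kernel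
    at 0 leaves after G is subtracted, and strong continuity sends it to 0.\<close>
  define M where "M h x = (LINT t|lborel. (indicator {0<..<h} t / of_real h) * (exp (z * of_real (h - t)) * dil p t G x - G x))" for h x
  have main: "AE x in lborel. (dil p h R x - R x) / of_real h - (z * R x - G x) = ((exp (z * of_real h) - 1) / of_real h - z) * R x - M h x"
    if h: "h > 0" for h
  proof -
    let ?m = "\<lambda>t. exp (z * of_real (h - t)) * indicator {0<..<h} t"
    have mi: "integrable lborel ?m"
    proof -
      have "set_integrable lborel {0..h} (\<lambda>t. exp (z * of_real (h - t)))"
        by (rule borel_integrable_atLeastAtMost') (auto intro!: continuous_intros)
      then have "set_integrable lborel {0<..<h} (\<lambda>t. exp (z * of_real (h - t)))"
        by (rule set_integrable_subset) auto
      then show ?thesis by (simp add: set_integrable_def scaleR_conv_of_real of_real_indicator mult.commute)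
    qed
    show ?thesis
      using conv_AE_integrable[OF p1 k G] conv_AE_integrable[OF p1 mi G]
    proof eventually_elim
      case (elim x)
      have "dil p h R x = (LINT t|lborel. k t * dil p (t + h) G x)"
        unfolding R_def dil_conv by (simp add: conv_def dil_dil[OF p1])
      also have "\<dots> = (LINT t|lborel. k (t - h) * dil p t G x)"
        using lborel_integral_real_affine[of 1 "\<lambda>t. k t * dil p (t + h) G x" "- h"] by simp
      also have "\<dots> = (LINT t|lborel. exp (z * of_real h) * (k t * dil p t G x) - ?m t * dil p t G x)"
      proof (rule integral_cong_AE)
        show "AE t in lborel. k (t - h) * dil p t G x = exp (z * of_real h) * (k t * dil p t G x) - ?m t * dil p t G x"
          using shift[OF h] by eventually_elim (simp only: left_diff_distrib mult.assoc)
      qed auto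
      also have "\<dots> = exp (z * of_real h) * R x - (LINT t|lborel. ?m t * dil p t G x)"
        unfolding R_def conv_def using elim by simp
      finally have 1: "dil p h R x = exp (z * of_real h) * R x - (LINT t|lborel. ?m t * dil p t G x)" .
      have "M h x = (LINT t|lborel. (1 / of_real h) * (?m t * dil p t G x) - (indicator {0<..<h} t / of_real h) * G x)"
        unfolding M_def by (rule Bochner_Integration.integral_cong) (auto simp: algebra_simps)
      also have "\<dots> = (1 / of_real h) * (LINT t|lborel. ?m t * dil p t G x) - (LINT t|lborel. indicator {0<..<h} t / of_real h) * G x"
        unfolding Bochner_Integration.integral_diff[OF integrable_mult_right[OF elim(2)] integrable_mult_left[OF ind]]
          integral_mult_right_zero integral_mult_left_zero ..
      also have "(LINT t|lborel. indicator {0<..<h} t / of_real h :: complex) = 1"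
      proof -
        have "(LINT t|lborel. indicator {0<..<h} t / of_real h :: complex) = of_real (LINT t|lborel. indicator {0<..<h} t / h)"
          by (subst integral_complex_of_real[symmetric]) (simp add: of_real_indicator)
        then show ?thesis using h by simp
      qed
      finally have 2: "M h x = (LINT t|lborel. ?m t * dil p t G x) / of_real h - G x" by simp
      show ?case unfolding 1 2 using h by (simp add: field_simps)
    qed
  qed
  have "((\<lambda>h. Lnorm p (\<lambda>x. (dil p h R x - R x) / of_real h - (z * R x - G x))) \<longlongrightarrow> 0) (at_right 0)"
  proof (rule tendstoI)
    fix e :: real assume e: "e > 0"
    \<comment> \<open>Errors of size e' occur with the factors norm of R, norm of G, and 1; they add
      up to e' B, which is half of e.\<close>
    define B where "B = Lnorm p R + Lnorm p G + 1"
    have B: "B > 0" by (simp add: B_def add_nonneg_pos)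
    define e' where "e' = e / (2 * B)"
    have e': "e' > 0" using e B by (simp add: e'_def)
    obtain d1 where d1: "d1 > 0" "\<And>t. \<bar>t\<bar> < d1 \<Longrightarrow> Lnorm p (\<lambda>x. dil p t G x - G x) < e'"
      using dil_Lp_modulus[OF p1 G e'] by blast
    have "((\<lambda>t::real. norm (exp (z * of_real t) - 1)) \<longlongrightarrow> norm (exp (z * of_real 0) - 1)) (at 0)"
      by (intro tendsto_intros)
    then have "eventually (\<lambda>t::real. norm (exp (z * of_real t) - 1) < e') (at 0)"
      using e' by (intro order_tendstoD) auto
    then obtain d2 where d2: "d2 > 0" "\<And>t::real. t \<noteq> 0 \<Longrightarrow> \<bar>t\<bar> < d2 \<Longrightarrow> norm (exp (z * of_real t) - 1) < e'"
      by (auto simp: eventually_at)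
    have "((\<lambda>w. exp (z * w)) has_field_derivative z) (at 0)" by (auto intro!: derivative_eq_intros)
    then have "((\<lambda>w. (exp (z * w) - 1) / w) \<longlongrightarrow> z) (at 0)" by (simp add: has_field_derivative_iff)
    moreover have "filterlim complex_of_real (at 0) (at 0)"
      by (auto simp: filterlim_at eventually_at_filter intro!: tendsto_eq_intros)
    ultimately have "((\<lambda>h::real. (exp (z * of_real h) - 1) / of_real h) \<longlongrightarrow> z) (at 0)" by (rule filterlim_compose)
    then have "((\<lambda>h::real. norm ((exp (z * of_real h) - 1) / of_real h - z)) \<longlongrightarrow> 0) (at 0)"
      by (simp add: tendsto_norm_zero_iff LIM_zero)
    then have "eventually (\<lambda>h::real. norm ((exp (z * of_real h) - 1) / of_real h - z) < e') (at 0)"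
      using e' by (intro order_tendstoD) auto
    then have ev3: "eventually (\<lambda>h::real. norm ((exp (z * of_real h) - 1) / of_real h - z) < e') (at_right 0)"
      by (rule filter_leD[OF at_le, rotated]) simp
    have ev1: "eventually (\<lambda>h::real. 0 < h \<and> h < min d1 d2) (at_right 0)"
      using d1(1) d2(1) by (intro eventually_at_rightI[of _ "min d1 d2"]) auto
    from ev3 ev1 show "eventually (\<lambda>h. dist (Lnorm p (\<lambda>x. (dil p h R x - R x) / of_real h - (z * R x - G x))) 0 < e) (at_right 0)"
    proof eventually_elim
      case (elim h)
      then have h: "0 < h" "h < d1" "h < d2" by auto
      define u where "u t x = exp (z * of_real (h - t)) * dil p t G x - G x" for t x
      have um: "(\<lambda>(t, x). u t x) \<in> borel_measurable (lborel \<Otimes>\<^sub>M borel)"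
        unfolding u_def dil_def by measurable
      have uL: "u t \<in> Lp p" for t unfolding u_def by (intro Lp_diff Lp_scale p1 dil_Lp G)
      have un: "Lnorm p (u t) \<le> e' * (Lnorm p G + 1)" if "indicator {0<..<h} t / complex_of_real h \<noteq> 0" for t
      proof -
        have t: "0 < t" "t < h" using that by (auto simp: indicator_def split: if_splits)
        have "u t = (\<lambda>x. (exp (z * of_real (h - t)) - 1) * dil p t G x + (dil p t G x - G x))"
          by (simp add: u_def fun_eq_iff algebra_simps)
        then have "Lnorm p (u t) \<le> norm (exp (z * of_real (h - t)) - 1) * Lnorm p G + Lnorm p (\<lambda>x. dil p t G x - G x)"
          using Lnorm_triangle[OF p1 Lp_scale[OF p1 dil_Lp[OF p1 G]] Lp_diff[OF p1 dil_Lp[OF p1 G] G], of "exp (z * of_real (h - t)) - 1" t t]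
          by (simp add: Lnorm_scale[OF p1] Lnorm_dil[OF p1])
        also have "\<dots> \<le> e' * Lnorm p G + e'"
          using d1(2)[of t] d2(2)[of "h - t"] t h by (intro add_mono mult_right_mono) auto
        finally show ?thesis by (simp add: distrib_left)
      qed
      have one: "(LINT t|lborel. norm (indicator {0<..<h} t / complex_of_real h)) = 1"
      proof -
        have "(LINT t|lborel. norm (indicator {0<..<h} t / complex_of_real h)) = (LINT t|lborel. indicator {0<..<h} t / h)"
          using h by (intro Bochner_Integration.integral_cong) (auto simp: norm_divide indicator_def)
        also have "\<dots> = 1" using h by simp
        finally show ?thesis .
      qed
      note I = Lnorm_integral_le[OF p1 sigma_finite_lborel um ind[of h] uL un]
      have MhL: "M h \<in> Lp p" unfolding M_def[abs_def] u_def[symmetric] using e' by (intro I(2)) auto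
      have MN: "Lnorm p (M h) \<le> e' * (Lnorm p G + 1)"
        unfolding M_def[abs_def] u_def[symmetric] using I(3) e' by (simp add: one)
      have "Lnorm p (\<lambda>x. (dil p h R x - R x) / of_real h - (z * R x - G x))
          = Lnorm p (\<lambda>x. ((exp (z * of_real h) - 1) / of_real h - z) * R x - M h x)"
        by (rule Lnorm_cong_AE[OF main[OF h(1)]])
          (use Lp_measurable[OF Lp_quotient[OF R Lp_diff[OF p1 Lp_scale[OF p1 R] G]]] Lp_measurable[OF Lp_diff[OF p1 Lp_scale[OF p1 R] MhL]] in auto)
      also have "\<dots> \<le> Lnorm p (\<lambda>x. ((exp (z * of_real h) - 1) / of_real h - z) * R x) + Lnorm p (M h)"
        using Lnorm_triangle3[OF p1 Lp_scale[OF p1 R] Lp_zero[OF p1] MhL]  Lnorm_minus_commute[OF p1, of "\<lambda>x. 0" "M h"] by simp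
      also have "\<dots> \<le> e' * Lnorm p R + e' * (Lnorm p G + 1)"
        unfolding Lnorm_scale[OF p1] using MN elim by (intro add_mono mult_right_mono) auto
      also have "\<dots> = e' * B" by (simp add: B_def algebra_simps)
      also have "\<dots> < e" using e B by (simp add: e'_def)
      finally show ?case by simp
    qed
  qed
  then show "((\<lambda>h. Lnorm p (\<lambda>x. (dil p h (conv p k G) x - conv p k G x) / of_real h - (z * conv p k G x - G x))) \<longlongrightarrow> 0) (at_right 0)"
    by (simp add: R_def)
qed

end

section \<open>Absence of eigenvectors on L^p\<close>

lemma exp_deriv_quotient: "((\<lambda>h::real. (exp (- z * of_real h) * (1 + z * of_real h) - 1) / of_real h) \<longlongrightarrow> 0) (at 0)"
  for z :: complex
proof -
  have "((\<lambda>w. exp (- z * w) * (1 + z * w)) has_field_derivative 0) (at 0)"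
    by (auto intro!: derivative_eq_intros)
  then have "((\<lambda>w. (exp (- z * w) * (1 + z * w) - 1) / w) \<longlongrightarrow> 0) (at 0)" by (simp add: has_field_derivative_iff)
  moreover have "filterlim complex_of_real (at 0) (at 0)"
    by (auto simp: filterlim_at eventually_at_filter intro!: tendsto_eq_intros)
  ultimately show ?thesis by (rule filterlim_compose)
qed

context
  fixes p :: real
  assumes p1: "1 \<le> p"
begin

text \<open>The norm of e^(-zt) T_t F - F, as a real function of t, has derivative 0 everywhere: at
  t = 0 this is the eigenvalue equation, since e^(-zh)(1 + zh) - 1 = o(h), and the increment at s is
  T_s of the one at 0 times e^(-zs). A real function suffices, so no vector-valued differentiation
  is involved.\<close>

lemma Lgen_eigen_dil:
  assumes G: "Lgen p F H" and eig: "AE x in lborel. H x = z * F x"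
  shows "AE x in lborel. dil p t F x = exp (z * of_real t) * F x"
proof -
  have F: "F \<in> Lp p" using LgenD(1)[OF p1 G] .
  have Gz: "Lgen p F (\<lambda>x. z * F x)"
    using Lgen_cong_AE[OF p1 G _ eig, of F] Lp_measurable[OF F] by simp
  define D where "D h x = exp (- z * of_real h) * dil p h F x - F x" for h :: real and x
  have D: "D h \<in> Lp p" for h unfolding D_def by (intro Lp_diff Lp_scale p1 dil_Lp F)
  define \<phi> where "\<phi> t = Lnorm p (D t)" for t
  have Dlim: "((\<lambda>h. Lnorm p (D h) / \<bar>h\<bar>) \<longlongrightarrow> 0) (at 0)"
  proof (rule Lim_null_comparison)
    let ?Q = "\<lambda>h x. (dil p h F x - F x) / of_real h - z * F x"
    let ?b = "\<lambda>h. norm (exp (- z * of_real h)) * Lnorm p (?Q h) + norm ((exp (- z * of_real h) * (1 + z * of_real h) - 1) / of_real h) * Lnorm p F"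
    have "((\<lambda>h::real. norm (exp (- z * of_real h))) \<longlongrightarrow> norm (exp (- z * of_real 0))) (at 0)" by (intro tendsto_intros)
    moreover have "((\<lambda>h. Lnorm p (?Q h)) \<longlongrightarrow> 0) (at 0)" using Gz by (simp add: Lgen_def)
    ultimately have "(?b \<longlongrightarrow> norm (exp (- z * of_real 0)) * 0 + norm (0::complex) * Lnorm p F) (at 0)"
      using exp_deriv_quotient[of z] by (intro tendsto_intros) auto
    then show "(?b \<longlongrightarrow> 0) (at 0)" by simp
    have "Lnorm p (D h) / \<bar>h\<bar> \<le> ?b h" if "h \<noteq> 0" for h
    proof -
      have "D h x / of_real h = exp (- z * of_real h) * ?Q h x + ((exp (- z * of_real h) * (1 + z * of_real h) - 1) / of_real h) * F x" for x
        using that by (simp add: D_def field_simps)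
      then have "(\<lambda>x. D h x / of_real h) = (\<lambda>x. exp (- z * of_real h) * ?Q h x + ((exp (- z * of_real h) * (1 + z * of_real h) - 1) / of_real h) * F x)"
        by (rule ext)
      moreover have "Lnorm p (\<lambda>x. D h x / of_real h) = Lnorm p (D h) / \<bar>h\<bar>" by (simp add: Lnorm_divide[OF p1])
      ultimately have "Lnorm p (D h) / \<bar>h\<bar> = Lnorm p (\<lambda>x. exp (- z * of_real h) * ?Q h x + ((exp (- z * of_real h) * (1 + z * of_real h) - 1) / of_real h) * F x)"
        by presburger
      also have "\<dots> \<le> Lnorm p (\<lambda>x. exp (- z * of_real h) * ?Q h x) + Lnorm p (\<lambda>x. ((exp (- z * of_real h) * (1 + z * of_real h) - 1) / of_real h) * F x)"
        by (intro Lnorm_triangle p1 Lp_scale F Lp_quotient)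
      also have "\<dots> = ?b h" unfolding Lnorm_scale[OF p1] ..
      finally show ?thesis .
    qed
    then show "eventually (\<lambda>h. norm (Lnorm p (D h) / \<bar>h\<bar>) \<le> ?b h) (at 0)"
      unfolding eventually_at_filter by (intro always_eventually) (auto simp: abs_of_nonneg)
  qed
  have "(\<phi> has_real_derivative 0) (at s)" for s
    unfolding has_field_derivative_def DERIV_def
  proof -
    have "((\<lambda>h. (\<phi> (s + h) - \<phi> s) / h) \<longlongrightarrow> 0) (at 0)"
    proof (rule Lim_null_comparison)
      show "((\<lambda>h. norm (exp (- z * of_real s)) * (Lnorm p (D h) / \<bar>h\<bar>)) \<longlongrightarrow> 0) (at 0)"
        using tendsto_mult_right_zero[OF Dlim] by simp
      have "\<bar>\<phi> (s + h) - \<phi> s\<bar> \<le> norm (exp (- z * of_real s)) * Lnorm p (D h)" for h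
      proof -
        have e: "D (s + h) x - D s x = exp (- z * of_real s) * dil p s (D h) x" for x
        proof -
          have "exp (- z * of_real (s + h)) = exp (- z * of_real s) * exp (- z * of_real h)"
            by (simp add: ring_distribs flip: exp_add)
          then show ?thesis
            unfolding D_def dil_diff[OF p1] dil_scale[OF p1] dil_dil[OF p1] by (simp add: ring_distribs)
        qed
        have "\<bar>\<phi> (s + h) - \<phi> s\<bar> \<le> Lnorm p (\<lambda>x. D (s + h) x - D s x)"
          unfolding \<phi>_def by (rule Lnorm_diff_ineq[OF p1 D D])
        also have "\<dots> = norm (exp (- z * of_real s)) * Lnorm p (D h)"
          unfolding e Lnorm_scale[OF p1] Lnorm_dil[OF p1] ..
        finally show ?thesis .
      qed
      then show "eventually (\<lambda>h. norm ((\<phi> (s + h) - \<phi> s) / h) \<le> norm (exp (- z * of_real s)) * (Lnorm p (D h) / \<bar>h\<bar>)) (at 0)"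
        unfolding real_norm_def abs_divide times_divide_eq_right by (intro always_eventually allI divide_right_mono) auto
    qed
    then show "(\<phi> has_derivative (*) 0) (at s)"
      by (simp add: DERIV_def flip: has_field_derivative_def)
  qed
  then have "\<phi> t = \<phi> 0" by (intro DERIV_isconst_all) auto
  also have "\<phi> 0 = 0" by (simp add: \<phi>_def D_def[abs_def] dil_0[OF p1] Lnorm_zero[OF p1])
  finally have "AE x in lborel. D t x = 0" unfolding \<phi>_def Lnorm_eq_0[OF p1 D] .
  then show ?thesis
  proof eventually_elim
    case (elim x)
    then have "exp (z * of_real t) * (exp (- z * of_real t) * dil p t F x) = exp (z * of_real t) * F x" by (simp add: D_def)
    then show ?case by (simp add: mult.assoc[symmetric] flip: exp_add)
  qed
qed

text \<open>Isometry gives |e^z| = 1, so |F|^p has the same mass on [-M, M] as on [-M/e, M/e].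
  Repeating the contraction, this mass shrinks to that of the null set {0}.\<close>

lemma Lgen_eigen:
  assumes G: "Lgen p F H" and eig: "AE x in lborel. H x = z * F x"
  shows "AE x in lborel. F x = 0"
proof (rule ccontr)
  assume nz: "\<not> (AE x in lborel. F x = 0)"
  have F: "F \<in> Lp p" using LgenD(1)[OF p1 G] .
  note [measurable] = F[THEN Lp_measurable]
  have N: "Lnorm p F \<noteq> 0" using nz Lnorm_eq_0[OF p1 F] by simp
  have AE1: "AE x in lborel. dil p 1 F x = exp z * F x" using Lgen_eigen_dil[OF G eig, of 1] by simp
  have "Lnorm p F = Lnorm p (dil p 1 F)" by (simp add: Lnorm_dil[OF p1])
  also have "\<dots> = Lnorm p (\<lambda>x. exp z * F x)"
    by (rule Lnorm_cong_AE[OF AE1]) (use dil_Lp[OF p1 F] in auto)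
  also have "\<dots> = norm (exp z) * Lnorm p F" by (rule Lnorm_scale[OF p1])
  finally have nz1: "norm (exp z) = 1" using N by simp
  define J where "J M = (LINT x|lborel. indicator {-M..M} x * norm (F x) powr p)" for M
  have J1: "J M = J (exp (- 1) * M)" for M
  proof -
    have scaled: "(indicator {- (c * M)..c * M} (c * x) :: real) = indicator {-M..M} x" if "c > 0" for c x
      using mult_le_cancel_left_pos[OF that, of x M] mult_le_cancel_left_pos[OF that, of "-M" x]
      by (simp add: indicator_def)
    have "J M = (LINT x|lborel. indicator {-M..M} x * (exp (- 1) * norm (F (exp (- 1) * x)) powr p))"
      unfolding J_def
    proof (rule integral_cong_AE)
      show "AE x in lborel. indicator {-M..M} x * norm (F x) powr p = indicator {-M..M} x * (exp (- 1) * norm (F (exp (- 1) * x)) powr p)"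
        using AE1
      proof eventually_elim
        case (elim x)
        have "norm (F x) powr p = norm (dil p 1 F x) powr p" unfolding elim norm_mult nz1 by simp
        then show ?case by (simp add: norm_dil_powr[OF p1])
      qed
    qed auto
    also have "\<dots> = (LINT x|lborel. exp (- 1) * (indicator {- (exp (- 1) * M)..exp (- 1) * M} (exp (- 1) * x) * norm (F (exp (- 1) * x)) powr p))"
      unfolding scaled[of "exp (- 1)", simplified] by (simp only: mult_ac)
    also have "\<dots> = J (exp (- 1) * M)"
      unfolding J_def
      using lborel_integral_real_affine[of "exp (- 1)" "\<lambda>x. indicator {- (exp (- 1) * M)..exp (- 1) * M} x * norm (F x) powr p" 0] by simp
    finally show ?thesis .
  qed
  have Jk: "J M = J (exp (- real k) * M)" for M k
  proof (induction k)
    case (Suc k)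
    have "exp (- 1) * (exp (- real k) * M) = exp (- real (Suc k)) * M" by (simp add: mult.assoc[symmetric] flip: exp_add)
    then show ?case using Suc J1[of "exp (- real k) * M"] by metis
  qed simp
  have J0: "J M = 0" for M
  proof -
    have "(\<lambda>k. J (exp (- real k) * M)) \<longlonglongrightarrow> (LINT x::real|lborel. (0::real))"
      unfolding J_def
    proof (rule integral_dominated_convergence[where w="\<lambda>x. norm (F x) powr p"])
      have "AE x::real in lborel. x \<noteq> 0" by (rule AE_lborel_singleton)
      then show "AE x in lborel. (\<lambda>k. indicator {- (exp (- real k) * M)..exp (- real k) * M} x * norm (F x) powr p) \<longlonglongrightarrow> 0"
      proof eventually_elim
        case (elim x)
        have "(\<lambda>k. exp (- real k) * M) \<longlonglongrightarrow> 0 * M"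
          by (intro tendsto_intros filterlim_compose[OF exp_at_bot] filterlim_compose[OF filterlim_uminus_at_bot_at_top filterlim_real_sequentially])
        then have "eventually (\<lambda>k. exp (- real k) * M < \<bar>x\<bar>) sequentially" using elim by (intro order_tendstoD) auto
        then have "eventually (\<lambda>k. 0 = indicator {- (exp (- real k) * M)..exp (- real k) * M} x * norm (F x) powr p) sequentially"
          by eventually_elim (auto simp: indicator_def)
        then show ?case by (rule Lim_transform_eventually[OF tendsto_const])
      qed
    qed (use Lp_integrable[OF F] in \<open>auto simp: indicator_def\<close>)
    then have "(\<lambda>k::nat. J M) \<longlonglongrightarrow> 0" by (simp flip: Jk)
    then show ?thesis by (simp add: LIMSEQ_const_iff)
  qed
  have "(\<lambda>n. J (real n)) \<longlonglongrightarrow> (LINT x|lborel. norm (F x) powr p)"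
    unfolding J_def
  proof (rule integral_dominated_convergence[where w="\<lambda>x. norm (F x) powr p"])
    show "AE x in lborel. (\<lambda>n. indicator {- real n..real n} x * norm (F x) powr p) \<longlonglongrightarrow> norm (F x) powr p"
    proof (rule AE_I2)
      fix x
      have "eventually (\<lambda>n. norm (F x) powr p = indicator {- real n..real n} x * norm (F x) powr p) sequentially"
      proof (rule eventually_sequentiallyI[of "nat \<lceil>\<bar>x\<bar>\<rceil>"])
        fix n assume "nat \<lceil>\<bar>x\<bar>\<rceil> \<le> n"
        then have "\<bar>x\<bar> \<le> real n" by linarith
        then show "norm (F x) powr p = indicator {- real n..real n} x * norm (F x) powr p" by (auto simp: indicator_def)
      qed
      then show "(\<lambda>n. indicator {- real n..real n} x * norm (F x) powr p) \<longlonglongrightarrow> norm (F x) powr p"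
        by (rule Lim_transform_eventually[OF tendsto_const])
    qed
  qed (use Lp_integrable[OF F] in \<open>auto simp: indicator_def\<close>)
  then have "(LINT x|lborel. norm (F x) powr p) = 0" by (simp add: J0 LIMSEQ_const_iff)
  then show False using N by (simp add: Lnorm_def)
qed

end

section \<open>Erdelyi-Kober kernels\<close>

text \<open>Substituting \<open>s = x e\<^sup>-\<^sup>t\<close> turns \<open>x\<^sup>\<nu> W\<^sup>-\<^sup>\<alpha> (s\<^sup>-\<^sup>\<nu>\<^sup>-\<^sup>\<alpha> F)\<close> into an average of dilations of \<open>F\<close> with this kernel,
  where \<open>c = \<nu> + 1/p\<close>.\<close>

definition eker :: "real \<Rightarrow> real \<Rightarrow> real \<Rightarrow> real" where
  "eker a c t = (if t < 0 then (1 - exp t) powr (a - 1) * exp (c * t) / Gamma a else 0)"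

lemma eker_measurable [measurable]: "eker a c \<in> borel_measurable borel"
  unfolding eker_def by measurable

lemma eker_nonneg: "0 < a \<Longrightarrow> 0 \<le> eker a c t"
  by (simp add: eker_def Gamma_real_pos less_imp_le)

text \<open>With w = e^t the kernel becomes the Beta integrand w^(c-1) (1 - w)^(a-1): a > 0 handles
  t near 0, and c > 0 the behaviour at minus infinity.\<close>

lemma eker_integrable:
  assumes a: "0 < a" and c: "0 < c"
  shows "integrable lborel (eker a c)"
proof -
  define f where "f t = (1 - exp t) powr (a - 1) * exp (c * t)" for t :: real
  have i: "set_integrable lborel (einterval 0 1) (\<lambda>w. f (ln w) * (1 / w))"
  proof -
    have "set_integrable lborel {0<..<1} (\<lambda>w. w powr (c - 1) * (1 - w) powr (a - 1))"
      by (rule set_integrable_subset[OF integrable_Beta[OF c a]]) auto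
    moreover have e: "w powr (c - 1) * (1 - w) powr (a - 1) = f (ln w) * (1 / w)" if "w \<in> {0<..<1}" for w
      using that by (simp add: f_def powr_def exp_diff algebra_simps flip: exp_ln_iff)
    ultimately have "set_integrable lborel {0<..<1} (\<lambda>w. f (ln w) * (1 / w))"
      by (subst set_integrable_cong[OF refl refl e[symmetric]])
    moreover have "einterval 0 1 = {0<..<1}" by (auto simp: einterval_def)
    ultimately show ?thesis by simp
  qed
  have "set_integrable lborel (einterval (-\<infinity>) 0) f"
  proof (rule interval_integral_substitution_nonneg(1)[where g = ln and g' = "\<lambda>w. 1 / w" and a = 0 and b = 1])
    show "DERIV ln x :> 1 / x" if "0 < ereal x" "ereal x < 1" for x
      using that by (auto intro!: derivative_eq_intros)
    show "isCont f (ln x)" if "0 < ereal x" "ereal x < 1" for x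
      using that unfolding f_def by (auto intro!: continuous_intros)
    show "isCont (\<lambda>w. 1 / w) x" if "0 < ereal x" "ereal x < 1" for x
      using that by (auto intro!: continuous_intros)
    show "0 \<le> 1 / x" if "0 \<le> ereal x" "ereal x \<le> 1" for x using that by simp
    show "((ereal \<circ> ln \<circ> real_of_ereal) \<longlongrightarrow> - \<infinity>) (at_right 0)"
      unfolding zero_ereal_def ereal_tendsto_simps using ln_at_0 by (simp add: o_def)
    show "((ereal \<circ> ln \<circ> real_of_ereal) \<longlongrightarrow> 0) (at_left 1)"
      unfolding one_ereal_def zero_ereal_def ereal_tendsto_simps by (auto intro!: tendsto_eq_intros)
  qed (use i in \<open>auto simp: f_def\<close>)
  then have "integrable lborel (\<lambda>t. indicator {..<0} t *\<^sub>R f t)"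
    by (simp add: set_integrable_def einterval_def lessThan_def)
  then have "integrable lborel (\<lambda>t. (indicator {..<0} t *\<^sub>R f t) / Gamma a)" by simp
  moreover have "(\<lambda>t. (indicator {..<0} t *\<^sub>R f t) / Gamma a) = eker a c" by (auto simp: eker_def f_def indicator_def)
  ultimately show ?thesis by simp
qed

lemma Gamma_Beta: "0 < a \<Longrightarrow> 0 < b \<Longrightarrow> Beta a b / (Gamma a * Gamma b) = 1 / Gamma (a + b)" for a b :: real
  by (simp add: Beta_def Gamma_real_pos less_imp_neq[THEN not_sym] field_simps)

text \<open>The index law \<open>W\<^sup>-\<^sup>a W\<^sup>-\<^sup>b = W\<^sup>-\<^sup>(\<^sup>a\<^sup>+\<^sup>b\<^sup>)\<close>, read on the kernels.\<close>

lemma eker_convolution: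
  assumes a: "0 < a" and b: "0 < b"
  shows "(LINT r|lborel. eker b (c + a) r * eker a c (t - r)) = eker (a + b) c t"
proof (cases "t < 0")
  case False
  \<comment> \<open>For t >= 0 the arguments r and t - r are never both negative, so both sides
    vanish.\<close>
  then have z: "eker b (c + a) r * eker a c (t - r) = 0" for r by (auto simp: eker_def)
  have "eker (a + b) c t = 0" using False by (simp add: eker_def)
  then show ?thesis unfolding z by simp
next
  case True
  define s where "s = exp t"
  have s: "0 < s" "s < 1" "ln s = t" using True by (auto simp: s_def)
  define f where "f r = eker b (c + a) r * eker a c (t - r)" for r
  \<comment> \<open>The substitution e^r = s + (1 - s) y maps (t, 0) to (0, 1). The exponents c + a
    and c are matched so that all powers of w cancel and a Beta integral in y remains.\<close>
  define w where "w y = s + (1 - s) * y" for y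
  define g where "g y = ln (w y)" for y
  have w: "s < w y" "w y < 1" "0 < w y" if "0 < y" "y < 1" for y
  proof -
    show "s < w y" using s that by (simp add: w_def)
    have "(1 - s) * y < (1 - s) * 1" using s that by (intro mult_strict_left_mono) auto
    then show "w y < 1" by (simp add: w_def)
    show "0 < w y" using \<open>s < w y\<close> s by simp
  qed
  define K where "K = exp (c * t) * (1 - s) powr (a + b - 1) / (Gamma a * Gamma b)"
  have fg: "f (g y) * ((1 - s) / w y) = K * (y powr (a - 1) * (1 - y) powr (b - 1))" if y: "0 < y" "y < 1" for y
  proof -
    note wy = w[OF y]
    have 1: "g y < 0" "t - g y < 0" "exp (g y) = w y" "exp (t - g y) = s / w y"
      using wy s by (auto simp: g_def exp_diff s_def[symmetric] simp flip: s(3))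
    have e1: "exp ((c + a) * g y) = w y powr (c + a)" using wy by (simp add: g_def powr_def)
    have e2: "exp (c * (t - g y)) = exp (c * t) * w y powr (- c)" using wy by (simp add: g_def powr_def algebra_simps flip: exp_add)
    have e3: "1 - w y = (1 - s) * (1 - y)" by (simp add: w_def algebra_simps)
    have e4: "1 - s / w y = (1 - s) * y / w y" using wy by (simp add: w_def field_simps)
    have "f (g y) * ((1 - s) / w y) = ((1 - s) * (1 - y)) powr (b - 1) * w y powr (c + a) / Gamma b
        * (((1 - s) * y / w y) powr (a - 1) * (exp (c * t) * w y powr (- c)) / Gamma a) * ((1 - s) / w y)"
      unfolding f_def eker_def using 1 by (simp add: e1 e2 e3 e4)
    also have "\<dots> = exp (c * t) / (Gamma a * Gamma b) * (y powr (a - 1) * (1 - y) powr (b - 1))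
        * ((1 - s) powr (b - 1) * (1 - s) powr (a - 1) * (1 - s)) * (w y powr (c + a) * w y powr (- c) / (w y powr (a - 1) * w y))"
      using s y wy by (simp add: powr_mult powr_divide mult_ac)
    also have "w y powr (c + a) * w y powr (- c) / (w y powr (a - 1) * w y) = 1"
      using wy powr_add[of "w y" "a - 1" 1] by (simp flip: powr_add)
    also have "(1 - s) powr (b - 1) * (1 - s) powr (a - 1) * (1 - s) = (1 - s) powr (a + b - 1)"
    proof -
      have "(1 - s) powr (b - 1) * (1 - s) powr (a - 1) * (1 - s) powr 1 = (1 - s) powr (a + b - 1)"
        unfolding powr_add[symmetric] by (simp add: algebra_simps)
      then show ?thesis using s by simp
    qed
    finally show ?thesis by (simp add: K_def)
  qed
  have e01: "einterval 0 1 = {0<..<1::real}" by (auto simp: einterval_def)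
  have et0: "einterval (ereal t) 0 = {t<..<0}" by (auto simp: einterval_def)
  have bi: "set_integrable lborel {0<..<1} (\<lambda>y. K * (y powr (a - 1) * (1 - y) powr (b - 1)))"
    by (intro set_integrable_mult_right set_integrable_subset[OF integrable_Beta[OF a b]]) auto
  have i: "set_integrable lborel (einterval 0 1) (\<lambda>y. f (g y) * ((1 - s) / w y))"
    unfolding e01 by (subst set_integrable_cong[OF refl refl fg]) (use bi in auto)
  have "(LBINT r=ereal t..0. f r) = (LBINT y=0..1. f (g y) * ((1 - s) / w y))"
  proof (rule interval_integral_substitution_nonneg(2))
    show "DERIV g x :> (1 - s) / w x" if "0 < ereal x" "ereal x < 1" for x
      using w[of x] that unfolding g_def w_def by (auto intro!: derivative_eq_intros)
    show "isCont (\<lambda>y. (1 - s) / w y) x" if "0 < ereal x" "ereal x < 1" for x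
      using w[of x] that unfolding w_def by (auto intro!: continuous_intros)
    show "0 \<le> (1 - s) / w x" if "0 \<le> ereal x" "ereal x \<le> 1" for x
      using that s unfolding w_def by auto
    show "0 \<le> f (g x)" for x using a b by (simp add: f_def eker_nonneg)
    show "isCont f (g x)" if "0 < ereal x" "ereal x < 1" for x
    proof -
      have x: "0 < x" "x < 1" using that by auto
      have gx: "g x < 0" "t < g x" using w[OF x] s by (auto simp: g_def simp flip: s(3))
      define f' where "f' r = (1 - exp r) powr (b - 1) * exp ((c + a) * r) / Gamma b * ((1 - exp (t - r)) powr (a - 1) * exp (c * (t - r)) / Gamma a)" for r
      have "eventually (\<lambda>r. r \<in> {t<..<0}) (nhds (g x))" using gx by (intro eventually_nhds_in_open) auto
      then have "eventually (\<lambda>r. f' r = f r) (nhds (g x))"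
        by eventually_elim (auto simp: f_def f'_def eker_def)
      moreover have "isCont f' (g x)" unfolding f'_def using gx Gamma_real_pos[OF a] Gamma_real_pos[OF b] by (auto intro!: continuous_intros)
      ultimately show ?thesis using isCont_cong by blast
    qed
    show "((ereal \<circ> g \<circ> real_of_ereal) \<longlongrightarrow> ereal t) (at_right 0)"
      unfolding zero_ereal_def ereal_tendsto_simps g_def w_def using s by (auto intro!: tendsto_eq_intros)
    show "((ereal \<circ> g \<circ> real_of_ereal) \<longlongrightarrow> 0) (at_left 1)"
      unfolding zero_ereal_def one_ereal_def ereal_tendsto_simps g_def w_def using s by (auto intro!: tendsto_eq_intros)
  qed (use i in auto)
  also have "(LBINT r=ereal t..0. f r) = (LINT r|lborel. f r)"
  proof -
    have "(LBINT r=ereal t..0. f r) = (LINT r:{t<..<0}|lborel. f r)"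
      using True by (simp add: interval_lebesgue_integral_def et0)
    also have "\<dots> = (LINT r|lborel. f r)"
      unfolding set_lebesgue_integral_def by (rule Bochner_Integration.integral_cong) (auto simp: f_def eker_def indicator_def)
    finally show ?thesis .
  qed
  also have "(LBINT y=0..1. f (g y) * ((1 - s) / w y)) = (LINT y:{0<..<1}|lborel. f (g y) * ((1 - s) / w y))"
    by (simp add: interval_lebesgue_integral_def e01)
  also have "\<dots> = (LINT y:{0<..<1}|lborel. K * (y powr (a - 1) * (1 - y) powr (b - 1)))"
    by (rule set_lebesgue_integral_cong) (use fg in \<open>auto simp del: times_divide_eq_right\<close>)
  also have "\<dots> = K * Beta a b"
  proof -
    have "(LINT y:{0<..<1}|lborel. y powr (a - 1) * (1 - y) powr (b - 1)) = integral {0<..<1} (\<lambda>y. y powr (a - 1) * (1 - y) powr (b - 1))"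
      by (rule set_borel_integral_eq_integral(2)) (rule set_integrable_subset[OF integrable_Beta[OF a b]], auto)
    also have "\<dots> = Beta a b"
      using has_integral_Beta_real[OF a b] by (intro integral_unique) (simp add: has_integral_Icc_iff_Ioo)
    finally show ?thesis by simp
  qed
  also have "\<dots> = eker (a + b) c t"
  proof -
    have "K * Beta a b = exp (c * t) * (1 - s) powr (a + b - 1) * (Beta a b / (Gamma a * Gamma b))"
      by (simp add: K_def)
    then show ?thesis unfolding Gamma_Beta[OF a b] using True by (simp add: eker_def s_def)
  qed
  finally show ?thesis by (simp add: f_def)
qed

section \<open>Erdelyi-Kober operators and resolvents\<close>

definition EK :: "real \<Rightarrow> real \<Rightarrow> real \<Rightarrow> (real \<Rightarrow> complex) \<Rightarrow> real \<Rightarrow> complex" where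
  "EK p a \<nu> = conv p (\<lambda>t. complex_of_real (eker a (\<nu> + 1 / p) t))"

text \<open>Resolvent kernels: the Laplace transform of the forward semigroup for Re z > 0 and, with
  a minus sign, of the backward one for Re z < 0. The value 0 for Re z = 0 is only a filler.\<close>

definition rk :: "complex \<Rightarrow> real \<Rightarrow> complex" where
  "rk z t = (if 0 < Re z \<and> 0 < t then exp (- z * of_real t)
             else if Re z < 0 \<and> t < 0 then - exp (- z * of_real t) else 0)"

lemma rk_measurable [measurable]: "rk z \<in> borel_measurable borel"
  unfolding rk_def by measurable

lemma eker_1: "eker 1 c t = (if t < 0 then exp (c * t) else 0)"
  by (simp add: eker_def)

lemma rk_integrable:
  assumes "Re z \<noteq> 0" shows "integrable lborel (rk z)"
proof (cases "Re z > 0")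
  case True
  have "integrable lborel (\<lambda>t. eker 1 (Re z) (0 + (-1) * t))"
    by (intro lborel_integrable_real_affine eker_integrable) (use True in auto)
  then show ?thesis
    by (rule Bochner_Integration.integrable_bound) (use True in \<open>auto simp: rk_def eker_1\<close>)
next
  case False
  have "integrable lborel (\<lambda>t. eker 1 (- Re z) t)" by (intro eker_integrable) (use False assms in auto)
  then show ?thesis
    by (rule Bochner_Integration.integrable_bound) (use False assms in \<open>auto simp: rk_def eker_1\<close>)
qed

lemma rk_shift:
  assumes "Re z \<noteq> 0" "h > 0"
  shows "AE t in lborel. rk z (t - h) = exp (z * of_real h) * rk z t - exp (z * of_real (h - t)) * indicator {0<..<h} t"
proof -
  have "AE t in lborel. t \<noteq> 0 \<and> t \<noteq> h"
    using AE_lborel_singleton[of 0] AE_lborel_singleton[of h] by eventually_elim auto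
  then show ?thesis
  proof eventually_elim
    case (elim t)
    have e: "exp (z * of_real (h - t)) = exp (z * of_real h) * exp (- (z * of_real t))"
      "exp (- (z * of_real (t - h))) = exp (z * of_real h) * exp (- (z * of_real t))"
      by (simp_all add: algebra_simps flip: exp_add)
    consider "t < 0" | "0 < t" "t < h" | "h < t" using elim by linarith
    then show ?case
      by cases (use assms in \<open>auto simp: rk_def e simp del: of_real_diff\<close>)
  qed
qed

context
  fixes p :: real
  assumes p1: "1 \<le> p"
begin

lemma ek_integrable: "0 < a \<Longrightarrow> 0 \<le> \<nu> \<Longrightarrow> integrable lborel (\<lambda>t. complex_of_real (eker a (\<nu> + 1 / p) t))"
  using p1 by (intro integrable_of_real eker_integrable add_nonneg_pos) auto

lemma EK_Lp: "0 < a \<Longrightarrow> 0 \<le> \<nu> \<Longrightarrow> F \<in> Lp p \<Longrightarrow> EK p a \<nu> F \<in> Lp p"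
  unfolding EK_def by (intro conv_Lp p1 ek_integrable)

lemma dil_EK: "dil p t (EK p a \<nu> F) = EK p a \<nu> (dil p t F)"
  unfolding EK_def by (rule dil_conv)

lemma EK_cong_AE:
  assumes "0 < a" "0 \<le> \<nu>" "F \<in> Lp p" "G \<in> Lp p" "AE x in lborel. F x = G x"
  shows "AE x in lborel. EK p a \<nu> F x = EK p a \<nu> G x"
  unfolding EK_def by (rule conv_cong_AE[OF p1 ek_integrable[OF assms(1,2)] assms(3-5)])

lemma EK_scale: "EK p a \<nu> (\<lambda>x. c * F x) x = c * EK p a \<nu> F x"
  unfolding EK_def by (rule conv_scale)

lemma EK_commute:
  assumes "0 < a" "0 < b" "0 \<le> \<nu>" "0 \<le> \<mu>" "F \<in> Lp p"
  shows "AE x in lborel. EK p a \<nu> (EK p b \<mu> F) x = EK p b \<mu> (EK p a \<nu> F) x"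
  unfolding EK_def by (intro conv_commute p1 ek_integrable assms)

text \<open>With the weights written out, the inner average ends in the factor s^(\<nu>+a) and the
  outer one begins with s^(-\<nu>-a); their cancellation is the reason for the shifted weight. The
  kernel identity gives the opposite order of composition, and \<open>EK_commute\<close> swaps
  it.\<close>

lemma EK_EK:
  assumes a: "0 < a" and b: "0 < b" and \<nu>: "0 \<le> \<nu>" and F: "F \<in> Lp p"
  shows "AE x in lborel. EK p a \<nu> (EK p b (\<nu> + a) F) x = EK p (a + b) \<nu> F x"
proof -
  have "AE x in lborel. EK p b (\<nu> + a) (EK p a \<nu> F) x = EK p (a + b) \<nu> F x"
    unfolding EK_def
  proof (rule conv_conv[OF p1 ek_integrable ek_integrable F])
    have "complex_of_real (eker (a + b) (\<nu> + 1 / p) t)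
        = (LINT r|lborel. complex_of_real (eker b (\<nu> + a + 1 / p) r) * complex_of_real (eker a (\<nu> + 1 / p) (t - r)))" for t
      unfolding eker_convolution[OF a b, symmetric] of_real_mult[symmetric] integral_complex_of_real
      by (simp add: add_ac)
    then show "AE t in lborel. complex_of_real (eker (a + b) (\<nu> + 1 / p) t)
        = (LINT r|lborel. complex_of_real (eker b (\<nu> + a + 1 / p) r) * complex_of_real (eker a (\<nu> + 1 / p) (t - r)))"
      by simp
  qed (use assms in auto)
  with EK_commute[OF a b \<nu> _ F, of "\<nu> + a"] show ?thesis
    using a \<nu> by (auto elim: eventually_elim2)
qed

lemma Lgen_resolvent:
  assumes "Re z \<noteq> 0" "G \<in> Lp p"
  shows "Lgen p (conv p (rk z) G) (\<lambda>x. z * conv p (rk z) G x - G x)"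
  by (rule Lgen_resolventI[OF p1 rk_integrable[OF assms(1)] assms(2) rk_shift[OF assms(1)]])

text \<open>The order-1 kernel has no singular factor: it is a pure exponential on the negative
  half-line, hence minus the resolvent kernel at -(\<nu> + 1/p).\<close>

lemma EK_1: "0 \<le> \<nu> \<Longrightarrow> EK p 1 \<nu> F x = - conv p (rk (- of_real (\<nu> + 1 / p))) F x"
proof -
  assume "0 \<le> \<nu>"
  then have "\<nu> + 1 / p > 0" using p1 by (intro add_nonneg_pos) auto
  then have "(\<lambda>t. complex_of_real (eker 1 (\<nu> + 1 / p) t)) = (\<lambda>t. (-1) * rk (- of_real (\<nu> + 1 / p)) t)"
    by (auto simp: eker_1 rk_def fun_eq_iff exp_of_real[symmetric] simp del: of_real_add)
  then show ?thesis unfolding EK_def using conv_kernel_scale[of p "-1"] by simp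
qed

lemma Lgen_EK_1:
  assumes "0 \<le> \<nu>" "G \<in> Lp p"
  shows "Lgen p (EK p 1 \<nu> G) (\<lambda>x. G x - of_real (\<nu> + 1 / p) * EK p 1 \<nu> G x)"
proof -
  define z where "z = - complex_of_real (\<nu> + 1 / p)"
  have "\<nu> + 1 / p > 0" using p1 assms by (intro add_nonneg_pos) auto
  then have z: "Re z \<noteq> 0" by (simp add: z_def)
  have "EK p 1 \<nu> G = (\<lambda>x. - conv p (rk z) G x)" using EK_1[OF assms(1)] by (simp add: z_def fun_eq_iff)
  moreover have "(\<lambda>x. G x - of_real (\<nu> + 1 / p) * EK p 1 \<nu> G x) = (\<lambda>x. - (z * conv p (rk z) G x - G x))"
    unfolding EK_1[OF assms(1)] z_def[symmetric] by (simp add: z_def del: of_real_add of_real_divide)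
  ultimately show ?thesis using Lgen_add[OF p1 Lgen_resolvent[OF z assms(2)] Lgen_resolvent[OF z assms(2)], of "-1" 0] by simp
qed

text \<open>F minus the resolvent of zF - H satisfies the eigenvalue equation for z, and there are
  no eigenvectors.\<close>

lemma Lgen_inverse:
  assumes z: "Re z \<noteq> 0" and G: "Lgen p F H"
  shows "AE x in lborel. F x = conv p (rk z) (\<lambda>x. z * F x - H x) x"
proof -
  define K where "K x = z * F x - H x" for x
  have K: "K \<in> Lp p" unfolding K_def by (intro Lp_diff Lp_scale p1 LgenD[OF p1 G])
  define R where "R = conv p (rk z) K"
  have "Lgen p (\<lambda>x. 1 * F x + (-1) * R x) (\<lambda>x. 1 * H x + (-1) * (z * R x - K x))"
    unfolding R_def by (rule Lgen_add[OF p1 G Lgen_resolvent[OF z K]])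
  moreover have "1 * H x + (-1) * (z * R x - K x) = z * (1 * F x + (-1) * R x)" for x
    by (simp add: K_def algebra_simps)
  ultimately have "AE x in lborel. 1 * F x + (-1) * R x = 0"
    by (intro Lgen_eigen[OF p1]) auto
  then show ?thesis unfolding R_def K_def by eventually_elim simp
qed

lemma Lgen_imp_EK_1:
  assumes "0 \<le> \<nu>" "Lgen p F H"
  shows "\<exists>G\<in>Lp p. AE x in lborel. F x = EK p 1 \<nu> G x"
proof -
  define z where "z = - complex_of_real (\<nu> + 1 / p)"
  have "\<nu> + 1 / p > 0" using p1 assms by (intro add_nonneg_pos) auto
  then have z: "Re z \<noteq> 0" by (simp add: z_def)
  define G where "G x = (-1) * (z * F x - H x)" for x
  have G: "G \<in> Lp p" unfolding G_def by (intro Lp_diff Lp_scale p1 LgenD[OF p1 assms(2)])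
  have "EK p 1 \<nu> G x = conv p (rk z) (\<lambda>x. z * F x - H x) x" for x
    unfolding EK_1[OF assms(1)] z_def[symmetric] G_def conv_scale by simp
  then have "AE x in lborel. F x = EK p 1 \<nu> G x" using Lgen_inverse[OF z assms(2)] by presburger
  then show ?thesis using G by blast
qed

text \<open>In order 1 the generator recovers F from its average and sends zero to zero. Integer
  orders follow by peeling off one order at a time with the index law; a general order is completed
  to the integer [a] + 1 by a further average of order b.\<close>

lemma EK_injective:
  assumes a: "0 < a" and \<nu>: "0 \<le> \<nu>" and F: "F \<in> Lp p" and z: "AE x in lborel. EK p a \<nu> F x = 0"
  shows "AE x in lborel. F x = 0"
proof -
  have one: "AE x in lborel. F x = 0" if "0 \<le> \<nu>" "F \<in> Lp p" "AE x in lborel. EK p 1 \<nu> F x = 0" for \<nu> F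
    using Lgen_zero[OF p1 Lgen_EK_1[OF that(1,2)] that(3)] that(3) by eventually_elim simp
  have int: "AE x in lborel. F x = 0" if "0 \<le> \<nu>" "F \<in> Lp p" "AE x in lborel. EK p (real (Suc n)) \<nu> F x = 0" for \<nu> F n
    using that
  proof (induction n arbitrary: \<nu>)
    case 0
    then show ?case using one by simp
  next
    case (Suc n)
    have L: "EK p (real (Suc n)) (\<nu> + 1) F \<in> Lp p" using Suc by (intro EK_Lp) auto
    have "AE x in lborel. EK p 1 \<nu> (EK p (real (Suc n)) (\<nu> + 1) F) x = EK p (1 + real (Suc n)) \<nu> F x"
      using Suc by (intro EK_EK) auto
    with Suc.prems(3) have "AE x in lborel. EK p 1 \<nu> (EK p (real (Suc n)) (\<nu> + 1) F) x = 0"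
      by (auto elim: eventually_elim2)
    then have "AE x in lborel. EK p (real (Suc n)) (\<nu> + 1) F x = 0" by (rule one[OF Suc.prems(1) L])
    then show ?case using Suc.prems by (intro Suc.IH[of "\<nu> + 1"]) auto
  qed
  define n where "n = nat \<lfloor>a\<rfloor>"
  define b where "b = real (Suc n) - a"
  have b: "b > 0" unfolding b_def n_def using a by linarith
  have "AE x in lborel. EK p a \<nu> (EK p b (\<nu> + a) F) x = EK p (a + b) \<nu> F x" by (rule EK_EK[OF a b \<nu> F])
  moreover have "AE x in lborel. EK p a \<nu> (EK p b (\<nu> + a) F) x = EK p b (\<nu> + a) (EK p a \<nu> F) x"
    using a \<nu> by (intro EK_commute b F) auto
  moreover have "AE x in lborel. EK p b (\<nu> + a) (EK p a \<nu> F) x = EK p b (\<nu> + a) (\<lambda>x. 0) x"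
    using a \<nu> by (intro EK_cong_AE b EK_Lp F Lp_zero p1 z) auto
  ultimately have "AE x in lborel. EK p (a + b) \<nu> F x = 0"
    by eventually_elim (simp add: EK_def conv_def dil_def)
  then show ?thesis by (intro int[OF \<nu> F, of n]) (simp add: b_def)
qed

text \<open>The difference F = R1 - R2 of the resolvents at iy + \<epsilon> and iy - \<epsilon>
  satisfies iyF - H = -\<epsilon> (R1 + R2). The modulation of G gives R1 and -R2 the same phase, so
  nothing cancels in F: its norm dominates those of R1 and R2, and the quotient is at most 2
  \<epsilon>.\<close>

lemma approximate_eigenvalue:
  fixes y C :: real
  shows "\<exists>F H. Lgen p F H \<and> C * Lnorm p (\<lambda>x. \<i> * of_real y * F x - H x) < Lnorm p F"
proof -
  \<comment> \<open>|x|^(-iy) is a generalised eigenfunction: scaling the argument by e^(-t)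
    multiplies it by e^(iyt), which cancels the oscillation of the resolvent kernels. The cut to (1,
    2) puts G in L^p.\<close>
  define \<theta> where "\<theta> x = exp (- \<i> * of_real (y * ln \<bar>x\<bar>))" for x :: real
  define G where "G x = \<theta> x * indicator {1<..<2} x" for x :: real
  have n\<theta>: "norm (\<theta> x) = 1" for x by (simp add: \<theta>_def)
  have "(indicator ({1<..<2} \<inter> {-2<..<2}) :: real \<Rightarrow> complex) \<in> Lp p" by (rule Lp_indicator_bounded[OF p1]) simp
  moreover have "{1<..<2} \<inter> {-2<..<2} = {1<..<2::real}" by auto
  ultimately have i: "(indicator {1<..<2} :: real \<Rightarrow> complex) \<in> Lp p" by simp
  have Gm [measurable]: "G \<in> borel_measurable borel" unfolding G_def \<theta>_def by measurable
  have G: "G \<in> Lp p"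
    by (rule Lp_bound[OF i, of _ 1]) (use p1 in \<open>auto simp: G_def norm_mult n\<theta>\<close>)
  have "(LINT x|lborel. norm (G x) powr p) = (LINT x|lborel. indicator {1<..<2::real} x)"
    using p1 by (intro Bochner_Integration.integral_cong) (auto simp: G_def norm_mult n\<theta> indicator_def)
  then have "Lnorm p G = 1" by (simp add: Lnorm_def)
  then have Gnz: "\<not> (AE x in lborel. G x = 0)" using Lnorm_eq_0[OF p1 G] by simp
  define g where "g t x = exp (- t / p) * indicator {1<..<2} (exp (- t) * x)" for t x :: real
  have dG: "dil p t G x = exp (\<i> * of_real (y * t)) * (\<theta> x * of_real (g t x))" for t x
  proof (cases "x = 0")
    case False
    then have eq: "ln \<bar>exp (- t) * x\<bar> = ln \<bar>x\<bar> - t" by (simp add: abs_mult ln_mult)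
    have "\<theta> (exp (- t) * x) = exp (\<i> * of_real (y * t)) * \<theta> x"
      unfolding \<theta>_def eq by (simp add: algebra_simps flip: exp_add)
    then show ?thesis by (simp add: dil_def G_def g_def of_real_indicator)
  qed (simp add: dil_def G_def g_def)
  \<comment> \<open>Then 2 \<epsilon> = 1/(|C| + 1), so 2 \<epsilon> |C| < 1 whatever the sign of
    C.\<close>
  define \<epsilon> where "\<epsilon> = 1 / (\<bar>C\<bar> + 1) / 2"
  have \<epsilon>: "\<epsilon> > 0" by (simp add: \<epsilon>_def)
  define z1 z2 where "z1 = \<i> * of_real y + of_real \<epsilon>" and "z2 = \<i> * of_real y - of_real \<epsilon>"
  have rz: "Re z1 \<noteq> 0" "Re z2 \<noteq> 0" using \<epsilon> by (auto simp: z1_def z2_def)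
  define R1 R2 where "R1 = conv p (rk z1) G" and "R2 = conv p (rk z2) G"
  define A where "A x = (LINT t|lborel. (if 0 < t then exp (- \<epsilon> * t) * g t x else 0))" for x
  define B where "B x = (LINT t|lborel. (if t < 0 then exp (\<epsilon> * t) * g t x else 0))" for x
  have g0: "0 \<le> g t x" for t x by (simp add: g_def)
  have A0: "0 \<le> A x" and B0: "0 \<le> B x" for x
    unfolding A_def B_def using g0 by (auto intro!: Bochner_Integration.integral_nonneg)
  have R1: "R1 x = \<theta> x * of_real (A x)" for x
  proof -
    have "R1 x = (LINT t|lborel. \<theta> x * of_real (if 0 < t then exp (- \<epsilon> * t) * g t x else 0))"
      unfolding R1_def conv_def
    proof (rule Bochner_Integration.integral_cong[OF refl])
      fix t
      show "rk z1 t * dil p t G x = \<theta> x * of_real (if 0 < t then exp (- \<epsilon> * t) * g t x else 0)"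
      proof (cases "0 < t")
        case True
        have "rk z1 t = exp (- (\<i> * of_real (y * t))) * of_real (exp (- \<epsilon> * t))"
          using True \<epsilon> by (simp add: rk_def z1_def algebra_simps exp_of_real[symmetric] flip: exp_add)
        then have "rk z1 t * dil p t G x = (exp (- (\<i> * of_real (y * t))) * exp (\<i> * of_real (y * t))) * (\<theta> x * of_real (exp (- \<epsilon> * t) * g t x))"
          by (simp add: dG)
        then show ?thesis using True by (simp flip: exp_add)
      qed (use \<epsilon> in \<open>auto simp: rk_def z1_def\<close>)
    qed
    then show ?thesis by (simp only: integral_mult_right_zero integral_complex_of_real A_def)
  qed
  have R2: "R2 x = - \<theta> x * of_real (B x)" for x
  proof -
    have "R2 x = (LINT t|lborel. - \<theta> x * of_real (if t < 0 then exp (\<epsilon> * t) * g t x else 0))"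
      unfolding R2_def conv_def
    proof (rule Bochner_Integration.integral_cong[OF refl])
      fix t
      show "rk z2 t * dil p t G x = - \<theta> x * of_real (if t < 0 then exp (\<epsilon> * t) * g t x else 0)"
      proof (cases "t < 0")
        case True
        have "rk z2 t = - (exp (- (\<i> * of_real (y * t))) * of_real (exp (\<epsilon> * t)))"
          using True \<epsilon> by (simp add: rk_def z2_def algebra_simps exp_of_real[symmetric] flip: exp_add)
        then have "rk z2 t * dil p t G x = (exp (- (\<i> * of_real (y * t))) * exp (\<i> * of_real (y * t))) * (- \<theta> x * of_real (exp (\<epsilon> * t) * g t x))"
          by (simp add: dG)
        then show ?thesis using True by (simp flip: exp_add)
      qed (use \<epsilon> in \<open>auto simp: rk_def z2_def\<close>)
    qed
    then show ?thesis by (simp only: integral_mult_right_zero integral_complex_of_real B_def)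
  qed
  have L: "R1 \<in> Lp p" "R2 \<in> Lp p" unfolding R1_def R2_def by (intro conv_Lp p1 rk_integrable rz G)+
  define F H where "F x = 1 * R1 x + (-1) * R2 x" and "H x = 1 * (z1 * R1 x - G x) + (-1) * (z2 * R2 x - G x)" for x
  have gen: "Lgen p F H"
    unfolding F_def[abs_def] H_def[abs_def] R1_def R2_def by (intro Lgen_add p1 Lgen_resolvent rz G)
  note FL = LgenD(1)[OF p1 gen]
  have nF: "norm (F x) = A x + B x" for x
  proof -
    have "F x = \<theta> x * of_real (A x + B x)" by (simp add: F_def R1 R2 algebra_simps)
    then have "norm (F x) = \<bar>A x + B x\<bar>" by (metis mult_1 n\<theta> norm_mult norm_of_real)
    then show ?thesis using A0[of x] B0[of x] by simp
  qed
  have n1: "Lnorm p R1 \<le> Lnorm p F" "Lnorm p R2 \<le> Lnorm p F"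
    by (rule Lnorm_mono[OF p1 FL Lp_measurable[OF L(1)]], use A0 B0 in \<open>auto simp: nF R1 norm_mult n\<theta>\<close>)
       (rule Lnorm_mono[OF p1 FL Lp_measurable[OF L(2)]], use A0 B0 in \<open>auto simp: nF R2 norm_mult n\<theta>\<close>)
  have "(\<lambda>x. \<i> * of_real y * F x - H x) = (\<lambda>x. - of_real \<epsilon> * R1 x + - of_real \<epsilon> * R2 x)"
    by (simp add: F_def H_def z1_def z2_def fun_eq_iff algebra_simps)
  then have "Lnorm p (\<lambda>x. \<i> * of_real y * F x - H x) \<le> norm (- complex_of_real \<epsilon>) * Lnorm p R1 + norm (- complex_of_real \<epsilon>) * Lnorm p R2"
    using Lnorm_triangle[OF p1 Lp_scale[OF p1 L(1), of "- of_real \<epsilon>"] Lp_scale[OF p1 L(2), of "- of_real \<epsilon>"]]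
    by (simp only: Lnorm_scale[OF p1])
  also have "\<dots> = \<epsilon> * Lnorm p R1 + \<epsilon> * Lnorm p R2" using \<epsilon> by simp
  also have "\<dots> \<le> \<epsilon> * Lnorm p F + \<epsilon> * Lnorm p F" using n1 \<epsilon> by (intro add_mono mult_left_mono) auto
  finally have le: "Lnorm p (\<lambda>x. \<i> * of_real y * F x - H x) \<le> 2 * \<epsilon> * Lnorm p F" by simp
  have Fpos: "Lnorm p F > 0"
  proof (rule ccontr)
    assume "\<not> Lnorm p F > 0"
    then have "Lnorm p R1 = 0" using n1(1) Lnorm_nonneg[of p F] Lnorm_nonneg[of p R1] by linarith
    then have R10: "AE x in lborel. R1 x = 0" using Lnorm_eq_0[OF p1 L(1)] by simp
    have "AE x in lborel. z1 * R1 x - G x = 0"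
      by (rule Lgen_zero[OF p1 _ R10]) (use Lgen_resolvent[OF rz(1) G] in \<open>simp add: R1_def\<close>)
    with R10 have "AE x in lborel. G x = 0" by eventually_elim simp
    then show False using Gnz by simp
  qed
  have "C * Lnorm p (\<lambda>x. \<i> * of_real y * F x - H x) \<le> \<bar>C\<bar> * (2 * \<epsilon> * Lnorm p F)"
    using le by (meson Lnorm_nonneg abs_ge_self abs_ge_zero mult_mono)
  also have "2 * \<epsilon> = 1 / (\<bar>C\<bar> + 1)" by (simp only: \<epsilon>_def mult_2 field_sum_of_halves)
  also have "\<bar>C\<bar> * (1 / (\<bar>C\<bar> + 1) * Lnorm p F) = \<bar>C\<bar> / (\<bar>C\<bar> + 1) * Lnorm p F" by simp
  also have "\<dots> < 1 * Lnorm p F" using Fpos by (intro mult_strict_right_mono) (auto simp: divide_less_eq)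
  finally show ?thesis using gen by auto
qed

end

section \<open>Derivatives that commute with dilations\<close>

definition monom_deriv :: "nat \<Rightarrow> (real \<Rightarrow> complex) \<Rightarrow> real \<Rightarrow> complex" where
  "monom_deriv j \<phi> x = of_real x ^ j * nderiv j \<phi> x"

lemma monom_deriv_linear:
  assumes "schwartz \<phi>" "schwartz \<psi>"
  shows "monom_deriv j (\<lambda>x. a * \<phi> x + b * \<psi> x) = (\<lambda>x. a * monom_deriv j \<phi> x + b * monom_deriv j \<psi> x)"
  using schwartz_add_scale(2)[OF assms, of j a b] by (auto simp: monom_deriv_def fun_eq_iff algebra_simps)

lemma monom_deriv_dil:
  assumes "schwartz \<phi>" shows "monom_deriv j (dil p t \<phi>) = dil p t (monom_deriv j \<phi>)"
proof -
  have "nderiv j (dil p t \<phi>) = (\<lambda>x. of_real (exp (- t / p)) * of_real (exp (- t)) ^ j * nderiv j \<phi> (exp (- t) * x))"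
    unfolding dil_def by (rule schwartz_scaled(2)[OF assms]) simp
  then show ?thesis by (simp add: monom_deriv_def[abs_def] dil_def power_mult_distrib mult_ac)
qed

lemma monom_deriv_decay:
  assumes "schwartz \<phi>" obtains C where "0 \<le> C" "\<And>x. norm (monom_deriv j \<phi> x) * (1 + x\<^sup>2) \<le> C"
  using schwartz_decay[OF assms, of j j] by (auto simp: monom_deriv_def norm_mult norm_power)

lemma monom_deriv_measurable [measurable]: "schwartz \<phi> \<Longrightarrow> monom_deriv j \<phi> \<in> borel_measurable borel"
  unfolding monom_deriv_def[abs_def] by measurable

context
  fixes p :: real
  assumes p1: "1 \<le> p"
begin

lemma monom_deriv_Lp: "schwartz \<phi> \<Longrightarrow> monom_deriv j \<phi> \<in> Lp p"
  unfolding monom_deriv_def[abs_def] by (rule schwartz_monom_Lp[OF p1])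

text \<open>\<open>x P' - \<nu> P\<close> is, up to sign, the derivative of \<open>e\<^sup>\<nu>\<^sup>t P(e\<^sup>-\<^sup>t x)\<close> along the dilation flow.\<close>

lemma EK_1_euler:
  assumes \<nu>: "0 \<le> \<nu>" and der: "\<And>x. (P has_vector_derivative P' x) (at x)" and P': "continuous_on UNIV P'"
    and P: "\<And>x. norm (P x) * (1 + x\<^sup>2) \<le> D"
    and Q: "\<And>x. norm (of_real x * P' x - of_real \<nu> * P x) * (1 + x\<^sup>2) \<le> C"
    and x: "x \<noteq> 0"
  shows "EK p 1 \<nu> (\<lambda>x. of_real x * P' x - of_real \<nu> * P x) x = - P x"
proof -
  define q where "q x = of_real x * P' x - of_real \<nu> * P x" for x
  define f where "f t = of_real (exp (\<nu> * t)) * q (exp (- t) * x)" for t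
  define F where "F t = - (of_real (exp (\<nu> * t)) * P (exp (- t) * x))" for t
  have contP: "continuous_on UNIV P"
    using der by (meson continuous_at_imp_continuous_on has_vector_derivative_continuous)
  have dF: "(F has_vector_derivative f t) (at t)" for t
  proof -
    have e1: "((\<lambda>t. exp (- t) * x) has_vector_derivative - exp (- t) * x) (at t)"
      unfolding has_real_derivative_iff_has_vector_derivative[symmetric] by (auto intro!: derivative_eq_intros)
    have e2: "((\<lambda>t. P (exp (- t) * x)) has_vector_derivative (- exp (- t) * x) *\<^sub>R P' (exp (- t) * x)) (at t)"
      using vector_diff_chain_at[OF e1 der] by (simp add: o_def)
    have e3: "((\<lambda>t. complex_of_real (exp (\<nu> * t))) has_vector_derivative of_real (\<nu> * exp (\<nu> * t))) (at t)"
      by (rule has_vector_derivative_of_real)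
         (auto intro!: derivative_eq_intros simp flip: has_real_derivative_iff_has_vector_derivative)
    have "((\<lambda>t. of_real (exp (\<nu> * t)) * P (exp (- t) * x)) has_vector_derivative
        of_real (exp (\<nu> * t)) * ((- exp (- t) * x) *\<^sub>R P' (exp (- t) * x)) + of_real (\<nu> * exp (\<nu> * t)) * P (exp (- t) * x)) (at t)"
      by (rule has_vector_derivative_mult[OF e3 e2])
    from has_vector_derivative_minus[OF this] show ?thesis
      unfolding F_def[abs_def] f_def q_def by (simp add: scaleR_conv_of_real algebra_simps)
  qed
  have cf: "isCont f t" for t
  proof -
    have "continuous_on UNIV f" unfolding f_def q_def
      by (intro continuous_intros continuous_on_compose2[OF P'] continuous_on_compose2[OF contP]) auto
    then show ?thesis by (simp add: continuous_on_eq_continuous_at)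
  qed
  \<comment> \<open>As t tends to minus infinity, e^(-t) x runs off to infinity because x is
    nonzero, so quadratic decay of g becomes decay like e^(2t). This serves the integrability of f
    as well as the boundary term of F.\<close>
  have bnd: "norm (of_real (exp (\<nu> * t)) * g (exp (- t) * x)) \<le> B / x\<^sup>2 * exp (2 * t)"
    if g: "\<And>x. norm (g x) * (1 + x\<^sup>2) \<le> B" and t: "t \<le> 0" for g :: "real \<Rightarrow> complex" and B t
  proof -
    define y where "y = exp (- t) * x"
    have y2: "y\<^sup>2 = exp (- 2 * t) * x\<^sup>2" by (simp add: y_def power_mult_distrib flip: exp_double)
    have "norm (g y) * y\<^sup>2 \<le> norm (g y) * (1 + y\<^sup>2)" by (intro mult_left_mono) auto
    also have "\<dots> \<le> B" by (rule g)
    finally have "norm (g y) \<le> B / x\<^sup>2 * exp (2 * t)"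
      unfolding y2 using x by (simp add: field_simps exp_minus)
    moreover have "exp (\<nu> * t) * norm (g y) \<le> 1 * norm (g y)"
      using \<nu> t by (intro mult_right_mono) (auto simp: mult_nonneg_nonpos)
    ultimately show ?thesis by (simp add: norm_mult y_def)
  qed
  have fm [measurable]: "f \<in> borel_measurable borel"
    using cf by (intro borel_measurable_continuous_onI) (simp add: continuous_on_eq_continuous_at)
  have e: "einterval (- \<infinity>) 0 = {..<0::real}" by (auto simp: einterval_def)
  have C: "0 \<le> C" "0 \<le> D" using Q[of 0] P[of 0] by (auto intro: order_trans[rotated])
  have fi: "set_integrable lborel (einterval (- \<infinity>) 0) f"
    unfolding e set_integrable_def
  proof (rule Bochner_Integration.integrable_bound)
    show "integrable lborel (\<lambda>t. C / x\<^sup>2 * eker 1 2 t)" by (intro integrable_mult_right eker_integrable) auto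
    show "AE t in lborel. norm (indicator {..<0} t *\<^sub>R f t) \<le> norm (C / x\<^sup>2 * eker 1 2 t)"
      using bnd[of q C] Q C by (intro AE_I2) (auto simp: f_def q_def eker_1 indicator_def)
  qed simp
  have "(LBINT t=- \<infinity>..0. f t) = - P x - 0"
  proof (rule interval_integral_FTC_integrable[where F=F])
    show "((F \<circ> real_of_ereal) \<longlongrightarrow> - P x) (at_left 0)"
    proof -
      have "isCont F 0" using dF[of 0] by (rule has_vector_derivative_continuous)
      then have "(F \<longlongrightarrow> F 0) (at_left 0)" by (simp add: isCont_def filterlim_at_split)
      then show ?thesis unfolding zero_ereal_def ereal_tendsto_simps by (simp add: F_def)
    qed
    show "((F \<circ> real_of_ereal) \<longlongrightarrow> 0) (at_right (- \<infinity>))"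
      unfolding ereal_tendsto_simps
    proof (rule Lim_null_comparison)
      show "eventually (\<lambda>t. norm (F t) \<le> D / x\<^sup>2 * exp (2 * t)) at_bot"
        using eventually_le_at_bot[of 0]
      proof eventually_elim
        case (elim t)
        then show ?case using bnd[of P D t, OF P] by (simp add: F_def)
      qed
      have "((\<lambda>t::real. exp (2 * t)) \<longlongrightarrow> 0) at_bot"
        by (rule filterlim_compose[OF exp_at_bot]) (rule filterlim_tendsto_pos_mult_at_bot[OF tendsto_const _ filterlim_ident], simp)
      then show "((\<lambda>t. D / x\<^sup>2 * exp (2 * t)) \<longlongrightarrow> 0) at_bot" by (rule tendsto_mult_right_zero)
    qed
  qed (use dF cf fi in auto)
  moreover have "(LBINT t=- \<infinity>..0. f t) = EK p 1 \<nu> q x"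
  proof -
    have "(LBINT t=- \<infinity>..0. f t) = (LINT t|lborel. indicator {..<0} t *\<^sub>R f t)"
      by (simp add: interval_lebesgue_integral_def e set_lebesgue_integral_def)
    also have "\<dots> = EK p 1 \<nu> q x"
      unfolding EK_def conv_def
    proof (rule Bochner_Integration.integral_cong[OF refl])
      fix t
      have "exp ((\<nu> + 1 / p) * t) * exp (- t / p) = exp (\<nu> * t)" using p1 by (simp add: algebra_simps flip: exp_add)
      then have "complex_of_real (exp ((\<nu> + 1 / p) * t)) * (of_real (exp (- t / p)) * q (exp (- t) * x)) = f t"
        unfolding f_def by (metis mult.assoc of_real_mult)
      then show "indicator {..<0} t *\<^sub>R f t = of_real (eker 1 (\<nu> + 1 / p) t) * dil p t q x"
        unfolding eker_1 dil_def indicator_def by simp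
    qed
    finally show ?thesis .
  qed
  ultimately show ?thesis by (simp add: q_def[abs_def])
qed

text \<open>Euler's identity: with P = x^j d^j \<phi>, the function x P' - j P is x^(j+1) d^(j+1)
  \<phi>. The weight of the average has to equal the power of x.\<close>

lemma EK_1_monom_deriv:
  assumes \<phi>: "schwartz \<phi>"
  shows "AE x in lborel. EK p 1 (real j) (monom_deriv (Suc j) \<phi>) x = - monom_deriv j \<phi> x"
proof -
  define P' where "P' x = of_real (real j * x ^ (j - 1)) * nderiv j \<phi> x + of_real x ^ j * nderiv (Suc j) \<phi> x" for x :: real
  have der: "(monom_deriv j \<phi> has_vector_derivative P' x) (at x)" for x
  proof -
    have "((\<lambda>x. complex_of_real (x ^ j)) has_vector_derivative of_real (real j * x ^ (j - 1))) (at x)"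
      by (rule has_vector_derivative_of_real)
         (auto intro!: derivative_eq_intros simp flip: has_real_derivative_iff_has_vector_derivative)
    from has_vector_derivative_mult[OF this schwartz_deriv[OF \<phi>, of j]]
    show ?thesis unfolding monom_deriv_def[abs_def] P'_def by (simp add: add.commute)
  qed
  have q: "(\<lambda>x. of_real x * P' x - of_real (real j) * monom_deriv j \<phi> x) = monom_deriv (Suc j) \<phi>"
  proof
    fix x :: real
    \<comment> \<open>For j = 0 the truncated exponent j - 1 is harmless because of the factor
      j.\<close>
    have "complex_of_real x * of_real (real j * x ^ (j - 1)) = of_real (real j) * of_real x ^ j"
      by (cases j) (simp_all add: mult_ac)
    then show "of_real x * P' x - of_real (real j) * monom_deriv j \<phi> x = monom_deriv (Suc j) \<phi> x"
      unfolding P'_def monom_deriv_def distrib_left mult.assoc[symmetric] by (auto simp: mult_ac)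
  qed
  obtain C where C: "\<And>x. norm (monom_deriv (Suc j) \<phi> x) * (1 + x\<^sup>2) \<le> C" using monom_deriv_decay[OF \<phi>] by metis
  obtain D where D: "\<And>x. norm (monom_deriv j \<phi> x) * (1 + x\<^sup>2) \<le> D" using monom_deriv_decay[OF \<phi>] by metis
  have C': "norm (of_real x * P' x - of_real (real j) * monom_deriv j \<phi> x) * (1 + x\<^sup>2) \<le> C" for x
    unfolding fun_cong[OF q] by (rule C)
  have cP': "continuous_on UNIV P'" unfolding P'_def
    by (intro continuous_intros schwartz_nderiv_continuous[OF \<phi>])
  have "AE x in lborel. x \<noteq> (0::real)" by (rule AE_lborel_singleton)
  then show ?thesis
  proof eventually_elim
    case (elim x)
    show ?case
      using EK_1_euler[of "real j" "monom_deriv j \<phi>" P' D C x, OF _ der cP' D C' elim]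
      unfolding q by simp
  qed
qed

text \<open>Taylor's formula with base point at infinity: n + 1 integrations recover the j-th
  derivative from that of order j + n + 1, each with a minus sign, and the index law merges them
  into one average.\<close>

lemma EK_monom_deriv:
  assumes \<phi>: "schwartz \<phi>"
  shows "AE x in lborel. EK p (real (Suc n)) (real j) (monom_deriv (j + Suc n) \<phi>) x = (-1) ^ Suc n * monom_deriv j \<phi> x"
proof (induction n arbitrary: j)
  case 0
  then show ?case using EK_1_monom_deriv[OF \<phi>, of j] by simp
next
  case (Suc n)
  have "AE x in lborel. EK p 1 (real j) (EK p (real (Suc n)) (real j + 1) (monom_deriv (j + Suc (Suc n)) \<phi>)) x
     = EK p (1 + real (Suc n)) (real j) (monom_deriv (j + Suc (Suc n)) \<phi>) x"
    by (intro EK_EK p1 monom_deriv_Lp \<phi>) auto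
  moreover have "AE x in lborel. EK p 1 (real j) (EK p (real (Suc n)) (real j + 1) (monom_deriv (j + Suc (Suc n)) \<phi>)) x
     = EK p 1 (real j) (\<lambda>x. (-1) ^ Suc n * monom_deriv (Suc j) \<phi> x) x"
  proof (intro EK_cong_AE p1 EK_Lp Lp_scale monom_deriv_Lp \<phi>)
    show "AE x in lborel. EK p (real (Suc n)) (real j + 1) (monom_deriv (j + Suc (Suc n)) \<phi>) x = (- 1) ^ Suc n * monom_deriv (Suc j) \<phi> x"
      using Suc.IH[of "Suc j"] by (simp add: add.commute)
  qed auto
  ultimately show ?case using EK_1_monom_deriv[OF \<phi>, of j]
    by eventually_elim (simp add: EK_scale[OF p1] del: power_Suc, simp)
qed

text \<open>The preimage is -(x \<phi>' - \<nu> \<phi>), by Euler's identity with a real weight. It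
  need only lie in L^p, since the density proof approximates it afterwards.\<close>

lemma schwartz_in_range_EK_1:
  assumes \<phi>: "schwartz \<phi>" and \<nu>: "0 \<le> \<nu>"
  shows "\<exists>\<psi>\<in>Lp p. AE x in lborel. EK p 1 \<nu> \<psi> x = \<phi> x"
proof -
  define q where "q x = of_real x * nderiv 1 \<phi> x - of_real \<nu> * \<phi> x" for x
  obtain C1 where C1: "\<And>x. \<bar>x\<bar> ^ 1 * norm (nderiv 1 \<phi> x) * (1 + x\<^sup>2) \<le> C1" using schwartz_decay[OF \<phi>] by metis
  obtain D where D: "\<And>x. norm (\<phi> x) * (1 + x\<^sup>2) \<le> D" using schwartz_decay[OF \<phi>, of 0 0] by auto
  have Q: "norm (q x) * (1 + x\<^sup>2) \<le> C1 + \<nu> * D" for x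
  proof -
    have "norm (q x) * (1 + x\<^sup>2) \<le> (\<bar>x\<bar> * norm (nderiv 1 \<phi> x) + \<nu> * norm (\<phi> x)) * (1 + x\<^sup>2)"
      unfolding q_def by (intro mult_right_mono order_trans[OF norm_triangle_ineq4]) (use \<nu> in \<open>auto simp: norm_mult\<close>)
    also have "\<dots> = \<bar>x\<bar> ^ 1 * norm (nderiv 1 \<phi> x) * (1 + x\<^sup>2) + \<nu> * (norm (\<phi> x) * (1 + x\<^sup>2))" by (simp add: algebra_simps)
    also have "\<dots> \<le> C1 + \<nu> * D" using C1[of x] D[of x] \<nu> by (intro add_mono mult_left_mono) auto
    finally show ?thesis .
  qed
  have qL: "q \<in> Lp p"
  proof (rule Lp_bounded_decay[OF p1 _ Q])
    show "q \<in> borel_measurable borel" unfolding q_def using schwartz_nderiv_measurable[OF \<phi>, of 1] schwartz_measurable[OF \<phi>] by measurable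
  qed
  have "AE x in lborel. x \<noteq> (0::real)" by (rule AE_lborel_singleton)
  then have "AE x in lborel. EK p 1 \<nu> (\<lambda>x. (-1) * q x) x = \<phi> x"
  proof eventually_elim
    case (elim x)
    have "EK p 1 \<nu> q x = - \<phi> x"
      unfolding q_def
      by (rule EK_1_euler[OF \<nu> _ _ D])
         (use schwartz_deriv[OF \<phi>, of 0] schwartz_nderiv_continuous[OF \<phi>, of UNIV 1] Q elim in \<open>auto simp: q_def\<close>)
    then show ?case by (simp only: EK_scale[OF p1]) simp
  qed
  then show ?thesis using Lp_scale[OF p1 qL] by blast
qed

lemma Lsub_image:
  assumes "\<And>\<phi> \<psi> a b. schwartz \<phi> \<Longrightarrow> schwartz \<psi> \<Longrightarrow> T (\<lambda>x. a * \<phi> x + b * \<psi> x) = (\<lambda>x. a * T \<phi> x + b * T \<psi> x)"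
    and "\<And>\<phi>. schwartz \<phi> \<Longrightarrow> T \<phi> \<in> Lp p"
  shows "Lsub p (T ` Collect schwartz)"
  unfolding Lsub_def
proof (intro conjI ballI allI)
  obtain \<phi> where \<phi>: "schwartz \<phi>" using Lsub_schwartz[OF p1] by (auto simp: Lsub_def)
  show "T ` Collect schwartz \<subseteq> Lp p" using assms by auto
  show "(\<lambda>x. 0) \<in> T ` Collect schwartz"
    using assms(1)[OF \<phi> \<phi>, of 0 0] schwartz_add_scale(1)[OF \<phi> \<phi>, of 0 0]
    by (intro image_eqI[where x="\<lambda>x. 0 * \<phi> x + 0 * \<phi> x"]) auto
next
  fix f g assume "f \<in> T ` Collect schwartz" "g \<in> T ` Collect schwartz"
  then obtain \<phi> \<psi> where *: "schwartz \<phi>" "schwartz \<psi>" "f = T \<phi>" "g = T \<psi>" by auto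
  show "(\<lambda>x. f x + g x) \<in> T ` Collect schwartz"
    using assms(1)[OF *(1,2), of 1 1] schwartz_add_scale(1)[OF *(1,2), of 1 1] *
    by (intro image_eqI[where x="\<lambda>x. 1 * \<phi> x + 1 * \<psi> x"]) auto
next
  fix c f assume "f \<in> T ` Collect schwartz"
  then obtain \<phi> where *: "schwartz \<phi>" "f = T \<phi>" by auto
  show "(\<lambda>x. c * f x) \<in> T ` Collect schwartz"
    using assms(1)[OF *(1,1), of c 0] schwartz_add_scale(1)[OF *(1,1), of c 0] *
    by (intro image_eqI[where x="\<lambda>x. c * \<phi> x + 0 * \<phi> x"]) auto
qed

lemma Lcl_idem:
  assumes V: "V \<subseteq> Lp p" and W: "W \<subseteq> Lcl p V"
  shows "Lcl p W \<subseteq> Lcl p V"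
proof
  fix f assume f: "f \<in> Lcl p W"
  show "f \<in> Lcl p V"
  proof (rule Lcl_approx[OF p1 V])
    show "f \<in> Lp p" using f by (simp add: Lcl_def)
    fix e :: real assume "e > 0"
    then obtain g where "g \<in> W" "Lnorm p (\<lambda>x. f x - g x) < e" using f by (auto simp: Lcl_def)
    then show "\<exists>g\<in>Lcl p V. Lnorm p (\<lambda>x. f x - g x) < e" using W by blast
  qed
qed

text \<open>The closure of the functions of order j + 1 is closed and dilation-invariant, so it
  contains their averages; the order-1 average returns the functions of order j, which are dense by
  induction.\<close>

lemma monom_deriv_dense: "Lcl p (monom_deriv j ` Collect schwartz) = Lp p"
proof (induction j)
  case 0
  have "monom_deriv 0 = (\<lambda>\<phi>. \<phi>)" by (simp add: monom_deriv_def[abs_def] fun_eq_iff)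
  then show ?case using schwartz_dense[OF p1] by simp
next
  case (Suc j)
  define V where "V = monom_deriv (Suc j) ` Collect schwartz"
  have V: "Lsub p V" unfolding V_def by (rule Lsub_image) (auto intro: monom_deriv_linear monom_deriv_Lp)
  have VL: "V \<subseteq> Lp p" using V by (simp add: Lsub_def)
  have "monom_deriv j ` Collect schwartz \<subseteq> Lcl p V"
  proof safe
    fix \<phi> assume \<phi>: "schwartz \<phi>"
    have dilV: "dil p t f \<in> Lcl p V" if "f \<in> V" for f t
    proof -
      have "dil p t f \<in> V" using that schwartz_dil by (auto simp: V_def simp flip: monom_deriv_dil)
      then show ?thesis using subset_Lcl[OF p1 VL] by blast
    qed
    have "monom_deriv (Suc j) \<phi> \<in> Lcl p V" using subset_Lcl[OF p1 VL] \<phi> by (auto simp: V_def)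
    then have "EK p 1 (real j) (monom_deriv (Suc j) \<phi>) \<in> Lcl p V"
      unfolding EK_def by (intro conv_Lcl[OF p1 V] dilV ek_integrable[OF p1]) auto
    then have "(\<lambda>x. (-1) * EK p 1 (real j) (monom_deriv (Suc j) \<phi>) x) \<in> Lcl p V"
      by (rule Lsub_scaleD[OF Lsub_Lcl[OF p1 V]])
    then show "monom_deriv j \<phi> \<in> Lcl p V"
    proof (rule Lcl_cong_AE[OF p1])
      show "AE x in lborel. (-1) * EK p 1 (real j) (monom_deriv (Suc j) \<phi>) x = monom_deriv j \<phi> x"
        using EK_1_monom_deriv[OF \<phi>, of j] by eventually_elim simp
    qed (use VL \<phi> in auto)
  qed
  from Lcl_idem[OF VL this] show ?case using Suc Lcl_subset[OF p1, of V] by (auto simp: V_def)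
qed

end

section \<open>Weyl fractional derivatives of Schwartz functions\<close>

text \<open>Both one-sided Weyl integrals without the Gamma factor: \<sigma> = 1 for the right,
  \<sigma> = -1 for the left. The variable u = |s - x| frees the singular weight of x, so that
  differentiation falls on f alone.\<close>

definition weyl_side :: "real \<Rightarrow> real \<Rightarrow> (real \<Rightarrow> complex) \<Rightarrow> real \<Rightarrow> complex" where
  "weyl_side \<sigma> b f x = (LINT u|lborel. of_real (indicator {0<..} u * u powr (b - 1)) * f (x + \<sigma> * u))"

text \<open>One majorant for all Weyl integrands: the singularity u^(b-1) near 0 and quadratic decay
  at infinity. The factor 2 reflects 1 + u^2 <= 2 u^2 for u >= 1.\<close>

lemma power_weight_integrable:
  assumes b: "0 < b"
  shows "integrable lborel (\<lambda>u. indicator {0<..<1} u * u powr (b - 1) + 2 * inverse (1 + u\<^sup>2) :: real)"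
proof -
  have "set_integrable lborel {0<..<1} (\<lambda>t. t powr (b - 1) * (1 - t) powr (1 - 1))"
    by (rule set_integrable_subset[OF integrable_Beta[OF b zero_less_one]]) auto
  then have "integrable lborel (\<lambda>u. indicator {0<..<1} u *\<^sub>R (u powr (b - 1) * (1 - u) powr (1 - 1)))"
    by (simp add: set_integrable_def)
  also have "(\<lambda>u::real. indicator {0<..<1} u *\<^sub>R (u powr (b - 1) * (1 - u) powr (1 - 1))) = (\<lambda>u. indicator {0<..<1} u * u powr (b - 1))"
    by (auto simp: fun_eq_iff indicator_def)
  finally show ?thesis using integrable_inverse_1_plus_square by simp
qed

lemma power_weight_bound:
  fixes u b :: real
  assumes u: "0 < u" and k: "b + 1 \<le> real k"
  shows "u powr (b - 1) / (1 + u) ^ k \<le> indicator {0<..<1} u * u powr (b - 1) + 2 * inverse (1 + u\<^sup>2)"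
proof (cases "u < 1")
  case True
  have "u powr (b - 1) / (1 + u) ^ k \<le> u powr (b - 1) / 1"
    using u by (intro divide_left_mono) auto
  also have "\<dots> \<le> u powr (b - 1) + 2 * inverse (1 + u\<^sup>2)" by (simp add: add_nonneg_nonneg)
  finally show ?thesis using True u by simp
next
  case False
  have "u powr (b - 1) / (1 + u) ^ k \<le> u powr (b - 1) / u powr (b + 1)"
  proof (rule divide_left_mono)
    have "u powr (b + 1) \<le> u powr real k" using False k by (intro powr_mono) auto
    also have "\<dots> = u ^ k" using u by (simp add: powr_realpow)
    also have "\<dots> \<le> (1 + u) ^ k" using u by (intro power_mono) auto
    finally show "u powr (b + 1) \<le> (1 + u) ^ k" .
  qed (use u in auto)
  also have "\<dots> = u powr (- 2)" by (simp flip: powr_diff)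
  also have "\<dots> = 1 / u\<^sup>2" using u by (simp add: powr_minus powr_numeral divide_inverse)
  also have "\<dots> \<le> 2 * inverse (1 + u\<^sup>2)"
  proof -
    have "1 + u\<^sup>2 \<le> 2 * u\<^sup>2" using False by simp
    then show ?thesis using u by (simp add: field_simps add_pos_nonneg)
  qed
  finally show ?thesis using False by simp
qed

lemma schwartz_power_decay:
  assumes "schwartz f" obtains C where "0 \<le> C" "\<And>x. norm (nderiv n f x) * (1 + \<bar>x\<bar>) ^ k \<le> C"
proof -
  obtain A where A: "\<And>x. \<bar>x\<bar> ^ 0 * norm (nderiv n f x) \<le> A" using schwartz_bound[OF assms] by metis
  obtain B where B: "\<And>x. \<bar>x\<bar> ^ k * norm (nderiv n f x) \<le> B" using schwartz_bound[OF assms] by metis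
  have *: "norm (nderiv n f x) * (1 + \<bar>x\<bar>) ^ k \<le> 2 ^ k * (A + B)" for x
  proof -
    have "(1 + \<bar>x\<bar>) ^ k \<le> 2 ^ k * (1 + \<bar>x\<bar> ^ k)"
    proof (cases "\<bar>x\<bar> \<le> 1")
      case True
      then have "(1 + \<bar>x\<bar>) ^ k \<le> 2 ^ k" by (intro power_mono) auto
      also have "\<dots> \<le> 2 ^ k * (1 + \<bar>x\<bar> ^ k)" by simp
      finally show ?thesis .
    next
      case False
      then have "(1 + \<bar>x\<bar>) ^ k \<le> (2 * \<bar>x\<bar>) ^ k" by (intro power_mono) auto
      also have "\<dots> \<le> 2 ^ k * (1 + \<bar>x\<bar> ^ k)" by (simp add: power_mult_distrib)
      finally show ?thesis .
    qed
    then have "norm (nderiv n f x) * (1 + \<bar>x\<bar>) ^ k \<le> norm (nderiv n f x) * (2 ^ k * (1 + \<bar>x\<bar> ^ k))"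
      by (intro mult_left_mono) auto
    also have "\<dots> = 2 ^ k * (\<bar>x\<bar> ^ 0 * norm (nderiv n f x) + \<bar>x\<bar> ^ k * norm (nderiv n f x))" by (simp add: algebra_simps)
    also have "\<dots> \<le> 2 ^ k * (A + B)" by (intro mult_left_mono add_mono A B) auto
    finally show ?thesis .
  qed
  have "0 \<le> 2 ^ k * (A + B)" using *[of 0] by (rule order_trans[rotated]) simp
  with * show ?thesis using that by blast
qed

text \<open>The extra shift by h with |h| <= 1 lets one majorant dominate the difference quotients
  too. The constant rests on 1 + u <= (1 + |y|)(2 + |x|) for y = x + \<sigma> u + h.\<close>

lemma weyl_side_integrand_bound:
  fixes \<sigma> :: real
  assumes f: "schwartz f" and \<sigma>: "\<bar>\<sigma>\<bar> = 1"
  obtains C where "0 \<le> C" "\<And>u h. 0 < u \<Longrightarrow> \<bar>h\<bar> \<le> 1 \<Longrightarrow>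
     u powr (b - 1) * norm (nderiv n f (x + \<sigma> * u + h)) \<le> C * (indicator {0<..<1} u * u powr (b - 1) + 2 * inverse (1 + u\<^sup>2))"
proof -
  define k where "k = nat \<lceil>b + 1\<rceil>"
  have k: "b + 1 \<le> real k" unfolding k_def by linarith
  obtain C where C: "0 \<le> C" "\<And>x. norm (nderiv n f x) * (1 + \<bar>x\<bar>) ^ k \<le> C" using schwartz_power_decay[OF f] by metis
  show ?thesis
  proof (rule that[of "C * (2 + \<bar>x\<bar>) ^ k"])
    show "0 \<le> C * (2 + \<bar>x\<bar>) ^ k" using C(1) by simp
    fix u h :: real assume u: "0 < u" and h: "\<bar>h\<bar> \<le> 1"
    define y where "y = x + \<sigma> * u + h"
    have "u = \<bar>\<sigma> * u\<bar>" using u \<sigma> by (simp add: abs_mult)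
    also have "\<dots> \<le> \<bar>y\<bar> + \<bar>x\<bar> + 1" unfolding y_def using h by linarith
    finally have "1 + u \<le> (1 + \<bar>y\<bar>) * (2 + \<bar>x\<bar>)"
      using mult_nonneg_nonneg[of "\<bar>y\<bar>" "\<bar>x\<bar>"] abs_ge_zero[of y] unfolding distrib_right distrib_left by linarith
    then have "(1 + u) ^ k \<le> ((1 + \<bar>y\<bar>) * (2 + \<bar>x\<bar>)) ^ k" using u by (intro power_mono) auto
    then have "norm (nderiv n f y) * (1 + u) ^ k \<le> norm (nderiv n f y) * ((1 + \<bar>y\<bar>) ^ k * (2 + \<bar>x\<bar>) ^ k)"
      unfolding power_mult_distrib by (intro mult_left_mono) auto
    also have "\<dots> \<le> C * (2 + \<bar>x\<bar>) ^ k" unfolding mult.assoc[symmetric] using C(2)[of y] by (intro mult_right_mono) auto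
    finally have "norm (nderiv n f y) \<le> C * (2 + \<bar>x\<bar>) ^ k / (1 + u) ^ k" using u by (simp add: pos_le_divide_eq)
    then have "u powr (b - 1) * norm (nderiv n f y) \<le> u powr (b - 1) * (C * (2 + \<bar>x\<bar>) ^ k / (1 + u) ^ k)"
      by (intro mult_left_mono) auto
    also have "\<dots> = C * (2 + \<bar>x\<bar>) ^ k * (u powr (b - 1) / (1 + u) ^ k)" by simp
    also have "\<dots> \<le> C * (2 + \<bar>x\<bar>) ^ k * (indicator {0<..<1} u * u powr (b - 1) + 2 * inverse (1 + u\<^sup>2))"
      using C(1) by (intro mult_left_mono power_weight_bound u k) auto
    finally show "u powr (b - 1) * norm (nderiv n f (x + \<sigma> * u + h)) \<le> C * (2 + \<bar>x\<bar>) ^ k * (indicator {0<..<1} u * u powr (b - 1) + 2 * inverse (1 + u\<^sup>2))"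
      by (simp add: y_def)
  qed
qed

lemma weyl_side_integrable:
  assumes f: "schwartz f" and b: "0 < b" and \<sigma>: "\<bar>\<sigma>\<bar> = 1"
  shows "integrable lborel (\<lambda>u. of_real (indicator {0<..} u * u powr (b - 1)) * f (x + \<sigma> * u))"
proof -
  obtain C where C: "0 \<le> C" "\<And>u h. 0 < u \<Longrightarrow> \<bar>h\<bar> \<le> 1 \<Longrightarrow>
     u powr (b - 1) * norm (nderiv 0 f (x + \<sigma> * u + h)) \<le> C * (indicator {0<..<1} u * u powr (b - 1) + 2 * inverse (1 + u\<^sup>2))"
    using weyl_side_integrand_bound[OF f \<sigma>] by metis
  have [measurable]: "f \<in> borel_measurable borel" by (rule schwartz_measurable[OF f])
  show ?thesis
  proof (rule Bochner_Integration.integrable_bound[OF integrable_mult_right[OF power_weight_integrable[OF b], of C]])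
    have w: "0 \<le> C * (indicator {0<..<1} u * u powr (b - 1) + 2 * inverse (1 + u\<^sup>2))" for u :: real
      using C(1) by (intro mult_nonneg_nonneg add_nonneg_nonneg) auto
    show "AE u in lborel. norm (of_real (indicator {0<..} u * u powr (b - 1)) * f (x + \<sigma> * u))
      \<le> norm (C * (indicator {0<..<1} u * u powr (b - 1) + 2 * inverse (1 + u\<^sup>2)))"
    proof (rule AE_I2)
      fix u :: real
      show "norm (of_real (indicator {0<..} u * u powr (b - 1)) * f (x + \<sigma> * u))
        \<le> norm (C * (indicator {0<..<1} u * u powr (b - 1) + 2 * inverse (1 + u\<^sup>2)))"
      proof (cases "0 < u")
        case True
        then show ?thesis using C(1) C(2)[of u 0] w[of u] unfolding norm_mult norm_of_real by (simp add: abs_of_nonneg[OF w])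
      qed simp
    qed
  qed measurable
qed

lemma schwartz_diff_bound:
  assumes f: "schwartz f" and B: "\<And>\<xi>. \<bar>\<xi> - y\<bar> \<le> \<bar>h\<bar> \<Longrightarrow> norm (nderiv 1 f \<xi>) \<le> B"
  shows "norm (f (y + h) - f y) \<le> B * \<bar>h\<bar>"
proof -
  have "norm (f (y + h) - f y) \<le> B * norm (y + h - y)"
  proof (rule differentiable_bound[where S="cball y \<bar>h\<bar>" and f'="\<lambda>\<xi> t. t *\<^sub>R nderiv 1 f \<xi>"])
    show "(f has_derivative (\<lambda>t. t *\<^sub>R nderiv 1 f \<xi>)) (at \<xi> within cball y \<bar>h\<bar>)" for \<xi>
      using schwartz_deriv[OF f, of 0 \<xi>] by (auto simp: has_vector_derivative_def intro: has_derivative_at_withinI)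
    show "onorm (\<lambda>t. t *\<^sub>R nderiv 1 f \<xi>) \<le> B" if "\<xi> \<in> cball y \<bar>h\<bar>" for \<xi>
      using B[of \<xi>] that by (intro onorm_le[THEN order_trans, rotated] onorm_bound)
        (auto simp: dist_real_def abs_minus_commute intro!: order_trans[OF norm_ge_zero] mult_right_mono simp: mult.commute)
  qed (auto simp: dist_real_def)
  then show ?thesis by simp
qed

lemma has_vector_derivative_iff_quotient:
  fixes f :: "real \<Rightarrow> complex"
  shows "(f has_vector_derivative D) (at x) \<longleftrightarrow> ((\<lambda>h. (f (x + h) - f x) / of_real h) \<longlongrightarrow> D) (at 0)"
proof -
  have "(f has_vector_derivative D) (at x) \<longleftrightarrow> ((\<lambda>h. norm (f (x + h) - f x - h *\<^sub>R D) / norm h) \<longlongrightarrow> 0) (at 0)"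
    by (simp add: has_vector_derivative_def has_derivative_at bounded_linear_scaleR_left)
  also have "\<dots> \<longleftrightarrow> ((\<lambda>h. norm ((f (x + h) - f x) / of_real h - D)) \<longlongrightarrow> 0) (at 0)"
  proof (rule filterlim_cong[OF refl refl])
    have "norm (f (x + h) - f x - h *\<^sub>R D) / norm h = norm ((f (x + h) - f x) / of_real h - D)" if "h \<noteq> 0" for h
    proof -
      have "(f (x + h) - f x) / of_real h - D = (f (x + h) - f x - h *\<^sub>R D) / of_real h"
        using that by (simp add: scaleR_conv_of_real diff_divide_distrib)
      then show ?thesis by (simp add: norm_divide)
    qed
    then show "eventually (\<lambda>h. norm (f (x + h) - f x - h *\<^sub>R D) / norm h = norm ((f (x + h) - f x) / of_real h - D)) (at 0)"
      by (simp add: eventually_at_filter)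
  qed
  also have "\<dots> \<longleftrightarrow> ((\<lambda>h. (f (x + h) - f x) / of_real h) \<longlongrightarrow> D) (at 0)"
    by (simp add: tendsto_norm_zero_iff LIM_zero_iff)
  finally show ?thesis .
qed

text \<open>Differentiation under the integral: the mean value inequality bounds a quotient with |h|
  < 1 by values of the derivative within distance |h|, hence by the shifted majorant.\<close>

lemma weyl_side_deriv:
  assumes f: "schwartz f" and b: "0 < b" and \<sigma>: "\<bar>\<sigma>\<bar> = 1"
  shows "(weyl_side \<sigma> b f has_vector_derivative weyl_side \<sigma> b (nderiv 1 f) x) (at x)"
proof -
  define c where "c u = complex_of_real (indicator {0<..} u * u powr (b - 1))" for u :: real
  have [measurable]: "f \<in> borel_measurable borel" "nderiv 1 f \<in> borel_measurable borel"
    using schwartz_measurable[OF f] schwartz_nderiv_measurable[OF f, of 1] by auto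
  have [measurable]: "c \<in> borel_measurable borel" unfolding c_def by measurable
  have int: "integrable lborel (\<lambda>u. c u * f (y + \<sigma> * u))" for y unfolding c_def by (rule weyl_side_integrable[OF f b \<sigma>])
  obtain C where C: "0 \<le> C" "\<And>u h. 0 < u \<Longrightarrow> \<bar>h\<bar> \<le> 1 \<Longrightarrow>
     u powr (b - 1) * norm (nderiv 1 f (x + \<sigma> * u + h)) \<le> C * (indicator {0<..<1} u * u powr (b - 1) + 2 * inverse (1 + u\<^sup>2))"
    using weyl_side_integrand_bound[OF f \<sigma>] by metis
  define w where "w u = C * (indicator {0<..<1} u * u powr (b - 1) + 2 * inverse (1 + u\<^sup>2))" for u :: real
  have w0: "0 \<le> w u" for u unfolding w_def using C(1) by (intro mult_nonneg_nonneg add_nonneg_nonneg) auto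
  have wi: "integrable lborel w" unfolding w_def by (intro integrable_mult_right power_weight_integrable b)
  have "((\<lambda>h. (weyl_side \<sigma> b f (x + h) - weyl_side \<sigma> b f x) / of_real h) \<longlongrightarrow> weyl_side \<sigma> b (nderiv 1 f) x) (at 0)"
    unfolding tendsto_at_iff_sequentially o_def
  proof (intro allI impI)
    fix X :: "nat \<Rightarrow> real" assume X0: "\<forall>i. X i \<in> UNIV - {0}" and X: "X \<longlonglongrightarrow> 0"
    have "eventually (\<lambda>n. norm (X n) < 1) sequentially" using tendsto_norm[OF X] by (intro order_tendstoD) auto
    then obtain M where M: "\<And>n. n \<ge> M \<Longrightarrow> \<bar>X n\<bar> < 1" by (auto simp: eventually_sequentially)
    have eq: "(weyl_side \<sigma> b f (x + h) - weyl_side \<sigma> b f x) / of_real h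
        = (LINT u|lborel. c u * ((f (x + \<sigma> * u + h) - f (x + \<sigma> * u)) / of_real h))" for h
    proof -
      have "(LINT u|lborel. c u * ((f (x + \<sigma> * u + h) - f (x + \<sigma> * u)) / of_real h))
          = (LINT u|lborel. (c u * f (x + h + \<sigma> * u) - c u * f (x + \<sigma> * u)) / of_real h)"
        by (intro Bochner_Integration.integral_cong) (auto simp: algebra_simps)
      also have "\<dots> = ((LINT u|lborel. c u * f (x + h + \<sigma> * u)) - (LINT u|lborel. c u * f (x + \<sigma> * u))) / of_real h"
        using int by simp
      finally show ?thesis unfolding weyl_side_def c_def by (rule sym)
    qed
    show "(\<lambda>n. (weyl_side \<sigma> b f (x + X n) - weyl_side \<sigma> b f x) / of_real (X n)) \<longlonglongrightarrow> weyl_side \<sigma> b (nderiv 1 f) x"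
      unfolding eq weyl_side_def[of \<sigma> b "nderiv 1 f"] c_def[symmetric]
    proof (rule LIMSEQ_offset[of _ M], rule integral_dominated_convergence[where w=w])
      show "AE u in lborel. (\<lambda>n. c u * ((f (x + \<sigma> * u + X (n + M)) - f (x + \<sigma> * u)) / of_real (X (n + M)))) \<longlonglongrightarrow> c u * nderiv 1 f (x + \<sigma> * u)"
      proof (rule AE_I2)
        fix u :: real
        have "(f has_vector_derivative nderiv 1 f (x + \<sigma> * u)) (at (x + \<sigma> * u))" using schwartz_deriv[OF f, of 0] by simp
        then have "((\<lambda>h. (f (x + \<sigma> * u + h) - f (x + \<sigma> * u)) / of_real h) \<longlongrightarrow> nderiv 1 f (x + \<sigma> * u)) (at 0)"
          by (simp only: has_vector_derivative_iff_quotient)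
        moreover have "filterlim (\<lambda>n. X (n + M)) (at 0) sequentially"
          using LIMSEQ_ignore_initial_segment[OF X, of M] X0 by (auto simp: filterlim_at)
        ultimately have "(\<lambda>n. (f (x + \<sigma> * u + X (n + M)) - f (x + \<sigma> * u)) / of_real (X (n + M))) \<longlonglongrightarrow> nderiv 1 f (x + \<sigma> * u)"
          by (rule filterlim_compose)
        then show "(\<lambda>n. c u * ((f (x + \<sigma> * u + X (n + M)) - f (x + \<sigma> * u)) / of_real (X (n + M)))) \<longlonglongrightarrow> c u * nderiv 1 f (x + \<sigma> * u)"
          by (intro tendsto_mult_left)
      qed
      show "AE u in lborel. norm (c u * ((f (x + \<sigma> * u + X (n + M)) - f (x + \<sigma> * u)) / of_real (X (n + M)))) \<le> w u" for n
      proof (rule AE_I2)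
        fix u :: real
        define h where "h = X (n + M)"
        have h: "\<bar>h\<bar> < 1" "h \<noteq> 0" using M[of "n + M"] X0 by (auto simp: h_def)
        show "norm (c u * ((f (x + \<sigma> * u + X (n + M)) - f (x + \<sigma> * u)) / of_real (X (n + M)))) \<le> w u"
        proof (cases "0 < u")
          case True
          have up: "u powr (b - 1) > 0" using True by simp
          have "norm (f (x + \<sigma> * u + h) - f (x + \<sigma> * u)) \<le> w u / u powr (b - 1) * \<bar>h\<bar>"
          proof (rule schwartz_diff_bound[OF f])
            fix \<xi> assume "\<bar>\<xi> - (x + \<sigma> * u)\<bar> \<le> \<bar>h\<bar>"
            then have "u powr (b - 1) * norm (nderiv 1 f (x + \<sigma> * u + (\<xi> - (x + \<sigma> * u)))) \<le> w u"
              unfolding w_def using h(1) True by (intro C(2)) auto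
            then show "norm (nderiv 1 f \<xi>) \<le> w u / u powr (b - 1)" using up by (simp add: pos_le_divide_eq mult.commute)
          qed
          then have "u powr (b - 1) * (norm (f (x + \<sigma> * u + h) - f (x + \<sigma> * u)) / \<bar>h\<bar>) \<le> w u"
            using h(2) up by (simp add: field_simps)
          moreover have "norm (c u * ((f (x + \<sigma> * u + h) - f (x + \<sigma> * u)) / of_real h))
              = u powr (b - 1) * (norm (f (x + \<sigma> * u + h) - f (x + \<sigma> * u)) / \<bar>h\<bar>)"
            using True by (simp add: c_def norm_mult norm_divide)
          ultimately show ?thesis by (simp add: h_def)
        next
          case False
          then show ?thesis using w0 by (simp add: c_def)
        qed
      qed
    qed (use wi in measurable)
  qed
  then show ?thesis by (simp only: has_vector_derivative_iff_quotient)
qed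

lemma nderiv_weyl_side:
  assumes f: "schwartz f" and b: "0 < b" and \<sigma>: "\<bar>\<sigma>\<bar> = 1"
  shows "nderiv n (\<lambda>x. a * weyl_side \<sigma> b f x) = (\<lambda>x. a * weyl_side \<sigma> b (nderiv n f) x)"
proof -
  define g where "g n x = a * weyl_side \<sigma> b (nderiv n f) x" for n x
  have "(g n has_vector_derivative g (Suc n) x) (at x)" for n x
    unfolding g_def using weyl_side_deriv[OF schwartz_nderiv[OF f, of n] b \<sigma>, of x]
    by (intro has_vector_derivative_mult_right) (simp add: nderiv_nderiv)
  from nderiv_family[of g, OF this] show ?thesis by (simp add: g_def[abs_def])
qed


section \<open>Weighted Weyl derivatives as averages of dilations\<close>

text \<open>This is |x|^a times the Weyl derivative, with the phase removed: the remaining average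
  has order n - a in (0, 1]. The value is independent of p, since the 1/p in the kernel cancels the
  prefactor of \<open>dil\<close>.\<close>

definition wderiv :: "real \<Rightarrow> real \<Rightarrow> (real \<Rightarrow> complex) \<Rightarrow> real \<Rightarrow> complex" where
  "wderiv p a \<phi> = (if a = 0 then \<phi> else
     (let n = nat \<lfloor>a\<rfloor> + 1 in (\<lambda>x. (-1) ^ n * EK p (real n - a) a (monom_deriv n \<phi>) x)))"

text \<open>The factor of \<open>weyl0\<close>. It depends only on the sign of x and has modulus 1,
  so norms do not see it and dilations leave it alone.\<close>

definition phase :: "real \<Rightarrow> real \<Rightarrow> complex" where
  "phase a x = (if 0 < x then exp (\<i> * complex_of_real (pi * a)) else 1)"

lemma norm_phase [simp]: "norm (phase a x) = 1"
  by (simp add: phase_def)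

lemma phase_measurable [measurable]: "phase a \<in> borel_measurable borel"
  unfolding phase_def by measurable

text \<open>The substitution u = |x| (e^s - 1) turns the integral over u > 0 into the average over t
  = -s < 0, because x + sgn(x) u = e^s x.\<close>

lemma weyl_side_EK:
  assumes p1: "1 \<le> p" and \<phi>: "schwartz \<phi>" and b: "0 < b" and a: "0 < a" and n: "real n = a + b" and x: "x \<noteq> 0"
  shows "of_real (1 / Gamma b) * weyl_side (sgn x) b (nderiv n \<phi>) x * of_real (\<bar>x\<bar> powr a)
    = of_real (sgn x) ^ n * EK p b a (monom_deriv n \<phi>) x"
proof -
  define f where "f = nderiv n \<phi>"
  have sf: "schwartz f" unfolding f_def by (rule schwartz_nderiv[OF \<phi>])
  have cf: "isCont f y" for y
    using schwartz_nderiv_continuous[OF \<phi>, of UNIV n] by (simp add: f_def continuous_on_eq_continuous_at)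
  define \<sigma> where "\<sigma> = sgn x"
  have \<sigma>: "\<bar>\<sigma>\<bar> = 1" "\<sigma> * \<bar>x\<bar> = x" using x by (auto simp: \<sigma>_def sgn_real_def)
  define k where "k u = of_real (u powr (b - 1)) * f (x + \<sigma> * u)" for u
  define g where "g s = \<bar>x\<bar> * (exp s - 1)" for s
  have xg: "x + \<sigma> * g s = exp s * x" for s
  proof -
    have "x + \<sigma> * g s = x + (\<sigma> * \<bar>x\<bar>) * (exp s - 1)" by (simp add: g_def)
    then show ?thesis unfolding \<sigma>(2) by (simp add: algebra_simps)
  qed
  define m where "m t = of_real (eker b (a + 1 / p) t) * dil p t (monom_deriv n \<phi>) x" for t
  have [measurable]: "f \<in> borel_measurable borel" by (rule schwartz_measurable[OF sf])
  have [measurable]: "monom_deriv n \<phi> \<in> borel_measurable borel" by (rule monom_deriv_measurable[OF \<phi>])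
  have [measurable]: "k \<in> borel_measurable borel" "g \<in> borel_measurable borel" "m \<in> borel_measurable borel"
    unfolding k_def g_def m_def by measurable
  \<comment> \<open>The powers combine to |x|^a |x| |x|^(b-1) = |x|^n, since n = a + b; the sign
    factor turns |x|^n into the x^n carried by \<open>monom_deriv\<close>.\<close>
  define c where "c = of_real (sgn x) ^ n * complex_of_real (\<bar>x\<bar> powr a / Gamma b)"
  have key: "c * ((\<bar>x\<bar> * exp s) *\<^sub>R k (g s)) = m (- s)" if s: "s > 0" for s
  proof -
    have es: "exp s - 1 = exp s * (1 - exp (- s))" by (simp add: algebra_simps flip: exp_add)
    have pos: "1 - exp (- s) > 0" using s by simp
    have "(g s) powr (b - 1) = \<bar>x\<bar> powr (b - 1) * (exp s powr (b - 1) * (1 - exp (- s)) powr (b - 1))"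
      unfolding g_def es using pos by (simp add: powr_mult)
    also have "exp s powr (b - 1) = exp ((b - 1) * s)" by (simp add: powr_def)
    finally have gp: "(g s) powr (b - 1) = \<bar>x\<bar> powr (b - 1) * (exp ((b - 1) * s) * (1 - exp (- s)) powr (b - 1))" .
    have xn: "\<bar>x\<bar> powr a * (\<bar>x\<bar> * \<bar>x\<bar> powr (b - 1)) = \<bar>x\<bar> ^ n"
    proof -
      have "\<bar>x\<bar> powr a * (\<bar>x\<bar> powr 1 * \<bar>x\<bar> powr (b - 1)) = \<bar>x\<bar> powr real n"
        unfolding n powr_add[symmetric] by simp
      then show ?thesis using x by (simp add: powr_realpow)
    qed
    have "\<bar>x\<bar> powr a / Gamma b * (\<bar>x\<bar> * exp s * (g s) powr (b - 1))
        = (\<bar>x\<bar> powr a * (\<bar>x\<bar> * \<bar>x\<bar> powr (b - 1))) * (exp s * exp ((b - 1) * s)) * ((1 - exp (- s)) powr (b - 1) / Gamma b)"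
      unfolding gp by simp
    also have "exp s * exp ((b - 1) * s) = exp (b * s)" by (simp add: algebra_simps flip: exp_add)
    finally have real: "\<bar>x\<bar> powr a / Gamma b * (\<bar>x\<bar> * exp s * (g s) powr (b - 1))
        = \<bar>x\<bar> ^ n * exp (b * s) * ((1 - exp (- s)) powr (b - 1) / Gamma b)" unfolding xn .
    have sx: "of_real (sgn x) ^ n * complex_of_real (\<bar>x\<bar> ^ n) = of_real x ^ n"
      unfolding of_real_power[symmetric] of_real_mult[symmetric] power_mult_distrib[symmetric] by (simp add: sgn_mult_abs)
    have "c * ((\<bar>x\<bar> * exp s) *\<^sub>R k (g s))
        = of_real (sgn x) ^ n * of_real (\<bar>x\<bar> powr a / Gamma b * (\<bar>x\<bar> * exp s * (g s) powr (b - 1))) * f (exp s * x)"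
      unfolding c_def k_def xg scaleR_conv_of_real by simp
    also have "\<dots> = (of_real (sgn x) ^ n * of_real (\<bar>x\<bar> ^ n)) * of_real (exp (b * s) * ((1 - exp (- s)) powr (b - 1) / Gamma b)) * f (exp s * x)"
      unfolding real by simp
    also have "\<dots> = of_real x ^ n * of_real (exp (b * s) * ((1 - exp (- s)) powr (b - 1) / Gamma b)) * f (exp s * x)"
      unfolding sx ..
    also have "\<dots> = m (- s)"
    proof -
      have "exp ((a + 1 / p) * - s) * exp (s / p) * exp s ^ n = exp (b * s)"
      proof -
        have "exp s ^ n = exp (real n * s)" by (simp add: exp_of_nat_mult)
        then show ?thesis unfolding n by (simp add: algebra_simps flip: exp_add)
      qed
      then have "exp (b * s) * ((1 - exp (- s)) powr (b - 1) / Gamma b) = eker b (a + 1 / p) (- s) * exp (s / p) * exp s ^ n"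
        using s by (simp add: eker_def mult_ac)
      then show ?thesis unfolding m_def dil_def monom_deriv_def f_def[symmetric] by (simp add: power_mult_distrib mult_ac)
    qed
    finally show ?thesis .
  qed
  have c0: "c \<noteq> 0" using x Gamma_real_pos[OF b] by (simp add: c_def sgn_real_def)
  \<comment> \<open>Integrability is checked on the dilation side, where boundedness of the monomial
    derivative leaves only the kernel; the prefactor of \<open>dil\<close> lowers its exponent from
    a + 1/p to a, which is positive here.\<close>
  have mi: "integrable lborel (\<lambda>s. indicator {0<..} s *\<^sub>R m (- s))"
  proof -
    obtain C where C: "0 \<le> C" "\<And>x. norm (monom_deriv n \<phi> x) * (1 + x\<^sup>2) \<le> C" using monom_deriv_decay[OF \<phi>] by metis
    have C': "norm (monom_deriv n \<phi> y) \<le> C" for y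
      using C(2)[of y] mult_left_mono[of 1 "1 + y\<^sup>2" "norm (monom_deriv n \<phi> y)"] by simp
    have "integrable lborel m"
    proof (rule Bochner_Integration.integrable_bound)
      show "integrable lborel (\<lambda>t. C * eker b a t)" by (intro integrable_mult_right eker_integrable a b)
      show "m \<in> borel_measurable lborel" unfolding m_def by measurable
      show "AE t in lborel. norm (m t) \<le> norm (C * eker b a t)"
      proof (rule AE_I2)
        fix t
        have "eker b (a + 1 / p) t * exp (- t / p) = eker b a t"
          by (simp add: eker_def algebra_simps flip: exp_add)
        then have "norm (m t) = eker b a t * norm (monom_deriv n \<phi> (exp (- t) * x))"
          unfolding m_def dil_def using eker_nonneg[OF b] by (simp add: norm_mult abs_of_nonneg mult.assoc[symmetric])
        also have "\<dots> \<le> eker b a t * C" by (intro mult_left_mono C' eker_nonneg b)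
        finally show "norm (m t) \<le> norm (C * eker b a t)" using C(1) eker_nonneg[OF b] by (simp add: abs_of_nonneg mult.commute)
      qed
    qed
    from lborel_integrable_real_affine[OF this, of "-1" 0] have "integrable lborel (\<lambda>s. m (- s))" by simp
    then have "set_integrable lborel UNIV (\<lambda>s. m (- s))" by (simp add: set_integrable_def)
    then have "set_integrable lborel {0<..} (\<lambda>s. m (- s))" by (rule set_integrable_subset) auto
    then show ?thesis by (simp add: set_integrable_def)
  qed
  have e0: "einterval 0 \<infinity> = {0::real<..}" by (auto simp: einterval_def)
  have i1: "set_integrable lborel {0<..} (\<lambda>s. (\<bar>x\<bar> * exp s) *\<^sub>R k (g s))"
  proof -
    have "integrable lborel (\<lambda>s. (1 / c) * (indicator {0<..} s *\<^sub>R m (- s)))" using mi by (rule integrable_mult_right)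
    also have "(\<lambda>s. (1 / c) * (indicator {0<..} s *\<^sub>R m (- s))) = (\<lambda>s. indicator {0<..} s *\<^sub>R ((\<bar>x\<bar> * exp s) *\<^sub>R k (g s)))"
    proof
      fix s
      show "(1 / c) * (indicator {0<..} s *\<^sub>R m (- s)) = indicator {0<..} s *\<^sub>R ((\<bar>x\<bar> * exp s) *\<^sub>R k (g s))"
        using key[of s, symmetric] c0 by (cases "s > 0") simp_all
    qed
    finally show ?thesis by (simp add: set_integrable_def)
  qed
  have ki: "(LINT u|lborel. indicator {0<..} u *\<^sub>R k u) = weyl_side \<sigma> b f x"
    unfolding weyl_side_def k_def by (intro Bochner_Integration.integral_cong) (auto simp: indicator_def)
  have i2: "set_integrable lborel {0<..} k"
    using weyl_side_integrable[OF sf b \<sigma>(1), of x] unfolding set_integrable_def k_def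
    by (rule Bochner_Integration.integrable_cong[THEN iffD1, OF refl, rotated]) (auto simp: indicator_def)
  have "(LBINT u=0..\<infinity>. k u) = (LBINT s=0..\<infinity>. (\<bar>x\<bar> * exp s) *\<^sub>R k (g s))"
  proof (rule interval_integral_substitution_integrable)
    show "DERIV g s :> \<bar>x\<bar> * exp s" for s unfolding g_def by (auto intro!: derivative_eq_intros)
    show "isCont k (g s)" if "0 < ereal s" for s
    proof -
      have "g s > 0" using that x by (simp add: g_def)
      then show ?thesis unfolding k_def by (intro continuous_intros isCont_o2[OF _ cf]) auto
    qed
    show "isCont (\<lambda>s. \<bar>x\<bar> * exp s) s" for s by (intro continuous_intros)
    show "((ereal \<circ> g \<circ> real_of_ereal) \<longlongrightarrow> 0) (at_right 0)"
      unfolding zero_ereal_def ereal_tendsto_simps g_def by (auto intro!: tendsto_eq_intros)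
    have "filterlim (\<lambda>s. exp s - 1 :: real) at_top at_top"
      using filterlim_tendsto_add_at_top[OF tendsto_const[of "-1"] exp_at_top] by simp
    then have "filterlim g at_top at_top" unfolding g_def using x
      by (intro filterlim_tendsto_pos_mult_at_top[OF tendsto_const]) auto
    then show "((ereal \<circ> g \<circ> real_of_ereal) \<longlongrightarrow> \<infinity>) (at_left \<infinity>)"
      unfolding ereal_tendsto_simps .
  qed (use i1 i2 in \<open>auto simp: e0\<close>)
  then have "weyl_side \<sigma> b f x = (LINT s|lborel. indicator {0<..} s *\<^sub>R ((\<bar>x\<bar> * exp s) *\<^sub>R k (g s)))"
    by (simp add: interval_lebesgue_integral_def e0 set_lebesgue_integral_def ki)
  then have "c * weyl_side \<sigma> b f x = (LINT s|lborel. c * (indicator {0<..} s *\<^sub>R ((\<bar>x\<bar> * exp s) *\<^sub>R k (g s))))" by (simp only: integral_mult_right_zero)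
  also have "\<dots> = (LINT s|lborel. m (- s))"
  proof (rule integral_cong_AE)
    have "AE s in lborel. s \<noteq> (0::real)" by (rule AE_lborel_singleton)
    then show "AE s in lborel. c * (indicator {0<..} s *\<^sub>R ((\<bar>x\<bar> * exp s) *\<^sub>R k (g s))) = m (- s)"
    proof eventually_elim
      case (elim s)
      show ?case using key[of s] elim
        by (cases "s > 0") (auto simp: m_def eker_def)
    qed
  qed auto
  also have "\<dots> = EK p b a (monom_deriv n \<phi>) x"
    using lborel_integral_real_affine[of "-1" m 0] by (simp add: EK_def conv_def m_def)
  finally have fin: "c * weyl_side \<sigma> b f x = EK p b a (monom_deriv n \<phi>) x" .
  have "of_real (sgn x) ^ n * of_real (sgn x) ^ n = (1 :: complex)"
    using x by (simp add: sgn_real_def flip: power_mult_distrib)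
  then have "of_real (sgn x) ^ n * (c * weyl_side \<sigma> b f x) = of_real (1 / Gamma b) * weyl_side \<sigma> b f x * of_real (\<bar>x\<bar> powr a)"
    unfolding c_def by (simp add: mult.assoc[symmetric])
  then show ?thesis unfolding fin by (simp add: \<sigma>_def f_def)
qed

text \<open>On the right, (-1)^n belongs to the definition of \<open>weyl_plus\<close> and sgn(x)^n
  = 1; on the left, \<open>weyl_minus\<close> has no sign and (-1)^n comes from sgn(x)^n. So one
  formula \<open>wderiv\<close> serves both half-lines.\<close>

lemma weyl0_wderiv:
  assumes p1: "1 \<le> p" and \<phi>: "schwartz \<phi>" and a: "0 \<le> a" and x: "x \<noteq> 0"
  shows "weyl0 a \<phi> x * of_real (\<bar>x\<bar> powr a) = phase a x * wderiv p a \<phi> x"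
proof (cases "a = 0")
  case True
  then show ?thesis using x by (auto simp: weyl0_def weyl_plus_def weyl_minus_def wderiv_def phase_def)
next
  case False
  define n where "n = nat \<lfloor>a\<rfloor> + 1"
  define b where "b = real n - a"
  have a0: "0 < a" using a False by simp
  have b: "0 < b" unfolding b_def n_def using a by linarith
  have n: "real n = a + b" by (simp add: b_def)
  note E = weyl_side_EK[OF p1 \<phi> b a0 n x]
  have J: "wderiv p a \<phi> x = (-1) ^ n * EK p b a (monom_deriv n \<phi>) x"
    using False by (simp add: wderiv_def Let_def n_def b_def)
  show ?thesis
  proof (cases "x > 0")
    case True
    have "weyl_int_plus b \<phi> y = of_real (1 / Gamma b) * weyl_side 1 b \<phi> y" for y
    proof -
      have "(LINT s:{y<..}|lborel. complex_of_real ((s - y) powr (b - 1)) * \<phi> s) = weyl_side 1 b \<phi> y"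
        unfolding set_lebesgue_integral_def weyl_side_def
        using lborel_integral_real_affine[of 1 "\<lambda>s. indicator {y<..} s *\<^sub>R (complex_of_real ((s - y) powr (b - 1)) * \<phi> s)" y]
        by (simp, intro Bochner_Integration.integral_cong) (auto simp: indicator_def)
      then show ?thesis by (simp add: weyl_int_plus_def)
    qed
    then have "weyl_int_plus b \<phi> = (\<lambda>y. of_real (1 / Gamma b) * weyl_side 1 b \<phi> y)" by (rule ext)
    moreover have "weyl_plus a \<phi> x = (-1) ^ n * nderiv n (weyl_int_plus b \<phi>) x"
      using False unfolding weyl_plus_def Let_def n_def[symmetric] b_def[symmetric] by simp
    ultimately have "weyl_plus a \<phi> x = (-1) ^ n * (of_real (1 / Gamma b) * weyl_side 1 b (nderiv n \<phi>) x)"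
      using nderiv_weyl_side[OF \<phi> b, of 1 n "of_real (1 / Gamma b)"] by simp
    then have "weyl0 a \<phi> x * of_real (\<bar>x\<bar> powr a)
       = phase a x * ((-1) ^ n * (of_real (1 / Gamma b) * weyl_side 1 b (nderiv n \<phi>) x * of_real (\<bar>x\<bar> powr a)))"
      using True by (simp add: weyl0_def phase_def)
    moreover have "sgn x = 1" using True by simp
    ultimately show ?thesis unfolding J using E by (simp only:) simp
  next
    case False': False
    have "(\<lambda>y. LINT t:{..<y}|lborel. complex_of_real ((y - t) powr (b - 1)) * \<phi> t) = (\<lambda>y. 1 * weyl_side (-1) b \<phi> y)"
    proof
      fix y
      show "(LINT t:{..<y}|lborel. complex_of_real ((y - t) powr (b - 1)) * \<phi> t) = 1 * weyl_side (-1) b \<phi> y"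
        unfolding set_lebesgue_integral_def weyl_side_def
        using lborel_integral_real_affine[of "-1" "\<lambda>t. indicator {..<y} t *\<^sub>R (complex_of_real ((y - t) powr (b - 1)) * \<phi> t)" y]
        by (simp, intro Bochner_Integration.integral_cong) (auto simp: indicator_def)
    qed
    moreover have "weyl_minus a \<phi> x = of_real (1 / Gamma b) *
        nderiv n (\<lambda>y. LINT t:{..<y}|lborel. complex_of_real ((y - t) powr (b - 1)) * \<phi> t) x"
      using False unfolding weyl_minus_def Let_def n_def[symmetric] b_def[symmetric] by simp
    ultimately have "weyl_minus a \<phi> x = of_real (1 / Gamma b) * weyl_side (-1) b (nderiv n \<phi>) x"
      using nderiv_weyl_side[OF \<phi> b, of "-1" n 1] by simp
    then have "weyl0 a \<phi> x * of_real (\<bar>x\<bar> powr a)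
       = phase a x * (of_real (1 / Gamma b) * weyl_side (-1) b (nderiv n \<phi>) x * of_real (\<bar>x\<bar> powr a))"
      using False' x by (simp add: weyl0_def phase_def)
    moreover have "sgn x = - 1" using False' x by simp
    ultimately show ?thesis unfolding J using E by (simp only:) simp
  qed
qed

section \<open>The spaces as images of L^p\<close>

text \<open>The left inverse of \<open>wderiv\<close> on Schwartz functions: the fractional integral
  of order a of |s|^(-a) F, with weight 0 because no power of x stays in front. Order 0 is separate
  because its kernel would be a point mass.\<close>

definition wint :: "real \<Rightarrow> real \<Rightarrow> (real \<Rightarrow> complex) \<Rightarrow> real \<Rightarrow> complex" where
  "wint p a F = (if a = 0 then F else EK p a 0 F)"

text \<open>The element \<open>g\<close> of the completion is represented by the \<open>L\<^sup>p\<close> function \<open>F\<close> that extends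
  \<open>|t|\<^sup>a W\<^sub>0\<^sup>a g\<close>, freed of its phase.\<close>

definition Trep :: "real \<Rightarrow> real \<Rightarrow> (real \<Rightarrow> complex) \<Rightarrow> (real \<Rightarrow> complex) \<Rightarrow> bool" where
  "Trep a p g F \<longleftrightarrow> g \<in> borel_measurable borel \<and> F \<in> Lp p \<and> (AE x in lborel. g x = wint p a F x)"

lemma TrepD:
  assumes "Trep a p g F"
  shows "g \<in> borel_measurable borel" "F \<in> Lp p" "AE x in lborel. g x = wint p a F x"
  using assms by (auto simp: Trep_def)

context
  fixes p a :: real
  assumes p1: "1 \<le> p" and a0: "0 \<le> a"
begin

lemma wint_Lp: "F \<in> Lp p \<Longrightarrow> wint p a F \<in> Lp p"
  unfolding wint_def using a0 EK_Lp[OF p1] by simp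

lemma dil_wint: "dil p t (wint p a F) = wint p a (dil p t F)"
  unfolding wint_def using dil_EK[OF p1] by simp

lemma wint_linear_AE:
  assumes "F \<in> Lp p" "G \<in> Lp p"
  shows "AE x in lborel. wint p a (\<lambda>x. c * F x + d * G x) x = c * wint p a F x + d * wint p a G x"
proof (cases "a = 0")
  case False
  then show ?thesis
    unfolding wint_def EK_def using conv_add_AE[OF p1 ek_integrable[OF p1, of a 0] assms] a0 by simp
qed (simp add: wint_def)

lemma wint_bounded:
  obtains C where "\<And>F G. F \<in> Lp p \<Longrightarrow> G \<in> Lp p \<Longrightarrow> Lnorm p (\<lambda>x. wint p a F x - wint p a G x) \<le> C * Lnorm p (\<lambda>x. F x - G x)"
proof (cases "a = 0")
  case True
  then show ?thesis using that[of 1] by (simp add: wint_def)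
next
  case False
  then have "wint p a F = conv p (\<lambda>t. complex_of_real (eker a (0 + 1 / p) t)) F" for F by (simp add: wint_def EK_def)
  then show ?thesis
    using Lnorm_conv_diff[OF p1 ek_integrable[OF p1, of a 0]] a0 False by (intro that) auto
qed

lemma wint_injective:
  assumes F: "F \<in> Lp p" and G: "G \<in> Lp p" and eq: "AE x in lborel. wint p a F x = wint p a G x"
  shows "AE x in lborel. F x = G x"
proof -
  define D where "D x = 1 * F x + (-1) * G x" for x
  have D: "D \<in> Lp p" unfolding D_def by (intro Lp_add Lp_scale p1 F G)
  have "AE x in lborel. wint p a D x = 0"
    using wint_linear_AE[OF F G, of 1 "-1"] eq unfolding D_def by eventually_elim simp
  then have "AE x in lborel. D x = 0"
    using EK_injective[OF p1 _ _ D, of a 0] a0 by (cases "a = 0") (auto simp: wint_def)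
  then show ?thesis unfolding D_def by eventually_elim simp
qed

lemma wderiv_Lp: "schwartz \<phi> \<Longrightarrow> wderiv p a \<phi> \<in> Lp p"
proof (cases "a = 0")
  case False
  assume \<phi>: "schwartz \<phi>"
  have "0 < real (nat \<lfloor>a\<rfloor> + 1) - a" using a0 by linarith
  from Lp_scale[OF p1 EK_Lp[OF p1 this a0 monom_deriv_Lp[OF p1 \<phi>]]] show ?thesis
    unfolding wderiv_def Let_def using False by (simp only: if_False)
qed (simp add: wderiv_def schwartz_Lp[OF p1])

lemma wderiv_diff_AE:
  assumes \<phi>: "schwartz \<phi>" and \<psi>: "schwartz \<psi>"
  shows "AE x in lborel. wderiv p a (\<lambda>x. \<phi> x - \<psi> x) x = wderiv p a \<phi> x - wderiv p a \<psi> x"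
proof (cases "a = 0")
  case False
  define n where "n = nat \<lfloor>a\<rfloor> + 1"
  have b: "0 < real n - a" unfolding n_def using a0 by linarith
  have J: "wderiv p a \<eta> = (\<lambda>x. (-1) ^ n * EK p (real n - a) a (monom_deriv n \<eta>) x)" for \<eta>
    using False by (simp add: wderiv_def n_def Let_def)
  have m: "monom_deriv n (\<lambda>x. \<phi> x - \<psi> x) = (\<lambda>x. monom_deriv n \<phi> x - monom_deriv n \<psi> x)"
    using monom_deriv_linear[OF \<phi> \<psi>, of n 1 "-1"] by simp
  have "AE x in lborel. EK p (real n - a) a (\<lambda>x. monom_deriv n \<phi> x - monom_deriv n \<psi> x) x
      = EK p (real n - a) a (monom_deriv n \<phi>) x - EK p (real n - a) a (monom_deriv n \<psi>) x"
    unfolding EK_def by (intro conv_diff_AE p1 ek_integrable b a0 monom_deriv_Lp \<phi> \<psi>)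
  then show ?thesis unfolding J m by eventually_elim (simp add: right_diff_distrib)
qed (simp add: wderiv_def)

text \<open>\<open>wderiv\<close> is an average of weight a, as the index law requires, so orders a
  and n - a merge into the integer order n, which Taylor's formula inverts; the two signs (-1)^n
  cancel.\<close>

lemma wint_wderiv:
  assumes \<phi>: "schwartz \<phi>"
  shows "AE x in lborel. wint p a (wderiv p a \<phi>) x = \<phi> x"
proof (cases "a = 0")
  case False
  define m where "m = nat \<lfloor>a\<rfloor>"
  define b where "b = real (Suc m) - a"
  have b: "0 < b" unfolding b_def m_def using a0 by linarith
  have a: "0 < a" using False a0 by simp
  have J: "wderiv p a \<phi> = (\<lambda>x. (-1) ^ Suc m * EK p b a (monom_deriv (Suc m) \<phi>) x)"
    using False by (simp add: wderiv_def m_def b_def Let_def)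
  have "AE x in lborel. EK p a 0 (EK p b (0 + a) (monom_deriv (Suc m) \<phi>)) x = EK p (a + b) 0 (monom_deriv (Suc m) \<phi>) x"
    by (intro EK_EK p1 a b monom_deriv_Lp \<phi>) simp
  moreover have "AE x in lborel. EK p (real (Suc m)) (real 0) (monom_deriv (0 + Suc m) \<phi>) x = (-1) ^ Suc m * monom_deriv 0 \<phi> x"
    by (rule EK_monom_deriv[OF p1 \<phi>])
  moreover have "a + b = real (Suc m)" by (simp add: b_def)
  ultimately have 1: "AE x in lborel. EK p a 0 (EK p b a (monom_deriv (Suc m) \<phi>)) x = (-1) ^ Suc m * \<phi> x"
    by (auto simp: monom_deriv_def elim!: eventually_elim2 simp del: power_Suc)
  have 2: "wint p a (wderiv p a \<phi>) x = (-1) ^ Suc m * EK p a 0 (EK p b a (monom_deriv (Suc m) \<phi>)) x" for x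
    unfolding wint_def J using False by (simp add: EK_scale[OF p1] del: power_Suc)
  have 3: "(-1) ^ Suc m * ((-1) ^ Suc m * \<phi> x) = \<phi> x" for x
    by (simp add: mult.assoc[symmetric] flip: power_mult_distrib del: power_Suc)
  show ?thesis unfolding 2 using 1 by eventually_elim (simp only: 3)
qed (simp add: wint_def wderiv_def)

text \<open>Replace F by a Schwartz function \<eta>. It is an average of order b = n - a of some
  \<xi> in L^p, and \<xi> is a limit of functions x^n d^n \<phi>; boundedness of the average carries
  this approximation over to \<eta>.\<close>

lemma wderiv_dense:
  assumes F: "F \<in> Lp p" and e: "e > 0"
  shows "\<exists>\<phi>. schwartz \<phi> \<and> Lnorm p (\<lambda>x. wderiv p a \<phi> x - F x) < e"
proof -
  have "F \<in> Lcl p (Collect schwartz)" using F schwartz_dense[OF p1] by simp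
  then have "\<exists>\<eta>\<in>Collect schwartz. Lnorm p (\<lambda>x. F x - \<eta> x) < d" if "d > 0" for d using that by (simp add: Lcl_def)
  from this[of "e / 2"] obtain \<eta> where \<eta>: "schwartz \<eta>" "Lnorm p (\<lambda>x. F x - \<eta> x) < e / 2" using e by auto
  show ?thesis
  proof (cases "a = 0")
    case True
    then show ?thesis using \<eta> e by (intro exI[of _ \<eta>]) (simp add: wderiv_def Lnorm_minus_commute[OF p1, of \<eta>])
  next
    case False
    define n where "n = nat \<lfloor>a\<rfloor> + 1"
    define b where "b = real n - a"
    have b: "0 < b" "b \<le> 1" unfolding b_def n_def using a0 by linarith+
    obtain \<psi> where \<psi>: "\<psi> \<in> Lp p" "AE x in lborel. EK p 1 a \<psi> x = \<eta> x" using schwartz_in_range_EK_1[OF p1 \<eta>(1) a0] by blast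
    have "\<exists>\<xi>\<in>Lp p. AE x in lborel. EK p b a \<xi> x = \<eta> x"
    proof (cases "b = 1")
      case True
      then show ?thesis using \<psi> by auto
    next
      case False
      \<comment> \<open>An order-1 preimage of \<eta> is known; averaging it with the missing order
        1 - b yields a preimage of order b.\<close>
      have "AE x in lborel. EK p b a (EK p (1 - b) (a + b) \<psi>) x = EK p (b + (1 - b)) a \<psi> x"
        using EK_EK[OF p1 b(1) _ a0 \<psi>(1), of "1 - b"] b False by simp
      with \<psi>(2) have "AE x in lborel. EK p b a (EK p (1 - b) (a + b) \<psi>) x = \<eta> x" by eventually_elim simp
      moreover have "EK p (1 - b) (a + b) \<psi> \<in> Lp p" using b False a0 by (intro EK_Lp p1 \<psi>) auto
      ultimately show ?thesis by blast
    qed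
    then obtain \<xi> where \<xi>: "\<xi> \<in> Lp p" "AE x in lborel. EK p b a \<xi> x = \<eta> x" by blast
    define K where "K = (LINT t|lborel. norm (complex_of_real (eker b (a + 1 / p) t))) + 1"
    have K: "K > 0" unfolding K_def by (intro add_nonneg_pos) auto
    have "\<xi> \<in> Lcl p (monom_deriv n ` Collect schwartz)" using \<xi>(1) monom_deriv_dense[OF p1] by simp
    then have "\<exists>h\<in>monom_deriv n ` Collect schwartz. Lnorm p (\<lambda>x. \<xi> x - h x) < e / 2 / K"
      using e K by (simp add: Lcl_def)
    then obtain \<phi>0 where \<phi>0: "schwartz \<phi>0" "Lnorm p (\<lambda>x. \<xi> x - monom_deriv n \<phi>0 x) < e / 2 / K" by auto
    have mL: "monom_deriv n \<phi>0 \<in> Lp p" by (rule monom_deriv_Lp[OF p1 \<phi>0(1)])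
    \<comment> \<open>The sign built into \<open>wderiv\<close> is absorbed into the test
      function.\<close>
    define \<phi> where "\<phi> x = (-1) ^ n * \<phi>0 x" for x
    have s\<phi>: "schwartz \<phi>" unfolding \<phi>_def using schwartz_add_scale(1)[OF \<phi>0(1) \<phi>0(1), of "(-1) ^ n" 0] by simp
    have "monom_deriv n \<phi> = (\<lambda>x. (-1) ^ n * monom_deriv n \<phi>0 x)"
      unfolding \<phi>_def using monom_deriv_linear[OF \<phi>0(1) \<phi>0(1), of n "(-1) ^ n" 0] by simp
    moreover have "wderiv p a \<phi> = (\<lambda>x. (-1) ^ n * EK p b a (monom_deriv n \<phi>) x)"
      using False unfolding wderiv_def Let_def n_def[symmetric] b_def[symmetric] by simp
    ultimately have "wderiv p a \<phi> x = (-1) ^ n * ((-1) ^ n * EK p b a (monom_deriv n \<phi>0) x)" for x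
      by (simp only: EK_scale[OF p1])
    then have J: "wderiv p a \<phi> = EK p b a (monom_deriv n \<phi>0)"
      by (simp add: fun_eq_iff mult.assoc[symmetric] flip: power_mult_distrib)
    have EL: "EK p b a \<xi> \<in> Lp p" "EK p b a (monom_deriv n \<phi>0) \<in> Lp p" by (intro EK_Lp p1 b a0 \<xi> mL)+
    have "Lnorm p (\<lambda>x. EK p b a \<xi> x - EK p b a (monom_deriv n \<phi>0) x) \<le> (K - 1) * Lnorm p (\<lambda>x. \<xi> x - monom_deriv n \<phi>0 x)"
      unfolding EK_def K_def using Lnorm_conv_diff[OF p1 ek_integrable[OF p1 b(1) a0] \<xi>(1) mL] by simp
    also have "\<dots> \<le> K * Lnorm p (\<lambda>x. \<xi> x - monom_deriv n \<phi>0 x)" by (intro mult_right_mono) auto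
    also have "\<dots> < K * (e / 2 / K)" using \<phi>0(2) K by (intro mult_strict_left_mono)
    also have "\<dots> = e / 2" using K by simp
    finally have "Lnorm p (\<lambda>x. EK p b a \<xi> x - wderiv p a \<phi> x) < e / 2" by (simp add: J)
    moreover have "Lnorm p (\<lambda>x. EK p b a \<xi> x - wderiv p a \<phi> x) = Lnorm p (\<lambda>x. \<eta> x - wderiv p a \<phi> x)"
    proof (rule Lnorm_cong_AE)
      show "AE x in lborel. EK p b a \<xi> x - wderiv p a \<phi> x = \<eta> x - wderiv p a \<phi> x" using \<xi>(2) by eventually_elim simp
    qed (use Lp_measurable[OF Lp_diff[OF p1 EL(1) wderiv_Lp[OF s\<phi>]]] Lp_measurable[OF Lp_diff[OF p1 schwartz_Lp[OF p1 \<eta>(1)] wderiv_Lp[OF s\<phi>]]] in auto)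
    ultimately have "Lnorm p (\<lambda>x. F x - wderiv p a \<phi> x) < e"
      using \<eta>(2) Lnorm_triangle3[OF p1 F schwartz_Lp[OF p1 \<eta>(1)] wderiv_Lp[OF s\<phi>]] by simp
    then show ?thesis using s\<phi> by (intro exI[of _ \<phi>]) (simp add: Lnorm_minus_commute[OF p1, of _ F])
  qed
qed

section \<open>Identification of the completion with L^p\<close>

lemma tnorm_wderiv:
  assumes \<phi>: "schwartz \<phi>"
  shows "tnorm a p \<phi> = 1 / Gamma (a + 1) * Lnorm p (wderiv p a \<phi>)"
proof -
  have "(LINT t|lborel. (norm (weyl0 a \<phi> t) * \<bar>t\<bar> powr a) powr p) = (LINT t|lborel. norm (wderiv p a \<phi> t) powr p)"
  proof (rule integral_discrete_difference[where X="{0}"])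
    fix t :: real assume "t \<notin> {0}"
    then have "norm (weyl0 a \<phi> t * of_real (\<bar>t\<bar> powr a)) = norm (wderiv p a \<phi> t)"
      using weyl0_wderiv[OF p1 \<phi> a0, of t] by (simp add: norm_mult)
    then show "(norm (weyl0 a \<phi> t) * \<bar>t\<bar> powr a) powr p = norm (wderiv p a \<phi> t) powr p" by (simp add: norm_mult)
  qed auto
  then show ?thesis by (simp add: tnorm_def Lnorm_def)
qed

lemma Gamma_pos: "Gamma (a + 1) > 0"
  using a0 by (intro Gamma_real_pos) simp

lemma approx_seq_iff:
  "approx_seq a p \<phi> g \<longleftrightarrow> (\<forall>n. schwartz (\<phi> n)) \<and>
     (\<forall>e>0. \<exists>N. \<forall>m\<ge>N. \<forall>n\<ge>N. Lnorm p (\<lambda>x. wderiv p a (\<phi> m) x - wderiv p a (\<phi> n) x) < e) \<and>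
     g \<in> Lp p \<and> (\<lambda>n. Lnorm p (\<lambda>x. \<phi> n x - g x)) \<longlonglongrightarrow> 0"
proof (cases "\<forall>n. schwartz (\<phi> n)")
  case True
  have t: "tnorm a p (\<lambda>x. \<phi> m x - \<phi> n x) = 1 / Gamma (a + 1) * Lnorm p (\<lambda>x. wderiv p a (\<phi> m) x - wderiv p a (\<phi> n) x)" for m n
  proof -
    have s: "schwartz (\<phi> m)" "schwartz (\<phi> n)" using True by auto
    have "Lnorm p (wderiv p a (\<lambda>x. \<phi> m x - \<phi> n x)) = Lnorm p (\<lambda>x. wderiv p a (\<phi> m) x - wderiv p a (\<phi> n) x)"
      by (rule Lnorm_cong_AE[OF wderiv_diff_AE[OF s]])
         (use Lp_measurable[OF wderiv_Lp[OF schwartz_diff[OF s]]] Lp_measurable[OF Lp_diff[OF p1 wderiv_Lp[OF s(1)] wderiv_Lp[OF s(2)]]] in auto)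
    then show ?thesis by (simp add: tnorm_wderiv[OF schwartz_diff[OF s]])
  qed
  have "(\<forall>e>0. \<exists>N. \<forall>m\<ge>N. \<forall>n\<ge>N. tnorm a p (\<lambda>x. \<phi> m x - \<phi> n x) < e)
      \<longleftrightarrow> (\<forall>e>0. \<exists>N. \<forall>m\<ge>N. \<forall>n\<ge>N. Lnorm p (\<lambda>x. wderiv p a (\<phi> m) x - wderiv p a (\<phi> n) x) < e)" (is "?L \<longleftrightarrow> ?R")
  proof
    assume L: ?L
    show ?R
    proof (intro allI impI)
      fix e :: real assume "e > 0"
      then have "e / Gamma (a + 1) > 0" using Gamma_pos by simp
      with L obtain N where "\<forall>m\<ge>N. \<forall>n\<ge>N. tnorm a p (\<lambda>x. \<phi> m x - \<phi> n x) < e / Gamma (a + 1)" by blast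
      then show "\<exists>N. \<forall>m\<ge>N. \<forall>n\<ge>N. Lnorm p (\<lambda>x. wderiv p a (\<phi> m) x - wderiv p a (\<phi> n) x) < e"
        using Gamma_pos unfolding t by (intro exI[of _ N]) (auto simp: divide_less_cancel)
    qed
  next
    assume R: ?R
    show ?L
    proof (intro allI impI)
      fix e :: real assume "e > 0"
      then have "e * Gamma (a + 1) > 0" using Gamma_pos by simp
      with R obtain N where "\<forall>m\<ge>N. \<forall>n\<ge>N. Lnorm p (\<lambda>x. wderiv p a (\<phi> m) x - wderiv p a (\<phi> n) x) < e * Gamma (a + 1)" by blast
      then show "\<exists>N. \<forall>m\<ge>N. \<forall>n\<ge>N. tnorm a p (\<lambda>x. \<phi> m x - \<phi> n x) < e"
        using Gamma_pos unfolding t by (intro exI[of _ N]) (auto simp: pos_divide_less_eq)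
    qed
  qed
  then show ?thesis unfolding approx_seq_def Lp_def Lnorm_tendsto_0_iff[OF p1] by auto
next
  case False
  then show ?thesis unfolding approx_seq_def by blast
qed

text \<open>Each \<open>\<phi> n\<close> is the fractional integral of its own weighted derivative.
  The latter converges in L^p by completeness, and boundedness of \<open>wint\<close> identifies g
  as the fractional integral of the limit.\<close>

lemma approx_seq_limit:
  assumes "approx_seq a p \<phi> g"
  obtains F where "Trep a p g F" "(\<lambda>n. Lnorm p (\<lambda>x. wderiv p a (\<phi> n) x - F x)) \<longlonglongrightarrow> 0"
proof -
  have s: "schwartz (\<phi> n)" for n using assms by (simp add: approx_seq_iff)
  have g: "g \<in> Lp p" "(\<lambda>n. Lnorm p (\<lambda>x. \<phi> n x - g x)) \<longlonglongrightarrow> 0" using assms by (auto simp: approx_seq_iff)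
  have "\<exists>F\<in>Lp p. (\<lambda>n. Lnorm p (\<lambda>x. wderiv p a (\<phi> n) x - F x)) \<longlonglongrightarrow> 0"
    using assms by (intro Lp_complete p1 wderiv_Lp s) (auto simp: approx_seq_iff)
  then obtain F where F: "F \<in> Lp p" "(\<lambda>n. Lnorm p (\<lambda>x. wderiv p a (\<phi> n) x - F x)) \<longlonglongrightarrow> 0" by blast
  obtain C where C: "\<And>F G. F \<in> Lp p \<Longrightarrow> G \<in> Lp p \<Longrightarrow> Lnorm p (\<lambda>x. wint p a F x - wint p a G x) \<le> C * Lnorm p (\<lambda>x. F x - G x)"
    using wint_bounded by blast
  have le: "Lnorm p (\<lambda>x. g x - wint p a F x) \<le> Lnorm p (\<lambda>x. \<phi> n x - g x) + C * Lnorm p (\<lambda>x. wderiv p a (\<phi> n) x - F x)" for n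
  proof -
    have "Lnorm p (\<lambda>x. \<phi> n x - wint p a F x) = Lnorm p (\<lambda>x. wint p a (wderiv p a (\<phi> n)) x - wint p a F x)"
    proof (rule Lnorm_cong_AE)
      show "AE x in lborel. \<phi> n x - wint p a F x = wint p a (wderiv p a (\<phi> n)) x - wint p a F x"
        using wint_wderiv[OF s[of n]] by eventually_elim simp
    qed (use Lp_measurable[OF Lp_diff[OF p1 schwartz_Lp[OF p1 s] wint_Lp[OF F(1)]]] Lp_measurable[OF Lp_diff[OF p1 wint_Lp[OF wderiv_Lp[OF s]] wint_Lp[OF F(1)]]] in auto)
    also have "\<dots> \<le> C * Lnorm p (\<lambda>x. wderiv p a (\<phi> n) x - F x)" by (rule C[OF wderiv_Lp[OF s] F(1)])
    finally show ?thesis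
      using Lnorm_triangle3[OF p1 g(1) schwartz_Lp[OF p1 s[of n]] wint_Lp[OF F(1)]]
      by (simp add: Lnorm_minus_commute[OF p1, of g])
  qed
  have "(\<lambda>n. Lnorm p (\<lambda>x. \<phi> n x - g x) + C * Lnorm p (\<lambda>x. wderiv p a (\<phi> n) x - F x)) \<longlonglongrightarrow> 0 + C * 0"
    by (intro tendsto_intros g F)
  then have "Lnorm p (\<lambda>x. g x - wint p a F x) \<le> 0 + C * 0"
    by (rule LIMSEQ_le_const) (use le in auto)
  then have "Lnorm p (\<lambda>x. g x - wint p a F x) = 0" using Lnorm_nonneg[of p "\<lambda>x. g x - wint p a F x"] by simp
  then have "AE x in lborel. g x - wint p a F x = 0" using Lnorm_eq_0[OF p1 Lp_diff[OF p1 g(1) wint_Lp[OF F(1)]]] by simp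
  then have "AE x in lborel. g x = wint p a F x" by eventually_elim simp
  then show ?thesis using that F g(1) Lp_measurable by (auto simp: Trep_def)
qed

lemma approx_seq_exists:
  assumes "Trep a p g F"
  shows "\<exists>\<phi>. approx_seq a p \<phi> g"
proof -
  note T = TrepD[OF assms]
  have g: "g \<in> Lp p" by (rule Lp_cong_AE[of "wint p a F"]) (use T wint_Lp in \<open>auto elim: eventually_mono\<close>)
  have "\<forall>n. \<exists>\<phi>. schwartz \<phi> \<and> Lnorm p (\<lambda>x. wderiv p a \<phi> x - F x) < 1 / real (Suc n)"
    by (intro allI wderiv_dense T) simp
  then obtain \<phi> where \<phi>: "\<And>n. schwartz (\<phi> n)" "\<And>n. Lnorm p (\<lambda>x. wderiv p a (\<phi> n) x - F x) < 1 / real (Suc n)" by metis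
  have lim: "(\<lambda>n. Lnorm p (\<lambda>x. wderiv p a (\<phi> n) x - F x)) \<longlonglongrightarrow> 0"
  proof (rule Lim_null_comparison)
    show "(\<lambda>n. 1 / real (Suc n)) \<longlonglongrightarrow> 0" by (rule LIMSEQ_inverse_real_of_nat[unfolded inverse_eq_divide])
    show "eventually (\<lambda>n. norm (Lnorm p (\<lambda>x. wderiv p a (\<phi> n) x - F x)) \<le> 1 / real (Suc n)) sequentially"
      using \<phi>(2) by (intro always_eventually) (auto intro: less_imp_le)
  qed
  obtain C where C: "\<And>F G. F \<in> Lp p \<Longrightarrow> G \<in> Lp p \<Longrightarrow> Lnorm p (\<lambda>x. wint p a F x - wint p a G x) \<le> C * Lnorm p (\<lambda>x. F x - G x)"
    using wint_bounded by blast
  have "approx_seq a p \<phi> g"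
    unfolding approx_seq_iff
  proof (intro conjI allI impI \<phi>(1) g)
    fix e :: real assume e: "e > 0"
    then have "eventually (\<lambda>n. Lnorm p (\<lambda>x. wderiv p a (\<phi> n) x - F x) < e / 2) sequentially"
      using lim by (intro order_tendstoD) auto
    then obtain N where N: "\<And>n. n \<ge> N \<Longrightarrow> Lnorm p (\<lambda>x. wderiv p a (\<phi> n) x - F x) < e / 2" by (auto simp: eventually_sequentially)
    have "Lnorm p (\<lambda>x. wderiv p a (\<phi> m) x - wderiv p a (\<phi> n) x) < e" if "m \<ge> N" "n \<ge> N" for m n
      using N[OF that(1)] N[OF that(2)] Lnorm_triangle3[OF p1 wderiv_Lp[OF \<phi>(1)[of m]] T(2) wderiv_Lp[OF \<phi>(1)[of n]]]
      unfolding Lnorm_minus_commute[OF p1, of F] by linarith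
    then show "\<exists>N. \<forall>m\<ge>N. \<forall>n\<ge>N. Lnorm p (\<lambda>x. wderiv p a (\<phi> m) x - wderiv p a (\<phi> n) x) < e" by blast
  next
    show "(\<lambda>n. Lnorm p (\<lambda>x. \<phi> n x - g x)) \<longlonglongrightarrow> 0"
    proof (rule Lim_null_comparison)
      show "(\<lambda>n. C * Lnorm p (\<lambda>x. wderiv p a (\<phi> n) x - F x)) \<longlonglongrightarrow> 0" using lim by (rule tendsto_mult_right_zero)
      have "Lnorm p (\<lambda>x. \<phi> n x - g x) = Lnorm p (\<lambda>x. wint p a (wderiv p a (\<phi> n)) x - wint p a F x)" for n
      proof (rule Lnorm_cong_AE)
        show "AE x in lborel. \<phi> n x - g x = wint p a (wderiv p a (\<phi> n)) x - wint p a F x"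
          using wint_wderiv[OF \<phi>(1)[of n]] T(3) by eventually_elim simp
      qed (use Lp_measurable[OF Lp_diff[OF p1 schwartz_Lp[OF p1 \<phi>(1)] g]] Lp_measurable[OF Lp_diff[OF p1 wint_Lp[OF wderiv_Lp[OF \<phi>(1)]] wint_Lp[OF T(2)]]] in auto)
      then show "eventually (\<lambda>n. norm (Lnorm p (\<lambda>x. \<phi> n x - g x)) \<le> C * Lnorm p (\<lambda>x. wderiv p a (\<phi> n) x - F x)) sequentially"
        using C[OF wderiv_Lp[OF \<phi>(1)] T(2)] by (intro always_eventually) simp
    qed
  qed
  then show ?thesis by blast
qed

lemma Tsp_iff: "g \<in> Tsp a p \<longleftrightarrow> (\<exists>F. Trep a p g F)"
  unfolding Tsp_def using approx_seq_exists approx_seq_limit by blast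

lemma Trep_unique:
  assumes "Trep a p g F" "Trep a p g G" shows "AE x in lborel. F x = G x"
proof (rule wint_injective)
  show "AE x in lborel. wint p a F x = wint p a G x"
    using TrepD(3)[OF assms(1)] TrepD(3)[OF assms(2)] by eventually_elim simp
qed (use assms in \<open>auto simp: Trep_def\<close>)

text \<open>Independence of the choice made by \<open>SOME\<close>: the weighted derivatives of the
  chosen sequence converge to some representative of g, and injectivity of \<open>wint\<close> makes
  it agree with F almost everywhere.\<close>

lemma Trep_some_approx:
  assumes "Trep a p g F"
  shows "\<And>n. schwartz ((SOME \<phi>. approx_seq a p \<phi> g) n)"
    and "(\<lambda>n. Lnorm p (\<lambda>x. wderiv p a ((SOME \<phi>. approx_seq a p \<phi> g) n) x - F x)) \<longlonglongrightarrow> 0"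
proof -
  define \<phi> where "\<phi> = (SOME \<phi>. approx_seq a p \<phi> g)"
  have ap: "approx_seq a p \<phi> g" unfolding \<phi>_def using approx_seq_exists[OF assms] by (rule someI_ex)
  then have s: "schwartz (\<phi> n)" for n unfolding approx_seq_iff by blast
  then show "\<And>n. schwartz ((SOME \<phi>. approx_seq a p \<phi> g) n)" unfolding \<phi>_def .
  obtain G where G: "Trep a p g G" "(\<lambda>n. Lnorm p (\<lambda>x. wderiv p a (\<phi> n) x - G x)) \<longlonglongrightarrow> 0" using approx_seq_limit[OF ap] by blast
  have "Lnorm p (\<lambda>x. wderiv p a (\<phi> n) x - G x) = Lnorm p (\<lambda>x. wderiv p a (\<phi> n) x - F x)" for n
  proof (rule Lnorm_cong_AE)
    show "AE x in lborel. wderiv p a (\<phi> n) x - G x = wderiv p a (\<phi> n) x - F x"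
      using Trep_unique[OF assms G(1)] by eventually_elim simp
    have "wderiv p a (\<phi> n) \<in> Lp p" using s by (intro wderiv_Lp)
    from Lp_diff[OF p1 this TrepD(2)[OF G(1)]] Lp_diff[OF p1 this TrepD(2)[OF assms]]
    show "(\<lambda>x. wderiv p a (\<phi> n) x - G x) \<in> borel_measurable borel" "(\<lambda>x. wderiv p a (\<phi> n) x - F x) \<in> borel_measurable borel" by auto
  qed
  with G(2) show "(\<lambda>n. Lnorm p (\<lambda>x. wderiv p a ((SOME \<phi>. approx_seq a p \<phi> g) n) x - F x)) \<longlonglongrightarrow> 0"
    by (simp add: \<phi>_def)
qed

lemma Tnorm_rep:
  assumes "Trep a p g F"
  shows "Tnorm a p g = 1 / Gamma (a + 1) * Lnorm p F"
proof -
  note S = Trep_some_approx[OF assms]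
  have "(\<lambda>n. Lnorm p (wderiv p a ((SOME \<phi>. approx_seq a p \<phi> g) n))) \<longlonglongrightarrow> Lnorm p F"
    by (rule Lnorm_tendsto[OF p1 wderiv_Lp[OF S(1)] TrepD(2)[OF assms] S(2)])
  then have "(\<lambda>n. tnorm a p ((SOME \<phi>. approx_seq a p \<phi> g) n)) \<longlonglongrightarrow> 1 / Gamma (a + 1) * Lnorm p F"
    unfolding tnorm_wderiv[OF S(1)] by (rule tendsto_mult_left)
  then show ?thesis unfolding Tnorm_def by (rule limI)
qed

lemma Trep_dil:
  assumes "Trep a p g F" shows "Trep a p (dil p t g) (dil p t F)"
proof -
  note T = TrepD[OF assms]
  have "AE x in lborel. dil p t g x = dil p t (wint p a F) x"
    by (rule dil_cong_AE[OF p1 T(1) Lp_measurable[OF wint_Lp[OF T(2)]] T(3)])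
  then show ?thesis unfolding Trep_def dil_wint using dil_measurable[OF p1 T(1)] dil_Lp[OF p1 T(2)] by blast
qed

lemma Trep_linear:
  assumes "Trep a p f F" "Trep a p g G"
  shows "Trep a p (\<lambda>x. c * f x + d * g x) (\<lambda>x. c * F x + d * G x)"
proof -
  note T = TrepD[OF assms(1)] TrepD[OF assms(2)]
  have "AE x in lborel. c * f x + d * g x = wint p a (\<lambda>x. c * F x + d * G x) x"
    using wint_linear_AE[OF T(2,5), of c d] T(3) T(6) by eventually_elim simp
  then show ?thesis unfolding Trep_def using T by (auto intro!: Lp_add Lp_scale p1)
qed

lemma Trep_diff:
  assumes "Trep a p f F" "Trep a p g G"
  shows "Trep a p (\<lambda>x. f x - g x) (\<lambda>x. F x - G x)"
  using Trep_linear[OF assms, of 1 "-1"] by simp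

lemma Trep_wint: "F \<in> Lp p \<Longrightarrow> Trep a p (wint p a F) F"
  using Lp_measurable[OF wint_Lp] by (auto simp: Trep_def)

lemma Trep_quotient:
  assumes "Trep a p f F" "Trep a p h H"
  shows "Trep a p (\<lambda>s. (dil p t f s - f s) / of_real t - h s) (\<lambda>s. (dil p t F s - F s) / of_real t - H s)"
proof -
  have "Trep a p (\<lambda>x. dil p t f x - f x) (\<lambda>x. dil p t F x - F x)"
    by (rule Trep_diff[OF Trep_dil[OF assms(1)] assms(1)])
  from Trep_linear[OF this assms(2), of "1 / of_real t" "-1"] show ?thesis by simp
qed

section \<open>The generator on the completion\<close>

lemma is_gen_rep:
  assumes "Trep a p f F" "Trep a p h H"
  shows "is_gen a p f h \<longleftrightarrow> Lgen p F H"
proof -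
  have "f \<in> Tsp a p" "h \<in> Tsp a p" using assms Tsp_iff by auto
  moreover have "((\<lambda>t. 1 / Gamma (a + 1) * Lnorm p (\<lambda>s. (dil p t F s - F s) / of_real t - H s)) \<longlongrightarrow> 0) (at 0)
      \<longleftrightarrow> ((\<lambda>t. Lnorm p (\<lambda>s. (dil p t F s - F s) / of_real t - H s)) \<longlongrightarrow> 0) (at 0)"
    using tendsto_mult_left_iff[of "1 / Gamma (a + 1)" "\<lambda>t. Lnorm p (\<lambda>s. (dil p t F s - F s) / of_real t - H s)" 0 "at 0"] Gamma_pos by simp
  ultimately show ?thesis
    unfolding is_gen_def Lgen_def Tnorm_rep[OF Trep_quotient[OF assms]] using TrepD[OF assms(1)] TrepD[OF assms(2)] by simp
qed

lemma is_gen_imp_rep: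
  assumes "is_gen a p f h"
  obtains F H where "Trep a p f F" "Trep a p h H" "Lgen p F H"
proof -
  obtain F H where "Trep a p f F" "Trep a p h H" using assms Tsp_iff by (auto simp: is_gen_def)
  then show ?thesis using that is_gen_rep assms by blast
qed

text \<open>\<open>wint\<close> is bounded and commutes with dilations, so it carries difference
  quotients and their limits along. The generator on the completion is thus a restriction of the one
  on L^p, from which the absence of eigenvectors and the differential formula are inherited.\<close>

lemma is_gen_imp_Lgen:
  assumes "is_gen a p f h" shows "Lgen p f h"
proof -
  obtain F H where T: "Trep a p f F" "Trep a p h H" and G: "Lgen p F H" using is_gen_imp_rep[OF assms] .
  obtain C where C: "\<And>F G. F \<in> Lp p \<Longrightarrow> G \<in> Lp p \<Longrightarrow> Lnorm p (\<lambda>x. wint p a F x - wint p a G x) \<le> C * Lnorm p (\<lambda>x. F x - G x)"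
    using wint_bounded by blast
  note L = LgenD[OF p1 G]
  have wint0: "AE x in lborel. wint p a (\<lambda>x. 0) x = 0"
    using wint_linear_AE[OF L(1,1), of 0 0] by simp
  have "Lnorm p (\<lambda>x. (dil p t (wint p a F) x - wint p a F x) / of_real t - wint p a H x) \<le> C * Lnorm p (\<lambda>x. (dil p t F x - F x) / of_real t - H x)" for t
  proof -
    let ?Q = "\<lambda>x. (dil p t F x - F x) / of_real t - H x"
    have Q: "?Q \<in> Lp p" by (rule Lp_quotient[OF p1 L])
    have "Trep a p (\<lambda>x. (dil p t (wint p a F) x - wint p a F x) / of_real t - wint p a H x) ?Q"
      by (intro Trep_quotient Trep_wint L)
    then have "AE x in lborel. (dil p t (wint p a F) x - wint p a F x) / of_real t - wint p a H x = wint p a ?Q x - wint p a (\<lambda>x. 0) x"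
      using wint0 unfolding Trep_def by (auto elim: eventually_elim2)
    then have "Lnorm p (\<lambda>x. (dil p t (wint p a F) x - wint p a F x) / of_real t - wint p a H x) = Lnorm p (\<lambda>x. wint p a ?Q x - wint p a (\<lambda>x. 0) x)"
      by (rule Lnorm_cong_AE) (use Lp_measurable[OF Lp_quotient[OF p1 wint_Lp[OF L(1)] wint_Lp[OF L(2)]]] Lp_measurable[OF Lp_diff[OF p1 wint_Lp[OF Q] wint_Lp[OF Lp_zero[OF p1]]]] in auto)
    also have "\<dots> \<le> C * Lnorm p (\<lambda>x. ?Q x - 0)" by (rule C[OF Q Lp_zero[OF p1]])
    finally show ?thesis by simp
  qed
  note le = this
  have "((\<lambda>t. Lnorm p (\<lambda>x. (dil p t (wint p a F) x - wint p a F x) / of_real t - wint p a H x)) \<longlongrightarrow> 0) (at 0)"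
  proof (rule Lim_null_comparison)
    show "((\<lambda>t. C * Lnorm p (\<lambda>x. (dil p t F x - F x) / of_real t - H x)) \<longlongrightarrow> 0) (at 0)"
      using G unfolding Lgen_def by (intro tendsto_mult_right_zero) blast
    show "eventually (\<lambda>t. norm (Lnorm p (\<lambda>x. (dil p t (wint p a F) x - wint p a F x) / of_real t - wint p a H x))
        \<le> C * Lnorm p (\<lambda>x. (dil p t F x - F x) / of_real t - H x)) (at 0)"
      using le by (intro always_eventually) simp
  qed
  then have "Lgen p (wint p a F) (wint p a H)" unfolding Lgen_def using wint_Lp L by blast
  then show ?thesis
    by (rule Lgen_cong_AE[OF p1]) (use TrepD[OF T(1)] TrepD[OF T(2)] in \<open>auto elim: eventually_mono\<close>)
qed

end

section \<open>The generator formula and the duality pairing\<close>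

lemma integrable_decay:
  fixes f :: "real \<Rightarrow> complex"
  assumes [measurable]: "f \<in> borel_measurable borel" and bd: "\<And>x. norm (f x) * (1 + x\<^sup>2) \<le> C"
  shows "integrable lborel f"
proof -
  have "f \<in> Lp 1" by (rule Lp_bounded_decay[OF order_refl _ bd]) measurable
  then have "integrable lborel (\<lambda>x. norm (f x))" unfolding Lp_def by simp
  then show ?thesis by (subst (asm) integrable_norm_iff) auto
qed

text \<open>The product rule for \<eta> times x \<phi>, integrated over the line; the boundary terms
  vanish because \<eta> decays quadratically while x \<phi> is bounded.\<close>

lemma schwartz_integration_by_parts:
  assumes \<eta>: "schwartz \<eta>" and \<phi>: "schwartz \<phi>"
  shows "nderiv 1 (\<lambda>x. of_real x * \<phi> x) = (\<lambda>x. \<phi> x + of_real x * nderiv 1 \<phi> x)"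
    and "(LINT x|lborel. monom_deriv 1 \<eta> x * \<phi> x) = - (LINT x|lborel. \<eta> x * nderiv 1 (\<lambda>x. of_real x * \<phi> x) x)"
proof -
  have d\<eta>: "(\<eta> has_vector_derivative nderiv 1 \<eta> x) (at x)" and d\<phi>: "(\<phi> has_vector_derivative nderiv 1 \<phi> x) (at x)" for x
    using schwartz_deriv[OF \<eta>, of 0] schwartz_deriv[OF \<phi>, of 0] by simp_all
  have dx: "(complex_of_real has_vector_derivative 1) (at x)" for x
    using has_vector_derivative_of_real[OF DERIV_ident] by simp
  have dx\<phi>: "((\<lambda>x. of_real x * \<phi> x) has_vector_derivative (\<phi> x + of_real x * nderiv 1 \<phi> x)) (at x)" for x
    using has_vector_derivative_mult[OF dx d\<phi>] by (simp add: add.commute)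
  show n1: "nderiv 1 (\<lambda>x. of_real x * \<phi> x) = (\<lambda>x. \<phi> x + of_real x * nderiv 1 \<phi> x)"
    by (simp add: fun_eq_iff vector_derivative_at[OF dx\<phi>])
  define F where "F x = \<eta> x * (of_real x * \<phi> x)" for x
  define f1 where "f1 x = monom_deriv 1 \<eta> x * \<phi> x" for x
  define f2 where "f2 x = \<eta> x * (\<phi> x + of_real x * nderiv 1 \<phi> x)" for x
  have dF: "(F has_vector_derivative (f1 x + f2 x)) (at x)" for x
    unfolding F_def f1_def f2_def using has_vector_derivative_mult[OF d\<eta> dx\<phi>, of x]
    by (simp add: monom_deriv_def algebra_simps)
  obtain A where A: "0 \<le> A" "\<And>x. norm (\<eta> x) * (1 + x\<^sup>2) \<le> A" using schwartz_decay[OF \<eta>, of 0 0] by auto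
  obtain A1 where A1: "0 \<le> A1" "\<And>x. norm (monom_deriv 1 \<eta> x) * (1 + x\<^sup>2) \<le> A1" using monom_deriv_decay[OF \<eta>] by metis
  obtain B where B: "0 \<le> B" "\<And>x. norm (\<phi> x) * (1 + x\<^sup>2) \<le> B" using schwartz_decay[OF \<phi>, of 0 0] by auto
  obtain B1 where B1: "0 \<le> B1" "\<And>x. norm (monom_deriv 1 \<phi> x) * (1 + x\<^sup>2) \<le> B1" using monom_deriv_decay[OF \<phi>] by metis
  obtain B2 where B2: "\<And>x. \<bar>x\<bar> ^ 1 * norm (nderiv 0 \<phi> x) \<le> B2" using schwartz_bound[OF \<phi>] by metis
  have le: "norm y \<le> D" if "norm y * (1 + x\<^sup>2) \<le> D" for y :: complex and x D :: real
    using that mult_left_mono[of 1 "1 + x\<^sup>2" "norm y"] by simp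
  have [measurable]: "\<eta> \<in> borel_measurable borel" "\<phi> \<in> borel_measurable borel" "nderiv 1 \<phi> \<in> borel_measurable borel" "monom_deriv 1 \<eta> \<in> borel_measurable borel"
    using schwartz_measurable \<eta> \<phi> schwartz_nderiv_measurable[OF \<phi>, of 1] monom_deriv_measurable[OF \<eta>, of 1] by auto
  have i1: "integrable lborel f1"
  proof (rule integrable_decay)
    show "f1 \<in> borel_measurable borel" unfolding f1_def by measurable
    fix x
    have "norm (f1 x) * (1 + x\<^sup>2) = norm (monom_deriv 1 \<eta> x) * (1 + x\<^sup>2) * norm (\<phi> x)" by (simp add: f1_def norm_mult)
    also have "\<dots> \<le> A1 * B" using A1 le[OF B(2)[of x]] by (intro mult_mono) auto
    finally show "norm (f1 x) * (1 + x\<^sup>2) \<le> A1 * B" .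
  qed
  have i2: "integrable lborel f2"
  proof (rule integrable_decay)
    show "f2 \<in> borel_measurable borel" unfolding f2_def by measurable
    fix x
    have "norm (\<phi> x + of_real x * nderiv 1 \<phi> x) \<le> B + B1"
      using norm_triangle_ineq[of "\<phi> x" "monom_deriv 1 \<phi> x"] le[OF B(2)[of x]] le[OF B1(2)[of x]] by (simp add: monom_deriv_def)
    then have "norm (\<eta> x) * (1 + x\<^sup>2) * norm (\<phi> x + of_real x * nderiv 1 \<phi> x) \<le> A * (B + B1)"
      using A by (intro mult_mono) auto
    then show "norm (f2 x) * (1 + x\<^sup>2) \<le> A * (B + B1)" by (simp add: f2_def norm_mult mult_ac)
  qed
  have lim: "(F \<longlongrightarrow> 0) G" if "((\<lambda>x. inverse (1 + x\<^sup>2)) \<longlongrightarrow> (0::real)) G" for G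
  proof (rule Lim_null_comparison)
    show "((\<lambda>x. A * B2 * inverse (1 + x\<^sup>2)) \<longlongrightarrow> 0) G" by (rule tendsto_mult_right_zero[OF that])
    have "norm (F x) \<le> A * B2 * inverse (1 + x\<^sup>2)" for x
    proof -
      have pos: "1 + x\<^sup>2 > 0" by (simp add: add_pos_nonneg)
      have "norm (F x) * (1 + x\<^sup>2) = norm (\<eta> x) * (1 + x\<^sup>2) * (\<bar>x\<bar> * norm (\<phi> x))" by (simp add: F_def norm_mult)
      also have "\<dots> \<le> A * B2" using A B2[of x] by (intro mult_mono) auto
      finally show ?thesis using pos by (simp add: field_simps)
    qed
    then show "eventually (\<lambda>x. norm (F x) \<le> A * B2 * inverse (1 + x\<^sup>2)) G" by simp
  qed
  have cont: "isCont (\<lambda>x. f1 x + f2 x) x" for x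
  proof -
    have "continuous_on UNIV (\<lambda>x. f1 x + f2 x)"
      using schwartz_nderiv_continuous[OF \<eta>, of UNIV 0] schwartz_nderiv_continuous[OF \<phi>, of UNIV 0]
      unfolding f1_def f2_def monom_deriv_def
      by (intro continuous_intros schwartz_nderiv_continuous \<eta> \<phi>) auto
    then show ?thesis by (simp add: continuous_on_eq_continuous_at)
  qed
  have e: "einterval (- \<infinity>) \<infinity> = (UNIV :: real set)" by (auto simp: einterval_def)
  have "(LBINT x=- \<infinity>..\<infinity>. f1 x + f2 x) = 0 - 0"
  proof (rule interval_integral_FTC_integrable[where F=F])
    have "((\<lambda>x::real. inverse (1 + x\<^sup>2)) \<longlongrightarrow> 0) at_bot" "((\<lambda>x::real. inverse (1 + x\<^sup>2)) \<longlongrightarrow> 0) at_top"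
      by real_asymp+
    then show "((F \<circ> real_of_ereal) \<longlongrightarrow> 0) (at_right (- \<infinity>))" "((F \<circ> real_of_ereal) \<longlongrightarrow> 0) (at_left \<infinity>)"
      unfolding ereal_tendsto_simps using lim by auto
    show "set_integrable lborel (einterval (- \<infinity>) \<infinity>) (\<lambda>x. f1 x + f2 x)"
      unfolding e set_integrable_def using i1 i2 by simp
  qed (use dF cont in auto)
  then have "(LINT x|lborel. f1 x + f2 x) = 0"
    by (simp add: interval_lebesgue_integral_def e set_lebesgue_integral_def)
  then have "(LINT x|lborel. f1 x) = - (LINT x|lborel. f2 x)" using i1 i2 by (simp add: eq_neg_iff_add_eq_0)
  then show "(LINT x|lborel. monom_deriv 1 \<eta> x * \<phi> x) = - (LINT x|lborel. \<eta> x * nderiv 1 (\<lambda>x. of_real x * \<phi> x) x)"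
    unfolding n1 f1_def f2_def .
qed

text \<open>Jensen's inequality with the integrable weight 1/(1 + x^2), which dominates \<psi> up to
  C. No conjugate exponent appears, so p = 1 is covered.\<close>

lemma pairing_bounded:
  assumes p1: "1 \<le> p" and [measurable]: "\<psi> \<in> borel_measurable borel" and \<psi>: "\<And>x. norm (\<psi> x) * (1 + x\<^sup>2) \<le> C"
  shows "\<exists>K. \<forall>g\<in>Lp p. integrable lborel (\<lambda>x. g x * \<psi> x) \<and> norm (LINT x|lborel. g x * \<psi> x) \<le> K * Lnorm p g"
proof -
  define w where "w x = inverse (1 + x\<^sup>2)" for x :: real
  have w0: "0 \<le> w x" "w x \<le> 1" for x
    unfolding w_def by (auto simp: add_nonneg_nonneg intro!: inverse_le_1_iff[THEN iffD2])
  have wi: "integrable lborel w" unfolding w_def by (rule integrable_inverse_1_plus_square)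
  have [measurable]: "w \<in> borel_measurable borel" unfolding w_def by measurable
  have C0: "0 \<le> C" using \<psi>[of 0] by (rule order_trans[rotated]) simp
  have \<psi>w: "norm (\<psi> x) \<le> C * w x" for x
  proof -
    have "1 + x\<^sup>2 > 0" by (simp add: add_pos_nonneg)
    then show ?thesis using \<psi>[of x] by (simp add: w_def field_simps)
  qed
  define A where "A = (LINT x|lborel. w x) powr (p - 1)"
  have A0: "0 \<le> A" by (simp add: A_def)
  have "integrable lborel (\<lambda>x. g x * \<psi> x) \<and> norm (LINT x|lborel. g x * \<psi> x) \<le> C * A powr (1 / p) * Lnorm p g" if g: "g \<in> Lp p" for g
  proof -
    note [measurable] = g[THEN Lp_measurable]
    have gp: "integrable lborel (\<lambda>x. w x * norm (g x) powr p)"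
    proof (rule Bochner_Integration.integrable_bound[OF Lp_integrable[OF g]])
      show "AE x in lborel. norm (w x * norm (g x) powr p) \<le> norm (norm (g x) powr p)"
        using w0 by (intro AE_I2) (auto simp: abs_mult intro!: mult_left_le_one_le)
    qed simp
    note j = jensen_powr[OF p1, of lborel w "\<lambda>x. norm (g x)", OF wi w0(1) _ _ gp]
    have i: "integrable lborel (\<lambda>x. w x * norm (g x))" by (rule j(1)) auto
    have "(LINT x|lborel. w x * norm (g x)) powr p \<le> A * (LINT x|lborel. w x * norm (g x) powr p)"
      unfolding A_def by (rule j(2)) auto
    also have "\<dots> \<le> A * (LINT x|lborel. norm (g x) powr p)"
      using A0 by (intro mult_left_mono integral_mono gp Lp_integrable[OF g]) (use w0 in \<open>auto intro!: mult_left_le_one_le\<close>)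
    also have "\<dots> = (A powr (1 / p) * Lnorm p g) powr p"
      using p1 A0 by (simp add: powr_mult powr_powr Lnorm_powr[OF p1])
    finally have le: "(LINT x|lborel. w x * norm (g x)) \<le> A powr (1 / p) * Lnorm p g"
      using p1 w0 powr_less_mono2[of p "A powr (1 / p) * Lnorm p g" "LINT x|lborel. w x * norm (g x)"] by (force simp: not_le[symmetric])
    have bd: "norm (g x * \<psi> x) \<le> C * (w x * norm (g x))" for x
      using mult_left_mono[OF \<psi>w[of x], of "norm (g x)"] by (simp add: norm_mult mult_ac)
    have ci: "integrable lborel (\<lambda>x. C * (w x * norm (g x)))" using i by simp
    have int: "integrable lborel (\<lambda>x. g x * \<psi> x)"
      by (rule Bochner_Integration.integrable_bound[OF ci]) (use bd in \<open>auto intro!: AE_I2 order_trans[OF bd]\<close>)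
    have "norm (LINT x|lborel. g x * \<psi> x) \<le> (LINT x|lborel. C * (w x * norm (g x)))"
      by (rule order_trans[OF integral_norm_bound]) (intro integral_mono int[THEN integrable_norm] ci bd)
    also have "\<dots> = C * (LINT x|lborel. w x * norm (g x))" by simp
    also have "\<dots> \<le> C * (A powr (1 / p) * Lnorm p g)" using le C0 by (intro mult_left_mono)
    finally show ?thesis using int by (simp add: mult.assoc)
  qed
  then show ?thesis by blast
qed

lemma pairing_tendsto:
  assumes p1: "1 \<le> p" and \<psi>: "\<psi> \<in> borel_measurable borel" "\<And>x. norm (\<psi> x) * (1 + x\<^sup>2) \<le> C"
    and g: "\<And>n::nat. g n \<in> Lp p" and h: "h \<in> Lp p" and lim: "(\<lambda>n. Lnorm p (\<lambda>x. g n x - h x)) \<longlonglongrightarrow> 0"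
  shows "(\<lambda>n. LINT x|lborel. g n x * \<psi> x) \<longlonglongrightarrow> (LINT x|lborel. h x * \<psi> x)"
proof -
  obtain K where K: "\<And>g. g \<in> Lp p \<Longrightarrow> integrable lborel (\<lambda>x. g x * \<psi> x)" "\<And>g. g \<in> Lp p \<Longrightarrow> norm (LINT x|lborel. g x * \<psi> x) \<le> K * Lnorm p g"
    using pairing_bounded[OF p1 \<psi>] by blast
  have "(\<lambda>n. (LINT x|lborel. g n x * \<psi> x) - (LINT x|lborel. h x * \<psi> x)) \<longlonglongrightarrow> 0"
  proof (rule Lim_null_comparison)
    show "(\<lambda>n. K * Lnorm p (\<lambda>x. g n x - h x)) \<longlonglongrightarrow> 0" by (rule tendsto_mult_right_zero[OF lim])
    have "norm ((LINT x|lborel. g n x * \<psi> x) - (LINT x|lborel. h x * \<psi> x)) \<le> K * Lnorm p (\<lambda>x. g n x - h x)" for n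
      using K(2)[OF Lp_diff[OF p1 g h], of n] K(1)[OF g[of n]] K(1)[OF h] by (simp add: left_diff_distrib)
    then show "eventually (\<lambda>n. norm ((LINT x|lborel. g n x * \<psi> x) - (LINT x|lborel. h x * \<psi> x)) \<le> K * Lnorm p (\<lambda>x. g n x - h x)) sequentially"
      by simp
  qed
  then show ?thesis by (rule LIM_zero_cancel)
qed

text \<open>With k = h + f/p, the function f is the order-1 average of k with weight 0, and k is a
  limit of functions x \<eta>', whose averages are -\<eta>. For Schwartz \<eta> the identity is
  integration by parts, and both sides pass to the limit.\<close>

lemma Lgen_formula:
  assumes p1: "1 \<le> p" and G: "Lgen p f h"
  shows "gen_formula p f h"
  unfolding gen_formula_def
proof (intro allI impI)
  fix \<phi> assume \<phi>: "schwartz \<phi>"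
  note L = LgenD[OF p1 G]
  define k where "k x = h x + f x / complex_of_real p" for x
  have k: "k \<in> Lp p" unfolding k_def by (intro Lp_add Lp_divide p1 L)
  \<comment> \<open>The resolvent point that belongs to order 1 and weight 0; for it, z f - h =
    -k.\<close>
  define z where "z = - complex_of_real (0 + 1 / p)"
  have z: "Re z \<noteq> 0" using p1 by (simp add: z_def)
  have zk: "z * f x - h x = (-1) * k x" for x by (simp add: z_def k_def)
  have fk: "AE x in lborel. f x = EK p 1 0 k x"
    using Lgen_inverse[OF p1 z G] unfolding EK_1[OF p1 order_refl] z_def[symmetric] zk conv_scale by simp
  have "k \<in> Lcl p (monom_deriv 1 ` Collect schwartz)" using k monom_deriv_dense[OF p1] by simp
  then have "\<exists>\<eta>. schwartz \<eta> \<and> Lnorm p (\<lambda>x. k x - monom_deriv 1 \<eta> x) < 1 / real (Suc n)" for n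
    unfolding Lcl_def by (auto dest!: spec[of _ "1 / real (Suc n)"])
  then obtain \<eta> where \<eta>: "\<And>n. schwartz (\<eta> n)" "\<And>n. Lnorm p (\<lambda>x. k x - monom_deriv 1 (\<eta> n) x) < 1 / real (Suc n)" by metis
  have lim1: "(\<lambda>n. Lnorm p (\<lambda>x. monom_deriv 1 (\<eta> n) x - k x)) \<longlonglongrightarrow> 0"
  proof (rule Lim_null_comparison)
    show "(\<lambda>n. 1 / real (Suc n)) \<longlonglongrightarrow> 0" by (rule LIMSEQ_inverse_real_of_nat[unfolded inverse_eq_divide])
    show "eventually (\<lambda>n. norm (Lnorm p (\<lambda>x. monom_deriv 1 (\<eta> n) x - k x)) \<le> 1 / real (Suc n)) sequentially"
      using \<eta>(2) by (intro always_eventually) (auto intro: less_imp_le simp: Lnorm_minus_commute[OF p1, of _ k])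
  qed
  have mL: "monom_deriv 1 (\<eta> n) \<in> Lp p" for n by (rule monom_deriv_Lp[OF p1 \<eta>(1)])
  define c where "c = (LINT t|lborel. norm (complex_of_real (eker 1 (0 + 1 / p) t)))"
  have lim2: "(\<lambda>n. Lnorm p (\<lambda>x. (-1) * \<eta> n x - f x)) \<longlonglongrightarrow> 0"
  proof (rule Lim_null_comparison)
    show "(\<lambda>n. c * Lnorm p (\<lambda>x. monom_deriv 1 (\<eta> n) x - k x)) \<longlonglongrightarrow> 0" by (rule tendsto_mult_right_zero[OF lim1])
    have "Lnorm p (\<lambda>x. (-1) * \<eta> n x - f x) \<le> c * Lnorm p (\<lambda>x. monom_deriv 1 (\<eta> n) x - k x)" for n
    proof -
      have "AE x in lborel. (-1) * \<eta> n x - f x = EK p 1 0 (monom_deriv 1 (\<eta> n)) x - EK p 1 0 k x"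
        using fk EK_1_monom_deriv[OF p1 \<eta>(1)[of n], of 0] by (auto simp: monom_deriv_def[of 0] elim!: eventually_elim2)
      then have "Lnorm p (\<lambda>x. (-1) * \<eta> n x - f x) = Lnorm p (\<lambda>x. EK p 1 0 (monom_deriv 1 (\<eta> n)) x - EK p 1 0 k x)"
        by (rule Lnorm_cong_AE[OF _ Lp_measurable[OF Lp_diff[OF p1 Lp_scale[OF p1 schwartz_Lp[OF p1 \<eta>(1)]] L(1)]]
           Lp_measurable[OF Lp_diff[OF p1 EK_Lp[OF p1 zero_less_one order_refl mL] EK_Lp[OF p1 zero_less_one order_refl k]]]])
      also have "\<dots> \<le> c * Lnorm p (\<lambda>x. monom_deriv 1 (\<eta> n) x - k x)"
        unfolding EK_def c_def by (rule Lnorm_conv_diff[OF p1 ek_integrable[OF p1] mL k]) auto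
      finally show ?thesis .
    qed
    then show "eventually (\<lambda>n. norm (Lnorm p (\<lambda>x. (-1) * \<eta> n x - f x)) \<le> c * Lnorm p (\<lambda>x. monom_deriv 1 (\<eta> n) x - k x)) sequentially"
      by (intro always_eventually) simp
  qed
  define \<psi> where "\<psi> = nderiv 1 (\<lambda>x. complex_of_real x * \<phi> x)"
  have \<psi>: "\<psi> = (\<lambda>x. \<phi> x + monom_deriv 1 \<phi> x)"
    unfolding \<psi>_def schwartz_integration_by_parts(1)[OF \<phi> \<phi>] by (simp add: monom_deriv_def)
  obtain B where B: "\<And>x. norm (\<phi> x) * (1 + x\<^sup>2) \<le> B" using schwartz_decay[OF \<phi>, of 0 0] by auto
  obtain B1 where B1: "\<And>x. norm (monom_deriv 1 \<phi> x) * (1 + x\<^sup>2) \<le> B1" using monom_deriv_decay[OF \<phi>] by metis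
  have \<psi>b: "norm (\<psi> x) * (1 + x\<^sup>2) \<le> B + B1" for x
  proof -
    have "norm (\<psi> x) * (1 + x\<^sup>2) \<le> (norm (\<phi> x) + norm (monom_deriv 1 \<phi> x)) * (1 + x\<^sup>2)"
      unfolding \<psi> by (intro mult_right_mono norm_triangle_ineq) auto
    then show ?thesis using B[of x] B1[of x] by (simp add: distrib_right)
  qed
  have \<psi>m: "\<psi> \<in> borel_measurable borel"
    unfolding \<psi> using schwartz_measurable[OF \<phi>] monom_deriv_measurable[OF \<phi>, of 1] by measurable
  have c1: "(\<lambda>n. LINT x|lborel. monom_deriv 1 (\<eta> n) x * \<phi> x) \<longlonglongrightarrow> (LINT x|lborel. k x * \<phi> x)"
    by (rule pairing_tendsto[OF p1 schwartz_measurable[OF \<phi>] B mL k lim1])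
  have c2: "(\<lambda>n. LINT x|lborel. (-1) * \<eta> n x * \<psi> x) \<longlonglongrightarrow> (LINT x|lborel. f x * \<psi> x)"
    by (rule pairing_tendsto[OF p1 \<psi>m \<psi>b Lp_scale[OF p1 schwartz_Lp[OF p1 \<eta>(1)]] L(1) lim2])
  have "(LINT x|lborel. monom_deriv 1 (\<eta> n) x * \<phi> x) = (LINT x|lborel. (-1) * \<eta> n x * \<psi> x)" for n
    using schwartz_integration_by_parts(2)[OF \<eta>(1) \<phi>, of n] by (simp add: \<psi>_def)
  then have "(LINT x|lborel. k x * \<phi> x) = (LINT x|lborel. f x * \<psi> x)" using c1 c2 by (simp add: LIMSEQ_unique)
  then show "(LINT s|lborel. (h s + f s / complex_of_real p) * \<phi> s) = (LINT s|lborel. f s * nderiv 1 (\<lambda>x. complex_of_real x * \<phi> x) s)"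
    by (simp add: k_def \<psi>_def)
qed

section \<open>The bilinear pairing and the adjoint of a dilation\<close>

text \<open>Young's inequality bounds the integral by a sum; applied to F and G scaled to norm 1, it
  becomes Hoelder's inequality.\<close>

lemma Lp_Lq_pairing:
  assumes p: "1 < p" and q: "1 < q" and pq: "1 / p + 1 / q = 1" and F: "F \<in> Lp p" and G: "G \<in> Lp q"
  shows "integrable lborel (\<lambda>x. F x * G x)"
    and "norm (LINT x|lborel. F x * G x) \<le> Lnorm p F * Lnorm q G"
proof -
  note [measurable] = F[THEN Lp_measurable] G[THEN Lp_measurable]
  have p1: "1 \<le> p" and q1: "1 \<le> q" using p q by auto
  have gi: "integrable lborel (\<lambda>x. F x * G x) \<and> norm (LINT x|lborel. F x * G x) \<le> Lnorm p F powr p / p + Lnorm q G powr q / q"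
    if F: "F \<in> Lp p" and G: "G \<in> Lp q" for F G
  proof -
    note [measurable] = F[THEN Lp_measurable] G[THEN Lp_measurable]
    have i: "integrable lborel (\<lambda>x. norm (F x) powr p / p + norm (G x) powr q / q)"
      using Lp_integrable[OF F] Lp_integrable[OF G] by simp
    have bd: "norm (F x * G x) \<le> norm (F x) powr p / p + norm (G x) powr q / q" for x
      unfolding norm_mult by (rule Youngs_inequality[OF p q pq]) auto
    have int: "integrable lborel (\<lambda>x. F x * G x)"
      by (rule Bochner_Integration.integrable_bound[OF i]) (auto intro!: AE_I2 order_trans[OF bd])
    have "norm (LINT x|lborel. F x * G x) \<le> (LINT x|lborel. norm (F x) powr p / p + norm (G x) powr q / q)"
      by (rule order_trans[OF integral_norm_bound]) (intro integral_mono int[THEN integrable_norm] i bd)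
    then show ?thesis using int Lp_integrable[OF F] Lp_integrable[OF G] by (simp add: Lnorm_powr[OF p1] Lnorm_powr[OF q1])
  qed
  show "integrable lborel (\<lambda>x. F x * G x)" using gi[OF F G] by blast
  define A B where "A = Lnorm p F" and "B = Lnorm q G"
  show "norm (LINT x|lborel. F x * G x) \<le> Lnorm p F * Lnorm q G"
  proof (cases "A = 0 \<or> B = 0")
    case True
    then have "AE x in lborel. F x * G x = 0"
      using Lnorm_eq_0[OF p1 F] Lnorm_eq_0[OF q1 G] unfolding A_def B_def by (auto elim: eventually_mono)
    then have "(LINT x|lborel. F x * G x) = (LINT x::real|lborel. (0::complex))" by (intro integral_cong_AE) auto
    then show ?thesis by simp
  next
    case False
    then have AB: "A > 0" "B > 0" using Lnorm_nonneg[of p F] Lnorm_nonneg[of q G] unfolding A_def B_def by linarith+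
    have "norm (LINT x|lborel. (F x / of_real A) * (G x / of_real B)) \<le> 1 powr p / p + 1 powr q / q"
      using gi[OF Lp_divide[OF p1 F, of "of_real A"] Lp_divide[OF q1 G, of "of_real B"]] AB
      by (simp add: Lnorm_divide[OF p1] Lnorm_divide[OF q1] A_def[symmetric] B_def[symmetric])
    also have "\<dots> = 1" using pq by simp
    also have "(LINT x|lborel. (F x / of_real A) * (G x / of_real B)) = (LINT x|lborel. F x * G x) / of_real (A * B)" by simp
    finally have "norm (LINT x|lborel. F x * G x) / (A * B) \<le> 1" using AB by (simp add: norm_divide norm_mult)
    then show ?thesis using AB by (simp add: A_def B_def divide_le_eq)
  qed
qed

lemma phase_square_Lp: "1 \<le> p \<Longrightarrow> F \<in> Lp p \<Longrightarrow> (\<lambda>x. (phase a x)\<^sup>2 * F x) \<in> Lp p"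
  by (rule Lp_bound[of F p _ 1]) (auto simp: norm_mult norm_power intro!: Lp_measurable)

lemma Lnorm_phase_square: "Lnorm p (\<lambda>x. (phase a x)\<^sup>2 * F x) = Lnorm p F"
  by (simp add: Lnorm_def norm_mult norm_power)

text \<open>The pairing has no conjugation, so the two phases multiply to a square instead of
  cancelling. Attached to F, the square is a factor of modulus 1, and Hoelder's inequality passes to
  the limit in both arguments.\<close>

lemma Tpair_rep:
  assumes p: "1 < p" and q: "1 < q" and pq: "1 / p + 1 / q = 1" and a0: "0 \<le> a"
    and f: "Trep a p f F" and g: "Trep a q g G"
  shows "Tpair a p q f g = of_real (1 / (Gamma (a + 1))\<^sup>2) * (LINT x|lborel. ((phase a x)\<^sup>2 * F x) * G x)"
proof -
  have p1: "1 \<le> p" and q1: "1 \<le> q" using p q by auto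
  define \<phi> where "\<phi> = (SOME \<phi>. approx_seq a p \<phi> f)"
  define \<psi> where "\<psi> = (SOME \<psi>. approx_seq a q \<psi> g)"
  have s: "schwartz (\<phi> n)" "schwartz (\<psi> n)" for n
    unfolding \<phi>_def \<psi>_def using Trep_some_approx(1)[OF p1 a0 f] Trep_some_approx(1)[OF q1 a0 g] by auto
  define Fn where "Fn n x = (phase a x)\<^sup>2 * wderiv p a (\<phi> n) x" for n x
  define Gn where "Gn n = wderiv q a (\<psi> n)" for n
  define F' where "F' x = (phase a x)\<^sup>2 * F x" for x
  have FL: "Fn n \<in> Lp p" "Gn n \<in> Lp q" "F' \<in> Lp p" "G \<in> Lp q" for n
    unfolding Fn_def Gn_def F'_def using TrepD(2)[OF f] TrepD(2)[OF g] s
    by (auto intro!: phase_square_Lp wderiv_Lp p1 q1 a0)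
  have "(\<lambda>n. Lnorm p (\<lambda>x. (phase a x)\<^sup>2 * (wderiv p a (\<phi> n) x - F x))) \<longlonglongrightarrow> 0"
    unfolding Lnorm_phase_square \<phi>_def by (rule Trep_some_approx(2)[OF p1 a0 f])
  then have lF: "(\<lambda>n. Lnorm p (\<lambda>x. Fn n x - F' x)) \<longlonglongrightarrow> 0" by (simp add: Fn_def F'_def right_diff_distrib)
  have lG: "(\<lambda>n. Lnorm q (\<lambda>x. Gn n x - G x)) \<longlonglongrightarrow> 0"
    unfolding Gn_def \<psi>_def by (rule Trep_some_approx(2)[OF q1 a0 g])
  have tp: "tpair0 a (\<phi> n) (\<psi> n) = of_real (1 / (Gamma (a + 1))\<^sup>2) * (LINT x|lborel. Fn n x * Gn n x)" for n
  proof -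
    have "(LINT t|lborel. weyl0 a (\<phi> n) t * weyl0 a (\<psi> n) t * complex_of_real (\<bar>t\<bar> powr (2 * a))) = (LINT x|lborel. Fn n x * Gn n x)"
    proof (rule integral_discrete_difference[where X="{0}"])
      fix t :: real assume "t \<notin> {0}"
      then have t: "t \<noteq> 0" by simp
      have "\<bar>t\<bar> powr (2 * a) = \<bar>t\<bar> powr a * \<bar>t\<bar> powr a" by (simp flip: powr_add)
      then have "weyl0 a (\<phi> n) t * weyl0 a (\<psi> n) t * complex_of_real (\<bar>t\<bar> powr (2 * a))
         = (weyl0 a (\<phi> n) t * of_real (\<bar>t\<bar> powr a)) * (weyl0 a (\<psi> n) t * of_real (\<bar>t\<bar> powr a))" by simp
      also have "\<dots> = (phase a t * wderiv p a (\<phi> n) t) * (phase a t * wderiv q a (\<psi> n) t)"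
        unfolding weyl0_wderiv[OF p1 s(1) a0 t] weyl0_wderiv[OF q1 s(2) a0 t] ..
      finally show "weyl0 a (\<phi> n) t * weyl0 a (\<psi> n) t * complex_of_real (\<bar>t\<bar> powr (2 * a)) = Fn n t * Gn n t"
        by (simp add: Fn_def Gn_def power2_eq_square)
    qed auto
    then show ?thesis by (simp add: tpair0_def)
  qed
  have "(\<lambda>n. (LINT x|lborel. Fn n x * Gn n x) - (LINT x|lborel. F' x * G x)) \<longlonglongrightarrow> 0"
  proof (rule Lim_null_comparison)
    have "(\<lambda>n. Lnorm q (Gn n)) \<longlonglongrightarrow> Lnorm q G" by (rule Lnorm_tendsto[OF q1 FL(2) FL(4) lG])
    then have "(\<lambda>n. Lnorm p (\<lambda>x. Fn n x - F' x) * Lnorm q (Gn n) + Lnorm p F' * Lnorm q (\<lambda>x. Gn n x - G x)) \<longlonglongrightarrow> 0 * Lnorm q G + Lnorm p F' * 0"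
      by (intro tendsto_intros lF lG)
    then show "(\<lambda>n. Lnorm p (\<lambda>x. Fn n x - F' x) * Lnorm q (Gn n) + Lnorm p F' * Lnorm q (\<lambda>x. Gn n x - G x)) \<longlonglongrightarrow> 0" by simp
    have "norm ((LINT x|lborel. Fn n x * Gn n x) - (LINT x|lborel. F' x * G x))
        \<le> Lnorm p (\<lambda>x. Fn n x - F' x) * Lnorm q (Gn n) + Lnorm p F' * Lnorm q (\<lambda>x. Gn n x - G x)" for n
    proof -
      note H = Lp_Lq_pairing[OF p q pq]
      note D = Lp_diff[OF p1 FL(1)[of n] FL(3)] Lp_diff[OF q1 FL(2)[of n] FL(4)]
      have "(LINT x|lborel. Fn n x * Gn n x) - (LINT x|lborel. F' x * G x) = (LINT x|lborel. Fn n x * Gn n x - F' x * G x)"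
        using H(1)[OF FL(1)[of n] FL(2)[of n]] H(1)[OF FL(3) FL(4)] by simp
      also have "\<dots> = (LINT x|lborel. (Fn n x - F' x) * Gn n x + F' x * (Gn n x - G x))"
        by (intro Bochner_Integration.integral_cong) (auto simp: algebra_simps)
      also have "\<dots> = (LINT x|lborel. (Fn n x - F' x) * Gn n x) + (LINT x|lborel. F' x * (Gn n x - G x))"
        by (rule Bochner_Integration.integral_add[OF H(1)[OF D(1) FL(2)] H(1)[OF FL(3) D(2)]])
      finally have eq: "(LINT x|lborel. Fn n x * Gn n x) - (LINT x|lborel. F' x * G x)
        = (LINT x|lborel. (Fn n x - F' x) * Gn n x) + (LINT x|lborel. F' x * (Gn n x - G x))" .
      show ?thesis unfolding eq
        by (rule order_trans[OF norm_triangle_ineq add_mono[OF H(2)[OF D(1) FL(2)] H(2)[OF FL(3) D(2)]]])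
    qed
    then show "eventually (\<lambda>n. norm ((LINT x|lborel. Fn n x * Gn n x) - (LINT x|lborel. F' x * G x))
        \<le> Lnorm p (\<lambda>x. Fn n x - F' x) * Lnorm q (Gn n) + Lnorm p F' * Lnorm q (\<lambda>x. Gn n x - G x)) sequentially" by simp
  qed
  then have "(\<lambda>n. LINT x|lborel. Fn n x * Gn n x) \<longlonglongrightarrow> (LINT x|lborel. F' x * G x)" by (rule LIM_zero_cancel)
  then have "(\<lambda>n. tpair0 a (\<phi> n) (\<psi> n)) \<longlonglongrightarrow> of_real (1 / (Gamma (a + 1))\<^sup>2) * (LINT x|lborel. F' x * G x)"
    unfolding tp by (rule tendsto_mult_left)
  then show ?thesis unfolding Tpair_def \<phi>_def[symmetric] \<psi>_def[symmetric] F'_def by (rule limI)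
qed

text \<open>The substitution x -> e^t x contributes e^t, and e^t e^(-t/p) = e^(t/q) is the prefactor
  of T_(-t) on L^q. The phase is unchanged because e^t x has the sign of x.\<close>

lemma dil_adjoint:
  assumes pq: "1 / p + 1 / q = 1"
  shows "(LINT x|lborel. ((phase a x)\<^sup>2 * dil p t F x) * G x) = (LINT x|lborel. ((phase a x)\<^sup>2 * F x) * dil q (- t) G x)"
proof -
  have e: "exp t * exp (- t / p) = exp (t / q)"
  proof -
    have "t + - t / p = t * (1 - 1 / p)" by (simp add: algebra_simps)
    also have "1 - 1 / p = 1 / q" using pq by simp
    finally show ?thesis by (simp flip: exp_add)
  qed
  have ph: "phase a (exp t * x) = phase a x" for x by (simp add: phase_def zero_less_mult_iff)
  have "(LINT x|lborel. ((phase a x)\<^sup>2 * dil p t F x) * G x)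
      = exp t *\<^sub>R (LINT x|lborel. ((phase a (exp t * x))\<^sup>2 * dil p t F (exp t * x)) * G (exp t * x))"
    using lborel_integral_real_affine[of "exp t" "\<lambda>x. ((phase a x)\<^sup>2 * dil p t F x) * G x" 0] by simp
  also have "\<dots> = (LINT x|lborel. exp t *\<^sub>R (((phase a (exp t * x))\<^sup>2 * dil p t F (exp t * x)) * G (exp t * x)))" by simp
  also have "\<dots> = (LINT x|lborel. ((phase a x)\<^sup>2 * F x) * dil q (- t) G x)"
  proof (rule Bochner_Integration.integral_cong[OF refl])
    fix x
    have x: "exp (- t) * (exp t * x) = x" by (simp add: mult.assoc[symmetric] flip: exp_add)
    have "exp t *\<^sub>R (((phase a (exp t * x))\<^sup>2 * dil p t F (exp t * x)) * G (exp t * x))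
        = ((phase a x)\<^sup>2 * F x) * (of_real (exp t * exp (- t / p)) * G (exp t * x))"
      unfolding ph dil_def x by (simp add: scaleR_conv_of_real mult_ac)
    then show "exp t *\<^sub>R (((phase a (exp t * x))\<^sup>2 * dil p t F (exp t * x)) * G (exp t * x)) = ((phase a x)\<^sup>2 * F x) * dil q (- t) G x"
      unfolding e by (simp add: dil_def)
  qed
  finally show ?thesis .
qed

section \<open>Domain, group property, spectrum and duality\<close>

lemma wint_plus_1:
  assumes p1: "1 \<le> p" and a0: "0 \<le> a" and G: "G \<in> Lp p"
  shows "AE x in lborel. wint p (a + 1) G x = wint p a (EK p 1 a G) x"
proof (cases "a = 0")
  case False
  have "AE x in lborel. EK p a 0 (EK p 1 (0 + a) G) x = EK p (a + 1) 0 G x"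
    using False a0 by (intro EK_EK[OF p1 _ _ _ G]) auto
  then show ?thesis using False a0 unfolding wint_def by (auto elim!: eventually_mono)
qed (simp add: wint_def)

lemma gen_domain_eq:
  assumes p1: "1 \<le> p" and a0: "0 \<le> a"
  shows "gen_domain a p = Tsp (a + 1) p"
proof (intro equalityI subsetI)
  have a1: "0 \<le> a + 1" using a0 by simp
  fix f assume "f \<in> gen_domain a p"
  then obtain h where "is_gen a p f h" by (auto simp: gen_domain_def)
  then obtain F H where F: "Trep a p f F" and G: "Lgen p F H" using is_gen_imp_rep[OF p1 a0] by metis
  \<comment> \<open>The domain on L^p lies in the range of the order-1 average of any weight \<nu>
    >= 0; weight a is taken because it composes with \<open>wint p a\<close> to order a + 1.\<close>
  obtain K where K: "K \<in> Lp p" "AE x in lborel. F x = EK p 1 a K x" using Lgen_imp_EK_1[OF p1 a0 G] by blast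
  have EL: "EK p 1 a K \<in> Lp p" by (rule EK_Lp[OF p1 zero_less_one a0 K(1)])
  have "AE x in lborel. wint p a F x = wint p a (EK p 1 a K) x"
  proof (cases "a = 0")
    case False
    then show ?thesis unfolding wint_def using EK_cong_AE[OF p1 _ order_refl TrepD(2)[OF F] EL K(2), of a] a0 by simp
  qed (use K in \<open>simp add: wint_def\<close>)
  with TrepD(3)[OF F] wint_plus_1[OF p1 a0 K(1)] have "AE x in lborel. f x = wint p (a + 1) K x"
    by eventually_elim simp
  then have "Trep (a + 1) p f K" using TrepD(1)[OF F] K(1) by (simp add: Trep_def)
  then show "f \<in> Tsp (a + 1) p" using Tsp_iff[OF p1 a1] by blast
next
  have a1: "0 \<le> a + 1" using a0 by simp
  fix f assume "f \<in> Tsp (a + 1) p"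
  then obtain K where K: "Trep (a + 1) p f K" using Tsp_iff[OF p1 a1] by blast
  note T = TrepD[OF K]
  have EL: "EK p 1 a K \<in> Lp p" by (rule EK_Lp[OF p1 zero_less_one a0 T(2)])
  have F: "Trep a p f (EK p 1 a K)"
    unfolding Trep_def using T(1) EL T(3) wint_plus_1[OF p1 a0 T(2)] by (auto elim: eventually_elim2)
  define H where "H x = K x - of_real (a + 1 / p) * EK p 1 a K x" for x
  have G: "Lgen p (EK p 1 a K) H" unfolding H_def by (rule Lgen_EK_1[OF p1 a0 T(2)])
  have "is_gen a p f (wint p a H)"
    using is_gen_rep[OF p1 a0 F Trep_wint[OF p1 a0 LgenD(2)[OF p1 G]]] G by simp
  then show "f \<in> gen_domain a p" by (auto simp: gen_domain_def)
qed

lemma dil_c0_group: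
  assumes p1: "1 \<le> p" and a0: "0 \<le> a"
  shows "c0_group_isom a p (dil p)"
  unfolding c0_group_isom_def
proof (intro conjI allI ballI)
  fix t f assume "f \<in> Tsp a p"
  then obtain F where F: "Trep a p f F" using Tsp_iff[OF p1 a0] by blast
  then show "dil p t f \<in> Tsp a p" using Tsp_iff[OF p1 a0] Trep_dil[OF p1 a0 F] by blast
  show "Tnorm a p (dil p t f) = Tnorm a p f"
    by (simp add: Tnorm_rep[OF p1 a0 F] Tnorm_rep[OF p1 a0 Trep_dil[OF p1 a0 F]] Lnorm_dil[OF p1])
next
  fix f assume "f \<in> Tsp a p"
  then obtain F where F: "Trep a p f F" using Tsp_iff[OF p1 a0] by blast
  show "((\<lambda>t. Tnorm a p (\<lambda>s. dil p t f s - f s)) \<longlongrightarrow> 0) (at 0)"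
    unfolding Tnorm_rep[OF p1 a0 Trep_diff[OF p1 a0 Trep_dil[OF p1 a0 F] F]]
    by (rule tendsto_mult_right_zero[OF dil_tendsto[OF p1 TrepD(2)[OF F]]])
qed (simp_all add: dil_0[OF p1] dil_dil[OF p1])

lemma point_spectrum_empty:
  assumes p1: "1 \<le> p" and a0: "0 \<le> a"
  shows "point_spectrum a p = {}"
proof -
  have "AE x in lborel. f x = 0" if "is_gen a p f h" "AE x in lborel. h x = z * f x" for f h z
    using Lgen_eigen[OF p1 is_gen_imp_Lgen[OF p1 a0 that(1)] that(2)] .
  then show ?thesis unfolding point_spectrum_def by blast
qed

lemma Tnorm_resolvent:
  assumes p1: "1 \<le> p" and a0: "0 \<le> a" and f: "Trep a p f F" and h: "Trep a p h H"
  shows "Tnorm a p (\<lambda>x. z * f x - h x) = 1 / Gamma (a + 1) * Lnorm p (\<lambda>x. z * F x - H x)"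
  using Tnorm_rep[OF p1 a0 Trep_linear[OF p1 a0 f h, of z "-1"]] by simp

text \<open>Off the imaginary axis, one average supplies both a solution and the norm bound. On the
  axis every bound C fails: the approximate eigenvectors of L^p are lifted by \<open>wint\<close>,
  which multiplies all norms by the same 1/Gamma(a + 1).\<close>

lemma resolvent_set_eq:
  assumes p1: "1 \<le> p" and a0: "0 \<le> a"
  shows "resolvent_set a p = {z. Re z \<noteq> 0}"
proof (intro equalityI subsetI CollectI)
  fix z assume z: "z \<in> {z. Re z \<noteq> 0}"
  then have rz: "Re z \<noteq> 0" by simp
  have 1: "\<exists>f h. is_gen a p f h \<and> (AE x in lborel. z * f x - h x = g x)" if g: "g \<in> Tsp a p" for g
  proof -
    obtain G where G: "Trep a p g G" using g Tsp_iff[OF p1 a0] by blast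
    note T = TrepD[OF G]
    define F where "F = conv p (rk z) G"
    define H where "H x = z * F x - G x" for x
    have gen: "Lgen p F H" unfolding F_def H_def by (rule Lgen_resolvent[OF p1 rz T(2)])
    note FH = Trep_wint[OF p1 a0 LgenD(1)[OF p1 gen]] Trep_wint[OF p1 a0 LgenD(2)[OF p1 gen]]
    have "Trep a p (\<lambda>x. z * wint p a F x + (-1) * wint p a H x) (\<lambda>x. z * F x + (-1) * H x)"
      by (rule Trep_linear[OF p1 a0 FH])
    moreover have "(\<lambda>x. z * F x + (-1) * H x) = G" by (simp add: H_def)
    ultimately have "AE x in lborel. z * wint p a F x - wint p a H x = wint p a G x" by (simp add: Trep_def)
    with T(3) have "AE x in lborel. z * wint p a F x - wint p a H x = g x" by eventually_elim simp
    then show ?thesis using is_gen_rep[OF p1 a0 FH] gen by blast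
  qed
  have 2: "AE x in lborel. f x = 0" if "is_gen a p f h" "AE x in lborel. z * f x - h x = 0" for f h
  proof -
    have "AE x in lborel. h x = z * f x" using that(2) by eventually_elim simp
    then show ?thesis by (rule Lgen_eigen[OF p1 is_gen_imp_Lgen[OF p1 a0 that(1)]])
  qed
  have 3: "Tnorm a p f \<le> (LINT t|lborel. norm (rk z t)) * Tnorm a p (\<lambda>x. z * f x - h x)" if ig: "is_gen a p f h" for f h
  proof -
    obtain F H where FH: "Trep a p f F" "Trep a p h H" and gen: "Lgen p F H" using is_gen_imp_rep[OF p1 a0 ig] .
    note L = LgenD[OF p1 gen]
    have K: "(\<lambda>x. z * F x - H x) \<in> Lp p" by (intro Lp_diff Lp_scale p1 L)
    have "Lnorm p F = Lnorm p (conv p (rk z) (\<lambda>x. z * F x - H x))"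
      by (rule Lnorm_cong_AE[OF Lgen_inverse[OF p1 rz gen] Lp_measurable[OF L(1)] Lp_measurable[OF conv_Lp[OF p1 rk_integrable[OF rz] K]]])
    also have "\<dots> \<le> (LINT t|lborel. norm (rk z t)) * Lnorm p (\<lambda>x. z * F x - H x)"
      by (rule Lnorm_conv[OF p1 rk_integrable[OF rz] K])
    finally have "1 / Gamma (a + 1) * Lnorm p F \<le> 1 / Gamma (a + 1) * ((LINT t|lborel. norm (rk z t)) * Lnorm p (\<lambda>x. z * F x - H x))"
      using Gamma_pos[OF p1 a0] by (intro mult_left_mono) auto
    then show ?thesis unfolding Tnorm_rep[OF p1 a0 FH(1)] Tnorm_resolvent[OF p1 a0 FH] by (simp only: mult.left_commute)
  qed
  show "z \<in> resolvent_set a p"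
    unfolding resolvent_set_def using 1 2 3 by blast
next
  fix z assume z: "z \<in> resolvent_set a p"
  show "Re z \<noteq> 0"
  proof
    assume "Re z = 0"
    then have zi: "z = \<i> * of_real (Im z)" by (simp add: complex_eq_iff)
    from z obtain C where C: "\<And>f h. is_gen a p f h \<Longrightarrow> Tnorm a p f \<le> C * Tnorm a p (\<lambda>x. z * f x - h x)"
      unfolding resolvent_set_def by blast
    obtain F H where gen: "Lgen p F H" and lt: "C * Lnorm p (\<lambda>x. z * F x - H x) < Lnorm p F"
      using approximate_eigenvalue[OF p1, of C "Im z"] zi by auto
    note FH = Trep_wint[OF p1 a0 LgenD(1)[OF p1 gen]] Trep_wint[OF p1 a0 LgenD(2)[OF p1 gen]]
    have "Tnorm a p (wint p a F) \<le> C * Tnorm a p (\<lambda>x. z * wint p a F x - wint p a H x)"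
      using is_gen_rep[OF p1 a0 FH] gen by (intro C) simp
    then have "1 / Gamma (a + 1) * Lnorm p F \<le> 1 / Gamma (a + 1) * (C * Lnorm p (\<lambda>x. z * F x - H x))"
      unfolding Tnorm_rep[OF p1 a0 FH(1)] Tnorm_resolvent[OF p1 a0 FH] by (simp only: mult.left_commute)
    then have "Lnorm p F \<le> C * Lnorm p (\<lambda>x. z * F x - H x)"
      using Gamma_pos[OF p1 a0] by (simp only: mult_le_cancel_left_pos divide_pos_pos zero_less_one)
    with lt show False by simp
  qed
qed

text \<open>Both elements are replaced by their representatives in L^p and L^q, where the identity
  is a change of variables; the sign of t plays no part in it.\<close>

lemma dil_dual:
  assumes p: "1 < p" and pq: "1 / p + 1 / q = 1" and a0: "0 \<le> a" and f: "f \<in> Tsp a p" and g: "g \<in> Tsp a q"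
  shows "Tpair a p q (dil p t f) g = Tpair a p q f (dil q (- t) g)"
proof -
  have "0 < 1 / p" "1 / p < 1" using p by simp_all
  then have "0 < 1 / q" "1 / q < 1" using pq by linarith+
  then have q: "1 < q" by (simp add: divide_less_eq)
  have p1: "1 \<le> p" and q1: "1 \<le> q" using p q by auto
  obtain F G where F: "Trep a p f F" and G: "Trep a q g G" using f g Tsp_iff[OF p1 a0] Tsp_iff[OF q1 a0] by blast
  show ?thesis
    unfolding Tpair_rep[OF p q pq a0 Trep_dil[OF p1 a0 F] G] Tpair_rep[OF p q pq a0 F Trep_dil[OF q1 a0 G]]
    by (simp only: dil_adjoint[OF pq])
qed

theorem theorem4p4:
  fixes p \<alpha> :: real
  assumes "1 \<le> p" and "0 \<le> \<alpha>"
  shows "c0_group_isom \<alpha> p (dil p) \<and>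
         gen_domain \<alpha> p = Tsp (\<alpha> + 1) p \<and>
         (\<forall>f h. is_gen \<alpha> p f h \<longrightarrow> gen_formula p f h) \<and>
         point_spectrum \<alpha> p = {} \<and>
         spectrum_gen \<alpha> p = {z. Re z = 0} \<and>
         (1 < p \<longrightarrow> (\<forall>q. 1 / p + 1 / q = 1 \<longrightarrow>
            (\<forall>t\<ge>0. \<forall>f\<in>Tsp \<alpha> p. \<forall>g\<in>Tsp \<alpha> q.
               Tpair \<alpha> p q (dil p t f) g = Tpair \<alpha> p q f (dil q (- t) g))))"
proof (intro conjI allI impI ballI)
  show "gen_formula p f h" if "is_gen \<alpha> p f h" for f h
    by (rule Lgen_formula[OF assms(1) is_gen_imp_Lgen[OF assms that]])
  show "spectrum_gen \<alpha> p = {z. Re z = 0}"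
    unfolding spectrum_gen_def resolvent_set_eq[OF assms] by auto
  show "Tpair \<alpha> p q (dil p t f) g = Tpair \<alpha> p q f (dil q (- t) g)"
    if "1 < p" "1 / p + 1 / q = 1" "f \<in> Tsp \<alpha> p" "g \<in> Tsp \<alpha> q" for q t f g
    by (rule dil_dual[OF that(1,2) assms(2) that(3,4)])
qed (rule dil_c0_group gen_domain_eq point_spectrum_empty assms)+

end
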